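(* Let $p$ be a positive natural number and let $V$ be a real Hilbert space (possibly infinite dimensional) with $\dim(V)\ge 2p$. Consider a $2p$-dimensional real Hilbert space $W$ and an isometric linear embedding $i:W\to V$. Then $i$ induces an isometric embedding $$i_*:\mathbf{St}(p,W)\to\mathbf{St}(p,V),\qquad x\mapsto i\circ x,$$ and the following hold. (1) $i_*(\mathbf{St}(p,W))$ is totally geodesic in $\mathbf{St}(p,V)$. (2) Let $d_W$ be the distance in $\mathbf{St}(p,W)$ and $d_V$ the distance in $\mathbf{St}(p,V)$. Then $d_W(x,y)=d_V(i_*(x),i_*(y))$ for all $x,y\in\mathbf{St}(p,W)$. (3) Let $x,y\in\mathbf{St}(p,W)$ and let $\gamma$ be a minimal geodesic connecting $x$ to $y$ in $\mathbf{St}(p,W)$. Then $i_*\circ\gamma$ is a minimal geodesic connecting $i_*(x)$ to $i_*(y)$ in $\mathbf{St}(p,V)$. (4) The diameter of $\mathbf{St}(p,V)$ is equal to the diameter of $\mathbf{St}(p,\mathbb{R}^{2p})$. (5) Any two points $x,y\in\mathbf{St}(p,V)$ can be connected by a minimal geodesic. Any minimal geodesic $\gamma$ in $\mathbf{St}(p,V)$ lies in $\mathbf{St}(p,U)$ for some $2p$-dimensional subspace $U$ of $V$ (dependent on $\gamma$). (6) Let $x,y\in\mathbf{St}(p,V)$. Then $y$ is in the cut locus of $x$ (in $\mathbf{St}(p,V)$) if and only if there are a $2p$-dimensional subspace $W'$ of $V$, with inclusion $j:W'\to V$, and $\tilde x,\tilde y\in\mathbf{St}(p,W')$ such that $x=j_*(\tilde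 x)$, $y=j_*(\tilde y)$ and $\tilde y$ is in the cut locus of $\tilde x$ in $\mathbf{St}(p,W')$.
   Context: For a real Hilbert space $V$, $\mathbf{St}(p,V)=\{x\in L(\mathbb{R}^p,V): x^\top\circ x=\mathrm{Id}_{\mathbb{R}^p}\}$ is the Stiefel manifold of linear isometric immersions of $\mathbb{R}^p$ into $V$ (equivalently, orthonormal frames of $p$ vectors in $V$), where $x^\top\in L(V,\mathbb{R}^p)$ is the transpose, defined by $\langle x^\top(v),r\rangle_{\mathbb{R}^p}=\langle v,x(r)\rangle_V$ for all $v\in V$, $r\in\mathbb{R}^p$. It is a smooth embedded submanifold of $V^p\cong L(\mathbb{R}^p,V)$ and carries the induced Riemannian metric $\langle x,y\rangle=\operatorname{tr}(x^\top y)$. For a subspace $U\subseteq V$, $\mathbf{St}(p,U)$ is viewed as a subset of $\mathbf{St}(p,V)$ via the inclusion. In a Riemannian manifold, the distance $d(x,y)$ is the infimum of the lengths $\operatorname{len}$ of all (smooth, or equivalently absolutely continuous) paths connecting $x$ to $y$; the diameter is the supremum of $d$. A critical geodesic is a curve $\gamma$ with $\nabla_{\partial_t}\dot\gamma=0$. A minimal geodesic is a path $\gamma:[0,1]\to M$ whose length equals $d(\gamma(0),\gamma(1))$; minimal geodesics are always assumed parametrized so that they are critical geodesics. A point $y$ is in the cut locus of $x$ if there is a critical geodesic $\gamma$, defined for all times $t\ge 0$, with $\gamma(0)=x$, $\gamma(1)=y$ such that $\sup\{t:\operatorname{len}(\gamma|_{[0,t]})=d(\gamma(0),\gamma(t))\}=1$.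 *)

theory Defs
  imports "HOL-Analysis.Analysis"
begin

section \<open>Riemannian geometry of embedded submanifolds of an inner product space\<close>

text \<open>
  A Riemannian manifold is represented by a subset \<open>M\<close> of a real inner product space that is an
  embedded submanifold, with the metric induced by the ambient inner product. Smooth curves in
  \<open>M\<close> are then the ambient smooth curves with values in \<open>M\<close>.
\<close>

text \<open>Derivatives are taken within \<open>I\<close>, hence are one-sided at endpoints contained in \<open>I\<close>;
  \<open>I\<close> is meant to be an interval with more than one point.\<close>

definition smooth_curve_on :: "real set \<Rightarrow> (real \<Rightarrow> 'a::real_normed_vector) \<Rightarrow> bool" where
  "smooth_curve_on I \<gamma> \<longleftrightarrow>
     (\<exists>F::nat \<Rightarrow> real \<Rightarrow> 'a. F 0 = \<gamma> \<and>
        (\<forall>n. \<forall>t\<in>I. (F n has_vector_derivative F (Suc n) t) (at t within I)))"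

definition velocity :: "real set \<Rightarrow> (real \<Rightarrow> 'a::real_normed_vector) \<Rightarrow> real \<Rightarrow> 'a" where
  "velocity I \<gamma> t = vector_derivative \<gamma> (at t within I)"

definition tangent_space :: "'a::real_normed_vector set \<Rightarrow> 'a \<Rightarrow> 'a set" where
  "tangent_space M x =
     {v. \<exists>\<epsilon> c. 0 < \<epsilon> \<and> smooth_curve_on {-\<epsilon><..<\<epsilon>} c \<and> c ` {-\<epsilon><..<\<epsilon>} \<subseteq> M \<and> c 0 = x \<and>
          (c has_vector_derivative v) (at 0)}"

definition curve_length :: "(real \<Rightarrow> 'a::real_normed_vector) \<Rightarrow> real \<Rightarrow> real \<Rightarrow> real" where
  "curve_length \<gamma> a b = integral {a..b} (\<lambda>t. norm (velocity {a..b} \<gamma> t))"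

definition smooth_paths :: "'a::real_normed_vector set \<Rightarrow> 'a \<Rightarrow> 'a \<Rightarrow> (real \<Rightarrow> 'a) set" where
  "smooth_paths M x y =
     {\<gamma>. smooth_curve_on {0..1} \<gamma> \<and> \<gamma> ` {0..1} \<subseteq> M \<and> \<gamma> 0 = x \<and> \<gamma> 1 = y}"

text \<open>Extended non-negative values make the infimum over an empty set of paths infinite, and an
  unbounded supremum infinite, instead of unspecified.\<close>

definition riem_dist :: "'a::real_normed_vector set \<Rightarrow> 'a \<Rightarrow> 'a \<Rightarrow> ennreal" where
  "riem_dist M x y = (INF \<gamma>\<in>smooth_paths M x y. ennreal (curve_length \<gamma> 0 1))"

definition riem_diameter :: "'a::real_normed_vector set \<Rightarrow> ennreal" where
  "riem_diameter M = (SUP x\<in>M. SUP y\<in>M. riem_dist M x y)"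

text \<open>The Levi-Civita derivative of the induced metric: for a vector field \<open>X\<close> along the curve
  \<open>\<gamma>\<close> in \<open>M\<close>, the covariant derivative at time \<open>t\<close> is the orthogonal projection \<open>w\<close> of the
  ambient derivative \<open>D\<close> of \<open>X\<close> to the tangent space of \<open>M\<close> at \<open>\<gamma> t\<close>.\<close>

definition has_covariant_derivative ::
  "'a::real_inner set \<Rightarrow> real set \<Rightarrow> (real \<Rightarrow> 'a) \<Rightarrow> (real \<Rightarrow> 'a) \<Rightarrow> real \<Rightarrow> 'a \<Rightarrow> bool" where
  "has_covariant_derivative M I \<gamma> X t w \<longleftrightarrow>
     w \<in> tangent_space M (\<gamma> t) \<and>
     (\<exists>D. (X has_vector_derivative D) (at t within I) \<and>
          (\<forall>u\<in>tangent_space M (\<gamma> t). (D - w) \<bullet> u = 0))"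

definition critical_geodesic :: "'a::real_inner set \<Rightarrow> real set \<Rightarrow> (real \<Rightarrow> 'a) \<Rightarrow> bool" where
  "critical_geodesic M I \<gamma> \<longleftrightarrow>
     smooth_curve_on I \<gamma> \<and> \<gamma> ` I \<subseteq> M \<and>
     (\<forall>t\<in>I. has_covariant_derivative M I \<gamma> (velocity I \<gamma>) t 0)"

text \<open>Minimal geodesics are by convention parametrized as critical geodesics on the unit
  interval.\<close>

definition minimal_geodesic :: "'a::real_inner set \<Rightarrow> 'a \<Rightarrow> 'a \<Rightarrow> (real \<Rightarrow> 'a) \<Rightarrow> bool" where
  "minimal_geodesic M x y \<gamma> \<longleftrightarrow>
     critical_geodesic M {0..1} \<gamma> \<and> \<gamma> 0 = x \<and> \<gamma> 1 = y \<and>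
     ennreal (curve_length \<gamma> 0 1) = riem_dist M x y"

text \<open>The supremum is taken in the extended reals, so that it is infinite if the geodesic is
  minimizing for all times.\<close>

definition in_cut_locus :: "'a::real_inner set \<Rightarrow> 'a \<Rightarrow> 'a \<Rightarrow> bool" where
  "in_cut_locus M x y \<longleftrightarrow>
     (\<exists>\<gamma>. critical_geodesic M {0..} \<gamma> \<and> \<gamma> 0 = x \<and> \<gamma> 1 = y \<and>
        (SUP t\<in>{t. 0 \<le> t \<and> ennreal (curve_length \<gamma> 0 t) = riem_dist M (\<gamma> 0) (\<gamma> t)}. ereal t) = 1)"

definition totally_geodesic :: "'a::real_inner set \<Rightarrow> 'a set \<Rightarrow> bool" where
  "totally_geodesic N M \<longleftrightarrow>
     N \<subseteq> M \<and>
     (\<forall>I \<gamma>. is_interval I \<and> interior I \<noteq> {} \<and> critical_geodesic N I \<gamma> \<longrightarrow>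
            critical_geodesic M I \<gamma>)"

primrec differentiable_times_on ::
  "nat \<Rightarrow> 'a::real_normed_vector set \<Rightarrow> ('a \<Rightarrow> 'b::real_normed_vector) \<Rightarrow> bool" where
  "differentiable_times_on 0 S f = continuous_on S f"
| "differentiable_times_on (Suc n) S f =
     ((\<forall>x\<in>S. f differentiable (at x)) \<and>
      (\<forall>v. differentiable_times_on n S (\<lambda>x. frechet_derivative f (at x) v)))"

text \<open>Smoothness on an open set \<open>S\<close>.\<close>

definition smooth_map_on ::
  "'a::real_normed_vector set \<Rightarrow> ('a \<Rightarrow> 'b::real_normed_vector) \<Rightarrow> bool" where
  "smooth_map_on S f \<longleftrightarrow> (\<forall>n. differentiable_times_on n S f)"

text \<open>A map between submanifolds is smooth iff it is locally the restriction of a smooth map \<open>g\<close>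
  of the ambient spaces; its differential at \<open>x\<close> is the restriction of that of \<open>g\<close> to the tangent
  space. Preservation of the metric makes the map an immersion.\<close>

definition isometric_embedding ::
  "'a::real_inner set \<Rightarrow> 'b::real_inner set \<Rightarrow> ('a \<Rightarrow> 'b) \<Rightarrow> bool" where
  "isometric_embedding M N f \<longleftrightarrow>
     f ` M \<subseteq> N \<and>
     (\<exists>h. homeomorphism M (f ` M) f h) \<and>
     (\<forall>x\<in>M. \<exists>S g. open S \<and> x \<in> S \<and> smooth_map_on S g \<and> (\<forall>y\<in>S \<inter> M. g y = f y) \<and>
        (\<forall>v\<in>tangent_space M x. \<forall>w\<in>tangent_space M x.
           frechet_derivative g (at x) v \<bullet> frechet_derivative g (at x) w = v \<bullet> w))"


section \<open>The Stiefel manifold\<close>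

text \<open>Linear maps from \<open>\<real>\<^sup>p\<close> to \<open>V\<close> are identified with \<open>V\<^sup>p\<close>, the tuple \<open>x\<close> consisting of the
  images of the standard basis vectors. The transpose is the library's \<open>adjoint\<close>.\<close>

definition frame_map :: "'v::real_inner ^ 'p::finite \<Rightarrow> real ^ 'p \<Rightarrow> 'v" where
  "frame_map x r = (\<Sum>k\<in>UNIV. (r $ k) *\<^sub>R (x $ k))"

text \<open>For a linear subspace \<open>U\<close>, \<open>Stiefel U\<close> is \<open>St(p,U)\<close> included into \<open>V\<^sup>p\<close>; the manifold
  \<open>St(p,V)\<close> is \<open>Stiefel UNIV\<close>.\<close>

definition Stiefel :: "'v::real_inner set \<Rightarrow> ('v ^ 'p::finite) set" where
  "Stiefel U = {x. range (frame_map x) \<subseteq> U \<and> adjoint (frame_map x) \<circ> frame_map x = id}"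

definition induced_map :: "('w \<Rightarrow> 'v) \<Rightarrow> 'w ^ 'p::finite \<Rightarrow> 'v ^ 'p" where
  "induced_map i x = (\<chi> k. i (x $ k))"

lemma linear_frame_map: "linear (frame_map x)"
  by (rule linearI) (simp_all add: frame_map_def scaleR_add_left sum.distrib scaleR_sum_right)

lemma frame_map_axis: "frame_map x (axis k 1) = x $ k"
  by (simp add: frame_map_def axis_def if_distrib[of "\<lambda>c. c *\<^sub>R _"] cong: if_cong)

lemma frame_map_ex1:
  assumes "linear f"
  shows "\<exists>!x. frame_map x = f"
proof
  show "frame_map (\<chi> k. f (axis k 1)) = f"
  proof
    fix r :: "real ^ 'a"
    have "f r = f (\<Sum>k\<in>UNIV. (r $ k) *\<^sub>R axis k 1)"
      using basis_expansion[of r] by (simp add: scalar_mult_eq_scaleR)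
    then show "frame_map (\<chi> k. f (axis k 1)) r = f r"
      by (simp add: frame_map_def linear_sum[OF assms] linear_scale[OF assms])
  qed
next
  fix x assume "frame_map x = f"
  then have "x $ k = f (axis k 1)" for k
    using frame_map_axis[of x k] by simp
  then show "x = (\<chi> k. f (axis k 1))"
    by (simp add: vec_eq_iff)
qed

lemma frame_map_induced_map:
  assumes "linear i"
  shows "frame_map (induced_map i x) = i \<circ> frame_map x"
  by (rule ext) (simp add: frame_map_def induced_map_def linear_sum[OF assms] linear_scale[OF assms])

lemma adjoint_frame_map: "adjoint (frame_map x) = (\<lambda>v. \<chi> k. v \<bullet> x $ k)"
proof (rule adjoint_unique, intro allI)
  fix r v
  show "frame_map x r \<bullet> v = r \<bullet> (\<chi> k. v \<bullet> x $ k)"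
    unfolding inner_commute[of "frame_map x r" v]
    by (simp add: frame_map_def inner_vec_def inner_sum_right)
qed

lemma adjoint_frame_map_works: "adjoint (frame_map x) v \<bullet> r = v \<bullet> frame_map x r"
  by (simp add: adjoint_frame_map frame_map_def inner_vec_def inner_sum_right mult.commute)

text \<open>The ambient inner product of \<open>V\<^sup>p\<close> is the metric \<open>tr(x\<^sup>T y)\<close>.\<close>

lemma inner_eq_trace:
  fixes x y :: "'v::real_inner ^ 'p::finite"
  shows "x \<bullet> y = trace (matrix (adjoint (frame_map x) \<circ> frame_map y))"
  by (simp add: trace_def matrix_def adjoint_frame_map frame_map_axis inner_vec_def inner_commute)

lemma Stiefel_iff_orthonormal:
  fixes x :: "'v::real_inner ^ 'p::finite"
  shows "x \<in> Stiefel UNIV \<longleftrightarrow> (\<forall>j k. x $ j \<bullet> x $ k = (if j = k then 1 else 0))"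
proof
  assume "x \<in> Stiefel UNIV"
  then have "adjoint (frame_map x) (frame_map x (axis j 1)) = axis j 1" for j
    by (simp add: Stiefel_def fun_eq_iff)
  then have "x $ j \<bullet> x $ k = axis j 1 $ k" for j k
    by (simp add: adjoint_frame_map frame_map_axis vec_eq_iff)
  then show "\<forall>j k. x $ j \<bullet> x $ k = (if j = k then 1 else 0)"
    by (auto simp: axis_def)
next
  assume *: "\<forall>j k. x $ j \<bullet> x $ k = (if j = k then 1 else 0)"
  have "adjoint (frame_map x) (frame_map x r) $ k = r $ k" for r k
    by (simp add: adjoint_frame_map frame_map_def inner_sum_left * if_distrib cong: if_cong)
  then show "x \<in> Stiefel UNIV"
    by (simp add: Stiefel_def fun_eq_iff vec_eq_iff)
qed

end

theory Submission
  imports Defs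
begin

text \<open>
  Write a frame \<open>x\<close> as a linear map \<open>\<real>\<^sup>p \<rightarrow> V\<close> and \<open>x\<^sup>T\<close> for its transpose. A critical geodesic
  \<open>\<gamma>\<close> of the Stiefel manifold satisfies \<open>\<gamma>'' = - \<gamma> (\<gamma>'\<^sup>T \<gamma>')\<close>, and this equation has two conserved
  quantities, the skew operator \<open>\<gamma>' \<gamma>\<^sup>T - \<gamma> \<gamma>'\<^sup>T\<close> on \<open>V\<close> and the skew matrix \<open>\<gamma>\<^sup>T \<gamma>'\<close>. They
  combine into one skew linear operator on \<open>V\<^sup>p\<close>, \<open>generator\<close>, such that \<open>\<gamma>\<close> solves the
  linear equation \<open>\<gamma>' = generator (\<gamma> s) (\<gamma>' s) \<gamma>\<close> with constant coefficients. Hence \<open>\<gamma>\<close> never leaves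
  the span of the \<open>2p\<close> vectors that make up \<open>\<gamma> s\<close> and \<open>\<gamma>' s\<close>. The geodesic equation does not
  mention the subspace in which the frames are taken, so a geodesic of \<open>St(p,U)\<close> is one of
  \<open>St(p,V)\<close>; this is total geodesy, and it reduces every statement to one fact
  (\<open>Stiefel_minimal_geodesic\<close>): for \<open>U\<close> of dimension \<open>2p\<close>, any two points of \<open>St(p,U)\<close> are joined by
  a geodesic of \<open>St(p,U)\<close> whose length is their distance in \<open>St(p,V)\<close>.

  That fact is proved by discretization. A path of length \<open>L\<close> carries, for each \<open>N\<close>, an
  inscribed polygon with \<open>N\<close> edges and energy (sum of squared edge lengths) at most \<open>L\<^sup>2 / N\<close>.
  Its vertices span a finite-dimensional space, so compactness gives a polygon of least energy with the
  same endpoints. Stationarity at an inner vertex says that the sum of its two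
  neighbours is the vertex times a symmetric matrix. This recursion keeps the minimizer inside the span of
  its first two vertices, which has dimension at most \<open>2p\<close>, so a linear isometry fixing both
  endpoints moves it into \<open>St(p,U)\<close> (\<open>discrete_geodesic_within\<close>). The recursion also conserves
  \<open>generator (z j) (z (j+1))\<close>, which turns the minimizing polygon into an Euler scheme for the linear
  geodesic equation, with an error per step that is quadratic in the edge. Along a subsequence the initial
  velocities converge, and the polygons converge to a geodesic of length at most \<open>L\<close>
  (\<open>discrete_geodesics_converge\<close>). Taking paths whose lengths tend to the distance gives a
  minimal geodesic; that some path exists at all follows from the same argument applied to a
  Lipschitz path made of plane rotations (\<open>Stiefel_lipschitz_connected\<close>).
\<close>


section \<open>Orthonormal sets and finite-dimensional subspaces\<close>

definition orthonormal :: "'a::real_inner set \<Rightarrow> bool" where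
  "orthonormal C \<longleftrightarrow> finite C \<and> (\<forall>b\<in>C. \<forall>c\<in>C. b \<bullet> c = (if b = c then 1 else 0))"

text \<open>For orthonormal \<open>C\<close> this is the orthogonal projection to the span of \<open>C\<close>.\<close>

definition orth_proj :: "'a::real_inner set \<Rightarrow> 'a \<Rightarrow> 'a" where
  "orth_proj C v = (\<Sum>c\<in>C. (v \<bullet> c) *\<^sub>R c)"

lemma orthonormal_finite: "orthonormal C \<Longrightarrow> finite C"
  by (simp add: orthonormal_def)

lemma orthonormal_subset: "orthonormal C \<Longrightarrow> D \<subseteq> C \<Longrightarrow> orthonormal D"
  unfolding orthonormal_def by (meson finite_subset subsetD)

lemma orthonormal_Basis: "orthonormal (Basis :: 'a::euclidean_space set)"
  by (simp add: orthonormal_def inner_Basis)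

lemma orth_proj_in_span: "orth_proj C v \<in> span C"
  unfolding orth_proj_def by (intro span_sum span_scale span_base)

lemma bounded_linear_orth_proj: "bounded_linear (orth_proj C)"
  unfolding orth_proj_def
  by (intro bounded_linear_sum bounded_linear_scaleR_const bounded_linear_inner_left)

lemma inner_orth_proj:
  assumes "orthonormal C" "c \<in> C"
  shows "orth_proj C v \<bullet> c = v \<bullet> c"
proof -
  have "orth_proj C v \<bullet> c = (\<Sum>b\<in>C. (v \<bullet> b) * (if b = c then 1 else 0))"
    using assms by (auto simp: orth_proj_def inner_sum_left orthonormal_def intro!: sum.cong)
  also have "\<dots> = v \<bullet> c"
    using assms by (simp add: orthonormal_def if_distrib sum.delta cong: if_cong)
  finally show ?thesis .
qed

lemma orth_proj_fixes_span:
  assumes C: "orthonormal C" and v: "v \<in> span C"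
  shows "orth_proj C v = v"
proof -
  have "(orth_proj C v - v) \<bullet> w = 0" if "w \<in> span C" for w
    using that
  proof (induction rule: span_induct_alt)
    case (step c b w)
    then show ?case
      using inner_orth_proj[OF C, of b v] by (simp add: inner_add_right inner_diff_left)
  qed simp
  from this[OF span_diff[OF orth_proj_in_span v]] show ?thesis
    by (metis inner_eq_zero_iff right_minus_eq)
qed

lemma orthonormal_independent:
  assumes "orthonormal C"
  shows "independent C"
proof (rule pairwise_orthogonal_independent)
  show "pairwise orthogonal C"
    using assms by (auto simp: orthonormal_def pairwise_def orthogonal_def)
  show "0 \<notin> C"
    using assms by (metis inner_zero_left orthonormal_def zero_neq_one)
qed

lemma dim_span_orthonormal: "orthonormal C \<Longrightarrow> dim (span C) = card C"
  by (intro dim_span_eq_card_independent orthonormal_independent)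

text \<open>One Gram-Schmidt step; nothing is added if \<open>a\<close> is already in the span.\<close>

lemma orthonormal_insert_direction:
  assumes C: "orthonormal C"
  shows "\<exists>D. orthonormal D \<and> C \<subseteq> D \<and> span D = span (insert a C) \<and> card D \<le> Suc (card C)"
proof (cases "orth_proj C a = a")
  case True
  then have "a \<in> span C"
    by (metis orth_proj_in_span)
  then show ?thesis
    using C by (intro exI[of _ C]) (auto simp: span_redundant)
next
  case False
  define w where "w = a - orth_proj C a"
  define u where "u = w /\<^sub>R norm w"
  have w: "w \<noteq> 0" "w \<bullet> c = 0" if "c \<in> C" for c
    using False inner_orth_proj[OF C that, of a] by (auto simp: w_def inner_diff_left)
  have w0: "w \<noteq> 0"
    using False by (simp add: w_def)
  have uc: "u \<bullet> c = 0" "c \<bullet> u = 0" if "c \<in> C" for c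
    using w(2)[OF that] by (simp_all add: u_def inner_commute)
  have uu: "u \<bullet> u = 1"
    using w0 by (simp add: u_def power2_norm_eq_inner[symmetric] power2_eq_square)
  have "orthonormal (insert u C)"
    using C uc uu by (auto simp: orthonormal_def)
  moreover have "span (insert u C) = span (insert a C)"
  proof (rule span_eq[THEN iffD2], intro conjI subsetI)
    have pa: "orth_proj C a \<in> span (insert z C)" for z
      using orth_proj_in_span[of C a] span_mono[of C "insert z C"] by auto
    have u1: "u \<in> span (insert a C)"
      unfolding u_def w_def by (intro span_scale span_diff pa span_base) auto
    have "a = norm w *\<^sub>R u + orth_proj C a"
      using w0 by (simp add: u_def w_def)
    then have a1: "a \<in> span (insert u C)"
      using span_add[OF span_scale[OF span_base[of u "insert u C"]] pa[of u]] by (metis insertI1)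
    show "x \<in> span (insert a C)" if "x \<in> insert u C" for x
      using that u1 by (auto intro: span_base)
    show "x \<in> span (insert u C)" if "x \<in> insert a C" for x
      using that a1 by (auto intro: span_base)
  qed
  moreover have "card (insert u C) \<le> Suc (card C)"
    by (rule card_insert_le_m1[of "Suc (card C)", simplified]) auto
  ultimately show ?thesis
    by blast
qed

lemma orthonormal_extension:
  assumes "orthonormal C" "finite F"
  shows "\<exists>D. orthonormal D \<and> C \<subseteq> D \<and> span D = span (C \<union> F) \<and> card D \<le> card C + card F"
  using assms(2)
proof (induction F)
  case empty
  then show ?case using assms(1) by auto
next
  case (insert a F)
  then obtain D where D: "orthonormal D" "C \<subseteq> D" "span D = span (C \<union> F)" "card D \<le> card C + card F"
    by blast
  obtain D' where D': "orthonormal D'" "D \<subseteq> D'" "span D' = span (insert a D)" "card D' \<le> Suc (card D)"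
    using orthonormal_insert_direction[OF D(1)] by blast
  have "span (insert a D) = span (C \<union> insert a F)"
    unfolding span_insert using D(3) by (simp add: span_insert)
  then show ?case
    using D D' insert by (intro exI[of _ D']) auto
qed

lemma orthonormal_basis_exists:
  assumes "subspace U" "dim U = n" "0 < n"
  shows "\<exists>C. orthonormal C \<and> span C = U \<and> card C = n"
proof -
  obtain B where B: "B \<subseteq> U" "independent B" "U \<subseteq> span B" "card B = n"
    using basis_exists[of U] assms(2) by metis
  then have "finite B" "span B = U"
    using assms by (auto intro: card_ge_0_finite simp: span_minimal subset_antisym)
  then obtain C where "orthonormal C" "span C = U"
    using orthonormal_extension[of "{}" B] by (auto simp: orthonormal_def)
  then show ?thesis
    using dim_span_orthonormal assms(2) by metis
qed

lemma card_independent_le_orthonormal: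
  assumes "orthonormal D" "independent B" "B \<subseteq> span D"
  shows "card B \<le> card D"
  using independent_span_bound[OF orthonormal_finite[OF assms(1)] assms(2,3)] by simp

text \<open>A set of at most \<open>n\<close> vectors lies in an \<open>n\<close>-dimensional subspace as soon as the space has
  \<open>n\<close> independent vectors: orthonormalize, enlarge, and cut down to cardinality \<open>n\<close>.\<close>

lemma orthonormal_superset_of_card:
  fixes B F :: "'a::real_inner set"
  assumes B: "finite B" "independent B" "card B = n"
    and F: "finite F" "card F \<le> n"
  shows "\<exists>C. orthonormal C \<and> F \<subseteq> span C \<and> card C = n"
proof -
  obtain C where C: "orthonormal C" "span C = span F" "card C \<le> card F"
    using orthonormal_extension[of "{}" F] F by (auto simp: orthonormal_def)
  obtain D where D: "orthonormal D" "C \<subseteq> D" "span D = span (C \<union> B)"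
    using orthonormal_extension[OF C(1) B(1)] by blast
  have "card B \<le> card D"
    by (rule card_independent_le_orthonormal[OF D(1) B(2)]) (auto simp: D(3) intro: span_base)
  then obtain E where E: "C \<subseteq> E" "E \<subseteq> D" "card E = n"
    using exists_subset_between[of C n D] C(3) F(2) B(3) D orthonormal_finite by auto
  have "F \<subseteq> span E"
    using C(2) span_mono[OF E(1)] by (metis order_trans span_superset)
  then show ?thesis
    using E orthonormal_subset[OF D(1) E(2)] by blast
qed

text \<open>A map between orthonormal bases extends to the whole space by projecting first. On the span
  of \<open>C\<close> it is isometric by Parseval. This one construction yields parametrizations of subspaces by
  Euclidean spaces as well as isometries that fix a common subspace.\<close>

lemma orthonormal_transfer:
  assumes C: "orthonormal C" and D: "orthonormal D" and \<phi>: "inj_on \<phi> C" "\<phi> ` C \<subseteq> D"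
  shows "\<exists>T. bounded_linear T \<and> (\<forall>c\<in>C. T c = \<phi> c) \<and> range T \<subseteq> span D \<and>
             (\<forall>v\<in>span C. \<forall>w\<in>span C. T v \<bullet> T w = v \<bullet> w)"
proof -
  define T where "T v = (\<Sum>c\<in>C. (v \<bullet> c) *\<^sub>R \<phi> c)" for v
  have bl: "bounded_linear T"
    unfolding T_def
    by (intro bounded_linear_sum bounded_linear_scaleR_const bounded_linear_inner_left)
  have fC: "finite C" using C by (rule orthonormal_finite)
  have T: "T b = \<phi> b" if "b \<in> C" for b
  proof -
    have "T b = (\<Sum>c\<in>C. (if b = c then 1 else 0) *\<^sub>R \<phi> c)"
      using C that by (auto simp: T_def orthonormal_def intro!: sum.cong)
    also have "\<dots> = (\<Sum>c\<in>C. if b = c then \<phi> c else 0)"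
      by (auto intro!: sum.cong)
    finally show ?thesis using fC that by simp
  qed
  have \<phi>i: "\<phi> b \<bullet> \<phi> c = (if b = c then 1 else 0)" if "b \<in> C" "c \<in> C" for b c
    using that D \<phi> by (auto simp: orthonormal_def inj_on_def image_subset_iff)
  have in1: "T v \<bullet> \<phi> b = v \<bullet> b" if "b \<in> C" for v b
  proof -
    have "T v \<bullet> \<phi> b = (\<Sum>c\<in>C. (v \<bullet> c) * (if c = b then 1 else 0))"
      using \<phi>i that by (auto simp: T_def inner_sum_left intro!: sum.cong)
    then show ?thesis
      using fC that by (simp add: if_distrib cong: if_cong)
  qed
  have "T v \<bullet> T w = v \<bullet> w" if "w \<in> span C" for v w
  proof -
    have "T v \<bullet> T w = (\<Sum>c\<in>C. (w \<bullet> c) * (v \<bullet> c))"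
      by (subst (2) T_def) (simp add: inner_sum_right in1)
    also have "\<dots> = v \<bullet> orth_proj C w"
      by (simp add: orth_proj_def inner_sum_right)
    finally show ?thesis
      by (simp add: orth_proj_fixes_span[OF C that])
  qed
  moreover have "range T \<subseteq> span D"
  proof (intro image_subsetI)
    show "T v \<in> span D" for v
      unfolding T_def using \<phi>(2) by (intro span_sum span_scale span_base) auto
  qed
  ultimately show ?thesis
    using bl T by blast
qed

lemma closed_span_finite:
  assumes "finite F"
  shows "closed (span F :: 'a::real_inner set)"
proof -
  obtain C :: "'a set" where C: "orthonormal C" "span C = span F"
    using orthonormal_extension[of "{}" F] assms by (auto simp: orthonormal_def)
  have "span C = {v. orth_proj C v = v}"
    using orth_proj_fixes_span[OF C(1)] orth_proj_in_span[of C] by (auto, metis)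
  moreover have "closed {v. orth_proj C v = v}"
    by (intro closed_Collect_eq continuous_intros
        linear_continuous_on bounded_linear_orth_proj)
  ultimately show ?thesis
    using C(2) by simp
qed

text \<open>Bounded sets of coordinates are compact, one coordinate at a time, and \<open>S\<close> is a closed part of the
  image of such a set.\<close>

lemma compact_in_span:
  fixes S :: "'a::real_inner set"
  assumes F: "finite F" and S: "closed S" "bounded S" "S \<subseteq> span F"
  shows "compact S"
proof -
  obtain C :: "'a set" where C: "orthonormal C" "span C = span F"
    using orthonormal_extension[of "{}" F] F by (auto simp: orthonormal_def)
  obtain R where R: "\<And>v. v \<in> S \<Longrightarrow> norm v \<le> R"
    using S(2) by (auto simp: bounded_iff)
  define Q where "Q D = {\<Sum>c\<in>D. a c *\<^sub>R c | a. \<forall>c\<in>D. \<bar>a c\<bar> \<le> R}" for D :: "'a set"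
  have "compact (Q D)" if "finite D" for D
    using that
  proof (induction D)
    case empty
    show ?case by (simp add: Q_def)
  next
    case (insert b D)
    have "Q (insert b D) = (\<lambda>(r, v). r *\<^sub>R b + v) ` ({-R..R} \<times> Q D)" (is "?A = ?B")
    proof (intro subset_antisym subsetI)
      fix x assume "x \<in> ?A"
      then obtain a where a: "x = (\<Sum>c\<in>insert b D. a c *\<^sub>R c)" "\<forall>c\<in>insert b D. \<bar>a c\<bar> \<le> R"
        by (auto simp: Q_def)
      have "x = (\<lambda>(r, v). r *\<^sub>R b + v) (a b, \<Sum>c\<in>D. a c *\<^sub>R c)"
        using a insert by simp
      moreover have "(a b, \<Sum>c\<in>D. a c *\<^sub>R c) \<in> {-R..R} \<times> Q D"
        using a(2) by (auto simp: Q_def abs_le_iff)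
      ultimately show "x \<in> ?B" by (rule image_eqI)
    next
      fix x assume "x \<in> ?B"
      then obtain r s where "r \<in> {-R..R}" "s \<in> Q D" "x = r *\<^sub>R b + s"
        by auto
      then obtain a where ra: "\<bar>r\<bar> \<le> R" "\<forall>c\<in>D. \<bar>a c\<bar> \<le> R" "x = r *\<^sub>R b + (\<Sum>c\<in>D. a c *\<^sub>R c)"
        unfolding Q_def by auto
      have "x = (\<Sum>c\<in>insert b D. (a(b := r)) c *\<^sub>R c)"
      proof -
        have "(\<Sum>c\<in>D. (a(b := r)) c *\<^sub>R c) = (\<Sum>c\<in>D. a c *\<^sub>R c)"
          using insert(2) by (intro sum.cong) auto
        then show ?thesis using ra insert by simp
      qed
      moreover have "\<forall>c\<in>insert b D. \<bar>(a(b := r)) c\<bar> \<le> R"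
        using ra by auto
      ultimately show "x \<in> ?A"
        unfolding Q_def by blast
    qed
    moreover have "compact ?B"
      by (intro compact_continuous_image compact_Times insert)
        (auto simp: case_prod_beta intro!: continuous_intros)
    ultimately show ?case by simp
  qed
  then have "compact (Q C)"
    using C by (simp add: orthonormal_finite)
  moreover have "S \<subseteq> Q C"
  proof
    fix v assume v: "v \<in> S"
    have "v = (\<Sum>c\<in>C. (v \<bullet> c) *\<^sub>R c)"
      using orth_proj_fixes_span[OF C(1), of v] S(3) C(2) v by (auto simp: orth_proj_def)
    moreover have "\<bar>v \<bullet> c\<bar> \<le> R" if "c \<in> C" for c
    proof -
      have "norm c = 1"
        using C(1) that by (simp add: orthonormal_def norm_eq_sqrt_inner)
      then show ?thesis
        using Cauchy_Schwarz_ineq2[of v c] R[OF v] by simp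
    qed
    ultimately show "v \<in> Q C"
      unfolding Q_def by blast
  qed
  ultimately show ?thesis
    using S(1) by (metis compact_Int_closed inf.absorb_iff2)
qed


section \<open>Linear differential equations with a skew operator\<close>

text \<open>The derivative of \<open>u \<bullet> u\<close> is \<open>2 (A u) \<bullet> u = 0\<close>.\<close>

lemma skew_ode_norm_constant:
  fixes u :: "real \<Rightarrow> 'a::real_inner"
  assumes I: "is_interval I"
    and skew: "\<And>z. A z \<bullet> z = 0"
    and u: "\<And>t. t \<in> I \<Longrightarrow> (u has_vector_derivative A (u t)) (at t within I)"
    and st: "s \<in> I" "t \<in> I"
  shows "norm (u s) = norm (u t)"
proof -
  have "((\<lambda>t. u t \<bullet> u t) has_vector_derivative 0) (at t within I)" if "t \<in> I" for t
  proof -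
    have "((\<lambda>t. u t \<bullet> u t) has_vector_derivative (u t \<bullet> A (u t) + A (u t) \<bullet> u t)) (at t within I)"
      using bounded_bilinear.has_vector_derivative[OF bounded_bilinear_inner u[OF that] u[OF that]] .
    then show ?thesis
      using skew by (simp add: inner_commute)
  qed
  from has_vector_derivative_zero_constant[OF is_interval_convex[OF I] this]
  obtain c where "\<And>t. t \<in> I \<Longrightarrow> u t \<bullet> u t = c"
    by blast
  then show ?thesis
    using st by (simp add: norm_eq_sqrt_inner)
qed

lemma skew_ode_unique:
  fixes u w :: "real \<Rightarrow> 'a::real_inner"
  assumes I: "is_interval I"
    and A: "linear A" and skew: "\<And>z. A z \<bullet> z = 0"
    and u: "\<And>t. t \<in> I \<Longrightarrow> (u has_vector_derivative A (u t)) (at t within I)"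
    and w: "\<And>t. t \<in> I \<Longrightarrow> (w has_vector_derivative A (w t)) (at t within I)"
    and st: "s \<in> I" "t \<in> I" and eq: "u s = w s"
  shows "u t = w t"
proof -
  have "((\<lambda>t. u t - w t) has_vector_derivative A (u t - w t)) (at t within I)" if "t \<in> I" for t
    using has_vector_derivative_diff[OF u[OF that] w[OF that]] by (simp add: linear_diff[OF A])
  from skew_ode_norm_constant[OF I skew this st] show ?thesis
    using eq by simp
qed

text \<open>The exponential series \<open>\<Sum>n. t\<^sup>n A\<^sup>n x / n!\<close>, differentiated coordinatewise as real power
  series.\<close>

lemma linear_ode_exists:
  fixes A :: "'a::euclidean_space \<Rightarrow> 'a"
  assumes A: "linear A"
  shows "\<exists>u. u 0 = x \<and> (\<forall>t::real. (u has_vector_derivative A (u t)) (at t))"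
proof -
  interpret bounded_linear A
    using A by (rule linear_conv_bounded_linear[THEN iffD1])
  obtain K where K: "K > 0" "\<And>z. norm (A z) \<le> norm z * K"
    using pos_bounded by blast
  define a where "a y n t = (t ^ n /\<^sub>R fact n) *\<^sub>R (A ^^ n) y" for y n and t :: real
  have bound: "norm ((A ^^ n) y) \<le> K ^ n * norm y" for y n
  proof (induction n)
    case (Suc n)
    have "norm ((A ^^ Suc n) y) \<le> norm ((A ^^ n) y) * K"
      using K(2) by simp
    also have "\<dots> \<le> K ^ n * norm y * K"
      using Suc K(1) by (intro mult_right_mono) auto
    finally show ?case by (simp add: ac_simps)
  qed simp
  have summable_a: "summable (\<lambda>n. a y n t)" for y t
  proof (rule summable_comparison_test')
    show "summable (\<lambda>n. ((\<bar>t\<bar> * K) ^ n /\<^sub>R fact n) * norm y)"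
      by (intro summable_mult2 summable_exp_generic)
    show "norm (a y n t) \<le> ((\<bar>t\<bar> * K) ^ n /\<^sub>R fact n) * norm y" for n
      using mult_left_mono[OF bound[of n y], of "\<bar>t\<bar> ^ n / fact n"]
      by (simp add: a_def power_abs power_mult_distrib field_simps)
  qed
  define u where "u y t = (\<Sum>n. a y n t)" for y t
  have inner_u: "u y t \<bullet> b = (\<Sum>n. ((A ^^ n) y \<bullet> b / fact n) * t ^ n)" for y t b
    unfolding u_def bounded_linear.suminf[OF bounded_linear_inner_left summable_a, of _ _ b]
    by (simp add: a_def field_simps)
  have summable_b: "summable (\<lambda>n. ((A ^^ n) y \<bullet> b / fact n) * t ^ n)" for y b and t :: real
    using bounded_linear.summable[OF bounded_linear_inner_left summable_a, of y t b]
    by (simp add: a_def field_simps)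
  have diffs: "diffs (\<lambda>n. (A ^^ n) y \<bullet> b / fact n) = (\<lambda>n. (A ^^ n) (A y) \<bullet> b / fact n)" for y b
    by (rule ext) (simp add: diffs_def funpow_swap1 field_simps del: of_nat_Suc)
  have A_u: "A (u y t) = u (A y) t" for y t
  proof -
    have "A (u y t) = (\<Sum>n. A (a y n t))"
      unfolding u_def by (rule suminf[OF summable_a])
    also have "\<dots> = u (A y) t"
      unfolding u_def by (simp add: a_def scaleR funpow_swap1)
    finally show ?thesis .
  qed
  have "(u x has_vector_derivative A (u x t)) (at t)" for t
    unfolding has_vector_derivative_def
  proof (subst has_derivative_componentwise_within, intro ballI)
    fix b :: 'a assume "b \<in> Basis"
    have "((\<lambda>t. u x t \<bullet> b) has_field_derivative u (A x) t \<bullet> b) (at t)"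
      unfolding inner_u
      using termdiffs_strong_converges_everywhere[OF summable_b, of x b t] by (simp add: diffs)
    then show "((\<lambda>t. u x t \<bullet> b) has_derivative (\<lambda>h. (h *\<^sub>R A (u x t)) \<bullet> b)) (at t)"
      by (simp add: A_u has_field_derivative_def mult_commute_abs)
  qed
  moreover have "u x 0 = x"
  proof -
    have "u x 0 = (\<Sum>n\<in>{0}. a x n 0)"
      unfolding u_def by (rule suminf_finite) (auto simp: a_def)
    then show ?thesis by (simp add: a_def)
  qed
  ultimately show ?thesis by blast
qed


section \<open>The generator of a Stiefel geodesic\<close>

text \<open>The operator \<open>v x\<^sup>T - x v\<^sup>T\<close> on \<open>V\<close>.\<close>

definition wedge :: "'v::real_inner ^ 'p::finite \<Rightarrow> 'v ^ 'p \<Rightarrow> 'v \<Rightarrow> 'v" where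
  "wedge x v y = (\<Sum>j\<in>UNIV. (x $ j \<bullet> y) *\<^sub>R v $ j - (v $ j \<bullet> y) *\<^sub>R x $ j)"

text \<open>The skew part of \<open>x\<^sup>T v\<close>. It equals \<open>x\<^sup>T v\<close> for tangent \<open>v\<close>; taking the skew part also for other
  \<open>v\<close> makes the generator below antisymmetric in \<open>x\<close> and \<open>v\<close>, so that it can be applied to two
  vertices of a polygon.\<close>

definition momentum :: "'v::real_inner ^ 'p::finite \<Rightarrow> 'v ^ 'p \<Rightarrow> 'p \<Rightarrow> 'p \<Rightarrow> real" where
  "momentum x v j k = (x $ j \<bullet> v $ k - v $ j \<bullet> x $ k) / 2"

text \<open>The product \<open>x S\<close> of a frame, seen as a linear map, with a square matrix.\<close>

definition rmult :: "'v::real_inner ^ 'p::finite \<Rightarrow> ('p \<Rightarrow> 'p \<Rightarrow> real) \<Rightarrow> 'v ^ 'p" where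
  "rmult x S = (\<chi> k. \<Sum>j\<in>UNIV. S j k *\<^sub>R x $ j)"

text \<open>The operator \<open>z \<mapsto> \<Omega> z - z A\<close> with \<open>\<Omega> = v x\<^sup>T - x v\<^sup>T\<close> and \<open>A\<close> the skew part of
  \<open>x\<^sup>T v\<close>. Its flow \<open>exp(t \<Omega>) x exp(-t A)\<close> is, for a frame \<open>x\<close> and tangent \<open>v\<close>, the Stiefel geodesic with
  initial velocity \<open>v\<close>.\<close>

definition generator :: "'v::real_inner ^ 'p::finite \<Rightarrow> 'v ^ 'p \<Rightarrow> 'v ^ 'p \<Rightarrow> 'v ^ 'p" where
  "generator x v z = (\<chi> k. wedge x v (z $ k) - rmult z (momentum x v) $ k)"

definition gram :: "'v::real_inner ^ 'p::finite \<Rightarrow> 'p \<Rightarrow> 'p \<Rightarrow> real" where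
  "gram x j k = x $ j \<bullet> x $ k"

definition sym_part :: "'v::real_inner ^ 'p::finite \<Rightarrow> 'v ^ 'p \<Rightarrow> 'p \<Rightarrow> 'p \<Rightarrow> real" where
  "sym_part x a j k = (x $ j \<bullet> a $ k + a $ j \<bullet> x $ k) / 2"

definition tangential :: "'v::real_inner ^ 'p::finite \<Rightarrow> 'v ^ 'p \<Rightarrow> bool" where
  "tangential x v \<longleftrightarrow> (\<forall>j k. x $ j \<bullet> v $ k + v $ j \<bullet> x $ k = 0)"

lemma gram_Stiefel: "x \<in> Stiefel UNIV \<Longrightarrow> x $ j \<bullet> x $ k = (if j = k then 1 else 0)"
  by (simp add: Stiefel_iff_orthonormal)

lemma norm_vec_squared: "(norm x)\<^sup>2 = (\<Sum>k\<in>UNIV. (norm (x $ k))\<^sup>2)"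
  for x :: "'v::real_inner ^ 'p::finite"
  by (simp add: power2_norm_eq_inner inner_vec_def)

lemma norm_Stiefel_nth: "x \<in> Stiefel UNIV \<Longrightarrow> norm (x $ k) = 1"
  by (simp add: norm_eq_sqrt_inner gram_Stiefel)

lemma norm_Stiefel:
  fixes x :: "'v::real_inner ^ 'p::finite"
  shows "x \<in> Stiefel UNIV \<Longrightarrow> norm x = sqrt (CARD('p))"
  using norm_vec_squared[of x] by (simp add: norm_Stiefel_nth real_sqrt_unique)

lemma wedge_skew: "wedge x v y \<bullet> y' + y \<bullet> wedge x v y' = 0"
  unfolding wedge_def inner_sum_left inner_sum_right sum.distrib[symmetric]
  by (intro sum.neutral) (simp add: algebra_simps inner_commute)

lemma wedge_add: "wedge x v (y + y') = wedge x v y + wedge x v y'"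
  unfolding wedge_def sum.distrib[symmetric]
  by (intro sum.cong) (auto simp: algebra_simps)

lemma wedge_scale: "wedge x v (c *\<^sub>R y) = c *\<^sub>R wedge x v y"
  unfolding wedge_def scaleR_sum_right
  by (intro sum.cong) (auto simp: algebra_simps)

lemma linear_wedge: "linear (wedge x v)"
  by (intro linearI wedge_add wedge_scale)

lemma momentum_skew: "momentum x v k j = - momentum x v j k"
  by (simp add: momentum_def inner_commute field_simps)

lemma rmult_add: "rmult (z + z') S = rmult z S + rmult z' S"
  by (simp add: rmult_def vec_eq_iff algebra_simps sum.distrib)

lemma rmult_scale: "rmult (c *\<^sub>R z) S = c *\<^sub>R rmult z S"
  by (simp add: rmult_def vec_eq_iff scaleR_sum_right mult.commute)

lemma generator_add: "generator x v (z + z') = generator x v z + generator x v z'"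
  by (simp add: generator_def vec_eq_iff wedge_add rmult_add)

lemma generator_scale: "generator x v (c *\<^sub>R z) = c *\<^sub>R generator x v z"
  by (simp add: generator_def vec_eq_iff wedge_scale rmult_scale algebra_simps)

lemma linear_generator: "linear (generator x v)"
  by (intro linearI generator_add generator_scale)

lemma generator_add_right: "generator x (v + w) z = generator x v z + generator x w z"
proof -
  have "wedge x (v + w) y = wedge x v y + wedge x w y" for y
    unfolding wedge_def sum.distrib[symmetric] by (intro sum.cong) (auto simp: algebra_simps)
  moreover have "momentum x (v + w) j k = momentum x v j k + momentum x w j k" for j k
    by (simp add: momentum_def inner_add_left inner_add_right field_simps)
  ultimately show ?thesis
    by (simp add: generator_def vec_eq_iff rmult_def scaleR_add_left sum.distrib)
qed

lemma generator_scale_right: "generator x (c *\<^sub>R v) z = c *\<^sub>R generator x v z"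
proof -
  have "wedge x (c *\<^sub>R v) y = c *\<^sub>R wedge x v y" for y
    unfolding wedge_def scaleR_sum_right by (intro sum.cong) (auto simp: algebra_simps)
  moreover have "momentum x (c *\<^sub>R v) j k = c * momentum x v j k" for j k
    by (simp add: momentum_def algebra_simps)
  ultimately show ?thesis
    by (simp add: generator_def vec_eq_iff rmult_def scaleR_sum_right scaleR_diff_right)
qed

lemma generator_antisym: "generator v x z = - generator x v z"
proof -
  have "wedge v x y = - wedge x v y" for y
    unfolding wedge_def sum_negf[symmetric] by (intro sum.cong) auto
  moreover have "momentum v x j k = - momentum x v j k" for j k
    unfolding momentum_def minus_divide_left by simp
  ultimately show ?thesis
    by (simp add: generator_def vec_eq_iff rmult_def sum_negf)
qed

lemma generator_self: "generator x x z = 0"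
proof -
  have "2 *\<^sub>R generator x x z = 0"
    using generator_antisym[of x x z] by (metis scaleR_2 eq_neg_iff_add_eq_0)
  then show ?thesis by simp
qed

lemma generator_diff_right: "generator x (v - w) z = generator x v z - generator x w z"
  using generator_add_right[of x v "- 1 *\<^sub>R w" z] generator_scale_right[of x "-1" w z] by simp

text \<open>The contribution of \<open>wedge\<close> cancels, since that operator is skew on \<open>V\<close>.\<close>

lemma inner_generator:
  "generator x v z $ j \<bullet> z $ k + z $ j \<bullet> generator x v z $ k =
     - (\<Sum>l\<in>UNIV. momentum x v l j * (z $ l \<bullet> z $ k) + momentum x v l k * (z $ j \<bullet> z $ l))"
  using wedge_skew[of x v "z $ j" "z $ k"]
  by (simp add: generator_def rmult_def inner_diff_left inner_diff_right inner_sum_left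
      inner_sum_right sum.distrib)

lemma skew_sum_zero:
  fixes a :: "'p::finite \<Rightarrow> 'p \<Rightarrow> real"
  assumes a: "\<And>j k. a k j = - a j k" and s: "\<And>j k. s k j = s j k"
  shows "(\<Sum>j\<in>UNIV. \<Sum>k\<in>UNIV. a j k * s j k) = 0"
proof -
  have "(\<Sum>j\<in>UNIV. \<Sum>k\<in>UNIV. a j k * s j k) = (\<Sum>k\<in>UNIV. \<Sum>j\<in>UNIV. a j k * s j k)"
    by (rule sum.swap)
  also have "\<dots> = - (\<Sum>k\<in>UNIV. \<Sum>j\<in>UNIV. a k j * s k j)"
    unfolding sum_negf[symmetric]
  proof (intro sum.cong refl)
    show "a j k * s j k = - (a k j * s k j)" for j k
      using a[of k j] s[of k j] by simp
  qed
  finally show ?thesis by simp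
qed

lemma generator_skew: "generator x v z \<bullet> z = 0"
proof -
  have "2 * (generator x v z \<bullet> z) =
    (\<Sum>k\<in>UNIV. generator x v z $ k \<bullet> z $ k + z $ k \<bullet> generator x v z $ k)"
    by (simp add: inner_vec_def inner_commute[of "_ $ _" "generator _ _ _ $ _"] sum_distrib_left)
  also have "\<dots> = - 2 * (\<Sum>k\<in>UNIV. \<Sum>l\<in>UNIV. momentum x v l k * (z $ l \<bullet> z $ k))"
    unfolding inner_generator
    by (simp add: sum_distrib_left sum_negf inner_commute)
  also have "(\<Sum>k\<in>UNIV. \<Sum>l\<in>UNIV. momentum x v l k * (z $ l \<bullet> z $ k)) = 0"
    by (rule skew_sum_zero[OF momentum_skew inner_commute, THEN trans[OF sum.swap]])
  finally show ?thesis by simp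
qed

text \<open>Each component is a sum of \<open>p\<close> terms, each bounded by three products of norms; only the
  existence of such a bound matters.\<close>

lemma norm_generator_le:
  fixes x v z :: "'v::real_inner ^ 'p::finite"
  shows "norm (generator x v z) \<le> 3 * (real CARD('p))\<^sup>2 * norm x * norm v * norm z"
proof -
  let ?P = "norm x * norm v * norm z"
  have tri: "\<bar>a \<bullet> b\<bar> * norm c \<le> n1 * n2 * n3"
    if "norm a \<le> n1" "norm b \<le> n2" "norm c \<le> n3" for a b c :: 'v and n1 n2 n3
  proof -
    have "\<bar>a \<bullet> b\<bar> * norm c \<le> (norm a * norm b) * norm c"
      by (intro mult_right_mono Cauchy_Schwarz_ineq2) auto
    also have "\<dots> \<le> n1 * n2 * n3"
      using that by (intro mult_mono) (auto intro: order_trans[OF norm_ge_zero] mult_nonneg_nonneg)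
    finally show ?thesis .
  qed
  note n = Finite_Cartesian_Product.norm_nth_le
  have comp: "norm (generator x v z $ k) \<le> real CARD('p) * (3 * ?P)" for k
  proof -
    have "norm (generator x v z $ k) =
      norm (\<Sum>j\<in>UNIV. (x $ j \<bullet> z $ k) *\<^sub>R v $ j - (v $ j \<bullet> z $ k) *\<^sub>R x $ j
         - momentum x v j k *\<^sub>R z $ j)"
      by (simp add: generator_def wedge_def rmult_def sum_subtractf)
    also have "\<dots> \<le> real CARD('p) * (3 * ?P)"
    proof (rule sum_norm_bound)
      fix j :: 'p
      have "norm ((x $ j \<bullet> z $ k) *\<^sub>R v $ j) \<le> ?P"
        using tri[OF n n n, of x j z k v j] by (simp add: ac_simps)
      moreover have "norm ((v $ j \<bullet> z $ k) *\<^sub>R x $ j) \<le> ?P"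
        using tri[OF n n n, of v j z k x j] by (simp add: ac_simps)
      moreover have "norm (momentum x v j k *\<^sub>R z $ j) \<le> ?P"
      proof -
        have "\<bar>momentum x v j k\<bar> * norm (z $ j) \<le>
          (\<bar>x $ j \<bullet> v $ k\<bar> * norm (z $ j) + \<bar>v $ j \<bullet> x $ k\<bar> * norm (z $ j)) / 2"
          unfolding momentum_def distrib_right[symmetric]
          by (simp add: abs_divide mult_right_mono abs_triangle_ineq4)
        also have "\<dots> \<le> (?P + ?P) / 2"
          using tri[OF n n n, of x j v k z j] tri[OF n n n, of v j x k z j]
          by (simp add: ac_simps)
        finally show ?thesis by (simp add: ac_simps)
      qed
      ultimately show "norm ((x $ j \<bullet> z $ k) *\<^sub>R v $ j - (v $ j \<bullet> z $ k) *\<^sub>R x $ j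
         - momentum x v j k *\<^sub>R z $ j) \<le> 3 * ?P"
        using norm_triangle_ineq4[of "(x $ j \<bullet> z $ k) *\<^sub>R v $ j" "(v $ j \<bullet> z $ k) *\<^sub>R x $ j"]
          norm_triangle_ineq4[of "(x $ j \<bullet> z $ k) *\<^sub>R v $ j - (v $ j \<bullet> z $ k) *\<^sub>R x $ j"
            "momentum x v j k *\<^sub>R z $ j"]
        by linarith
    qed
    finally show ?thesis .
  qed
  have "norm (generator x v z) \<le> (\<Sum>k\<in>UNIV. norm (generator x v z $ k))"
    unfolding norm_vec_def by (rule L2_set_le_sum) auto
  also have "\<dots> \<le> real CARD('p) * (real CARD('p) * (3 * ?P))"
    using sum_mono[of UNIV "\<lambda>k. norm (generator x v z $ k)", OF comp] by simp
  finally show ?thesis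
    by (simp add: power2_eq_square ac_simps)
qed

lemma bounded_linear_generator: "bounded_linear (generator x v)"
proof (rule bounded_linear_intro[OF generator_add generator_scale])
  show "norm (generator x v z) \<le> norm z * (3 * (real CARD('b))\<^sup>2 * norm x * norm v)" for z
    using norm_generator_le[of x v z] by (simp add: ac_simps)
qed

lemma bounded_bilinear_generator:
  "bounded_bilinear (\<lambda>x v. generator x v (z :: 'v::real_inner ^ 'p::finite))"
proof
  show "generator (x + x') v z = generator x v z + generator x' v z" for x x' v
    using generator_antisym[of "x + x'" v z] generator_antisym[of x v z] generator_antisym[of x' v z]
      generator_add_right[of v x x' z] by simp
  show "generator (c *\<^sub>R x) v z = c *\<^sub>R generator x v z" for c x v
    using generator_antisym[of "c *\<^sub>R x" v z] generator_antisym[of x v z]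
      generator_scale_right[of v c x z] by simp
  show "\<exists>K. \<forall>x v. norm (generator x v z) \<le> norm x * norm v * K"
    using norm_generator_le[of _ _ z]
    by (intro exI[of _ "3 * (real CARD('p))\<^sup>2 * norm z"]) (simp add: ac_simps)
qed (fact generator_add_right generator_scale_right)+

text \<open>At the base point the generator is the orthogonal projection of \<open>v\<close> to the tangent space,
  because normal vectors are the products of \<open>x\<close> with symmetric matrices.\<close>

lemma generator_base:
  assumes "x \<in> Stiefel UNIV"
  shows "generator x v x = v - rmult x (sym_part x v)"
proof -
  have "generator x v x $ k = v $ k - rmult x (sym_part x v) $ k" for k
  proof -
    have "generator x v x $ k = (\<Sum>j\<in>UNIV. (if j = k then 1 else 0) *\<^sub>R v $ j)
      - (\<Sum>j\<in>UNIV. (v $ j \<bullet> x $ k) *\<^sub>R x $ j + momentum x v j k *\<^sub>R x $ j)"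
      by (simp add: generator_def wedge_def rmult_def gram_Stiefel[OF assms] sum_subtractf sum.distrib)
    also have "(\<Sum>j\<in>UNIV. (if j = k then 1 else 0) *\<^sub>R v $ j) = v $ k"
      by (simp add: if_distrib[of "\<lambda>c. c *\<^sub>R _"] cong: if_cong)
    also have "(\<Sum>j\<in>UNIV. (v $ j \<bullet> x $ k) *\<^sub>R x $ j + momentum x v j k *\<^sub>R x $ j)
      = rmult x (sym_part x v) $ k"
      unfolding rmult_def vec_lambda_beta scaleR_add_left[symmetric]
      by (intro sum.cong refl arg_cong2[where f=scaleR])
         (simp add: momentum_def sym_part_def field_simps)
    finally show ?thesis .
  qed
  then show ?thesis
    by (simp add: vec_eq_iff)
qed

lemma generator_base_tangential:
  assumes "x \<in> Stiefel UNIV" "tangential x v"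
  shows "generator x v x = v"
proof -
  have "sym_part x v = (\<lambda>j k. 0)"
    using assms(2) by (simp add: tangential_def sym_part_def fun_eq_iff)
  then show ?thesis
    by (simp add: generator_base[OF assms(1)] rmult_def vec_eq_iff)
qed

lemma inner_rmult_Stiefel:
  assumes "x \<in> Stiefel UNIV"
  shows "x $ j \<bullet> rmult x S $ k = S j k"
  by (simp add: rmult_def inner_sum_right gram_Stiefel[OF assms] if_distrib[of "\<lambda>c. _ * c"]
      cong: if_cong)

text \<open>The normal directions do not contribute to the generator. This is the reason for its conservation
  along geodesics, whose acceleration is normal, and along discrete geodesics, where the sum of the
  neighbours of a vertex is normal at that vertex.\<close>

lemma generator_rmult:
  assumes x: "x \<in> Stiefel UNIV" and S: "\<And>j k. S j k = S k j"
  shows "generator x (rmult x S) z = 0"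
proof -
  have "momentum x (rmult x S) j k = 0" for j k
    using inner_rmult_Stiefel[OF x, of j S k] inner_rmult_Stiefel[OF x, of k S j] S[of j k]
    by (simp add: momentum_def inner_commute)
  moreover have "wedge x (rmult x S) y = 0" for y
  proof -
    have "wedge x (rmult x S) y =
      (\<Sum>j\<in>UNIV. \<Sum>l\<in>UNIV. (S l j * (x $ j \<bullet> y)) *\<^sub>R x $ l)
      - (\<Sum>j\<in>UNIV. \<Sum>l\<in>UNIV. (S l j * (x $ l \<bullet> y)) *\<^sub>R x $ j)"
      by (simp add: wedge_def rmult_def sum_subtractf scaleR_sum_right inner_sum_left
          scaleR_sum_left mult.commute)
    also have "(\<Sum>j\<in>UNIV. \<Sum>l\<in>UNIV. (S l j * (x $ l \<bullet> y)) *\<^sub>R x $ j) =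
        (\<Sum>j\<in>UNIV. \<Sum>l\<in>UNIV. (S l j * (x $ j \<bullet> y)) *\<^sub>R x $ l)"
      by (subst sum.swap) (simp add: S)
    finally show ?thesis by simp
  qed
  ultimately show ?thesis
    by (simp add: generator_def rmult_def vec_eq_iff)
qed


section \<open>The flow of the generator\<close>

lemma Stiefel_subspace_iff:
  fixes x :: "'v::real_inner ^ 'p::finite"
  assumes "subspace U"
  shows "x \<in> Stiefel U \<longleftrightarrow> x \<in> Stiefel UNIV \<and> (\<forall>k. x $ k \<in> U)"
proof -
  have "range (frame_map x) \<subseteq> U \<longleftrightarrow> (\<forall>k. x $ k \<in> U)"
  proof
    show "range (frame_map x) \<subseteq> U \<Longrightarrow> \<forall>k. x $ k \<in> U"
      by (metis frame_map_axis range_subsetD)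
    show "\<forall>k. x $ k \<in> U \<Longrightarrow> range (frame_map x) \<subseteq> U"
      using assms by (auto simp: frame_map_def intro: subspace_sum subspace_scale)
  qed
  then show ?thesis
    by (auto simp: Stiefel_def)
qed

lemma induced_map_nth [simp]: "induced_map f z $ k = f (z $ k)"
  by (simp add: induced_map_def)

lemma bounded_linear_induced_map:
  assumes "bounded_linear f"
  shows "bounded_linear (induced_map f :: 'v::real_inner ^ 'p::finite \<Rightarrow> 'w::real_inner ^ 'p)"
proof -
  interpret f: bounded_linear f by fact
  obtain K where K: "0 < K" "\<And>y. norm (f y) \<le> norm y * K"
    using f.pos_bounded by blast
  show ?thesis
  proof (rule bounded_linear_intro)
    show "induced_map f (y + z) = induced_map f y + induced_map f z" for y z :: "'v ^ 'p"
      by (simp add: vec_eq_iff f.add)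
    show "induced_map f (r *\<^sub>R y) = r *\<^sub>R induced_map f y" for r and y :: "'v ^ 'p"
      by (simp add: vec_eq_iff f.scaleR)
    show "norm (induced_map f y) \<le> norm y * (real CARD('p) * K)" for y :: "'v ^ 'p"
    proof -
      have "norm (induced_map f y) \<le> (\<Sum>k\<in>UNIV. norm (f (y $ k)))"
        unfolding norm_vec_def induced_map_nth by (rule L2_set_le_sum) auto
      also have "\<dots> \<le> (\<Sum>k\<in>(UNIV::'p set). norm y * K)"
        using K Finite_Cartesian_Product.norm_nth_le[of y]
        by (intro sum_mono) (meson mult_right_mono order_trans less_imp_le)
      finally show ?thesis by (simp add: ac_simps)
    qed
  qed
qed

lemma induced_map_wedge:
  assumes f: "linear f" and iso: "\<And>a b. a \<in> D \<Longrightarrow> b \<in> D \<Longrightarrow> f a \<bullet> f b = a \<bullet> b"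
    and D: "\<And>k. x $ k \<in> D" "\<And>k. v $ k \<in> D" "y \<in> D"
  shows "wedge (induced_map f x) (induced_map f v) (f y) = f (wedge x v y)"
  by (simp add: wedge_def iso D linear_sum[OF f] linear_diff[OF f] linear_scale[OF f])

lemma generator_induced_map:
  assumes f: "linear f" and iso: "\<And>a b. a \<in> D \<Longrightarrow> b \<in> D \<Longrightarrow> f a \<bullet> f b = a \<bullet> b"
    and D: "\<And>k. x $ k \<in> D" "\<And>k. v $ k \<in> D" "\<And>k. z $ k \<in> D"
  shows "generator (induced_map f x) (induced_map f v) (induced_map f z) =
    induced_map f (generator x v z)"
  using induced_map_wedge[OF f iso D(1,2,3)]
  by (simp add: vec_eq_iff generator_def rmult_def momentum_def iso D linear_diff[OF f]
      linear_sum[OF f] linear_scale[OF f])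

text \<open>The componentwise orthogonal projection to the span commutes with the generator, so it maps
  the solution to another solution with the same initial value.\<close>

lemma generator_flow_in_span:
  fixes u :: "real \<Rightarrow> 'v::real_inner ^ 'p::finite"
  assumes C: "orthonormal C" and x: "\<And>k. x $ k \<in> span C" and v: "\<And>k. v $ k \<in> span C"
    and I: "is_interval I"
    and u: "\<And>t. t \<in> I \<Longrightarrow> (u has_vector_derivative generator x v (u t)) (at t within I)"
    and st: "s \<in> I" "t \<in> I" and us: "\<And>k. u s $ k \<in> span C"
  shows "u t $ k \<in> span C"
proof -
  let ?Q = "orth_proj C"
  interpret Q: bounded_linear ?Q by (rule bounded_linear_orth_proj)
  have fix1: "?Q y = y" if "y \<in> span C" for y
    by (rule orth_proj_fixes_span[OF C that])
  have sa: "a \<bullet> ?Q y = a \<bullet> y" if "a \<in> span C" for a y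
  proof -
    have "a \<bullet> ?Q y = ?Q a \<bullet> y"
      by (simp add: orth_proj_def inner_sum_left inner_sum_right inner_commute mult.commute)
    then show ?thesis by (simp add: fix1 that)
  qed
  have w: "wedge x v (?Q y) = ?Q (wedge x v y)" for y
    by (simp add: wedge_def sa x v Q.sum Q.diff Q.scaleR fix1)
  have comm: "generator x v (induced_map ?Q z) = induced_map ?Q (generator x v z)" for z
    by (simp add: vec_eq_iff generator_def rmult_def w Q.sum Q.diff Q.scaleR)
  have "((\<lambda>t. induced_map ?Q (u t)) has_vector_derivative generator x v (induced_map ?Q (u t)))
      (at t within I)" if "t \<in> I" for t
    unfolding comm
    by (rule bounded_linear.has_vector_derivative[OF
        bounded_linear_induced_map[OF bounded_linear_orth_proj] u[OF that]])
  from skew_ode_unique[OF I linear_generator generator_skew this u st]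
  have "induced_map ?Q (u t) = u t"
    by (simp add: vec_eq_iff fix1 us)
  then have "?Q (u t $ k) = u t $ k"
    by (metis induced_map_nth)
  then show ?thesis
    using orth_proj_in_span[of C "u t $ k"] by simp
qed

lemma finite_card_two_frames:
  fixes x y :: "'v ^ 'p::finite"
  shows "finite (range (($) x) \<union> range (($) y))"
    and "card (range (($) x) \<union> range (($) y)) \<le> 2 * CARD('p)"
  using card_Un_le[of "range (($) x)" "range (($) y)"]
    card_image_le[of UNIV "($) x"] card_image_le[of UNIV "($) y"] by auto

text \<open>The vectors in \<open>x\<close> and \<open>v\<close> span at most \<open>2p\<close> dimensions. The equation is solved in
  \<open>\<real>\<^sup>2\<^sup>p\<close> and the solution is carried back by a linear isometry.\<close>

lemma generator_flow_exists:
  fixes x v :: "'v::real_inner ^ 'p::finite"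
  shows "\<exists>u. u 0 = x \<and> (\<forall>t::real. (u has_vector_derivative generator x v (u t)) (at t)) \<and>
             (\<forall>t k. u t $ k \<in> span (range (($) x) \<union> range (($) v)))"
proof -
  let ?F = "range (($) x) \<union> range (($) v)"
  note cF = finite_card_two_frames(2)[of x v]
  obtain C where C: "orthonormal C" "span C = span ?F" "card C \<le> card ?F"
    using orthonormal_extension[of "{}" ?F] by (auto simp: orthonormal_def)
  let ?B = "Basis :: (real ^ ('p + 'p)) set"
  obtain \<phi> where \<phi>: "inj_on \<phi> C" "\<phi> ` C \<subseteq> ?B"
  proof -
    have "card C \<le> card ?B"
      using C(3) cF by (simp add: card_UNIV_sum)
    then show thesis
      using card_le_inj[OF orthonormal_finite[OF C(1)] finite_Basis] that by blast
  qed
  let ?D = "\<phi> ` C"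
  have D: "orthonormal ?D"
    by (rule orthonormal_subset[OF orthonormal_Basis \<phi>(2)])
  obtain T where T: "bounded_linear T" "\<And>c. c \<in> C \<Longrightarrow> T c = \<phi> c" "range T \<subseteq> span ?D"
    using orthonormal_transfer[OF C(1) D \<phi>(1)] by auto
  \<comment> \<open>\<open>S\<close> inverts \<open>T\<close> on the span of \<open>C\<close>, and is isometric where the Euclidean solution lives.\<close>
  obtain S where S: "bounded_linear S" "\<And>c. c \<in> ?D \<Longrightarrow> S c = inv_into C \<phi> c" "range S \<subseteq> span C"
      and Siso: "\<And>a b. a \<in> span ?D \<Longrightarrow> b \<in> span ?D \<Longrightarrow> S a \<bullet> S b = a \<bullet> b"
  proof -
    have "inj_on (inv_into C \<phi>) ?D" "inv_into C \<phi> ` ?D \<subseteq> C"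
      using \<phi>(1) by (auto intro: inj_on_inv_into)
    from orthonormal_transfer[OF D C(1) this] obtain S where S: "bounded_linear S \<and>
      (\<forall>c\<in>?D. S c = inv_into C \<phi> c) \<and> range S \<subseteq> span C \<and>
      (\<forall>v\<in>span ?D. \<forall>w\<in>span ?D. S v \<bullet> S w = v \<bullet> w)" ..
    show thesis
      by (rule that[of S]) (use S in blast)+
  qed
  have ST: "S (T y) = y" if "y \<in> span C" for y
    by (rule linear_eq_on_span[of "\<lambda>y. S (T y)" "\<lambda>y. y" C])
      (use that \<phi> T(2) S(2) linear_compose[OF bounded_linear.linear[OF T(1)] bounded_linear.linear[OF S(1)]]
        in \<open>auto simp: o_def linear_id[unfolded id_def]\<close>)
  have xC: "x $ k \<in> span C" "v $ k \<in> span C" for k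
    unfolding C(2) by (auto intro: span_base)
  define x' where "x' = induced_map T x"
  define v' where "v' = induced_map T v"
  have D': "x' $ k \<in> span ?D" "v' $ k \<in> span ?D" for k
    using T(3) by (auto simp: x'_def v'_def)
  have S_xv: "induced_map S x' = x" "induced_map S v' = v"
    by (simp_all add: x'_def v'_def vec_eq_iff ST xC)
  obtain w where w: "w 0 = x'" "\<And>t. (w has_vector_derivative generator x' v' (w t)) (at t)"
    using linear_ode_exists[OF linear_generator] by blast
  have wD: "w t $ k \<in> span ?D" for t k
    by (rule generator_flow_in_span[OF D D' is_interval_univ, of w 0 t]) (use w D' in auto)
  have "((\<lambda>t. induced_map S (w t)) has_vector_derivative generator x v (induced_map S (w t))) (at t)"
    for t
  proof -
    have "generator x v (induced_map S (w t)) = induced_map S (generator x' v' (w t))"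
      using generator_induced_map[OF bounded_linear.linear[OF S(1)] Siso D' wD] by (simp add: S_xv)
    then show ?thesis
      using bounded_linear.has_vector_derivative[OF bounded_linear_induced_map[OF S(1)] w(2)] by simp
  qed
  moreover have "induced_map S (w 0) = x"
    by (simp add: w(1) S_xv)
  moreover have "induced_map S (w t) $ k \<in> span ?F" for t k
    using S(3) C(2) by auto
  ultimately show ?thesis by (intro exI[of _ "\<lambda>t. induced_map S (w t)"]) auto
qed

lemma linear_ode_smooth:
  assumes A: "bounded_linear A"
    and u: "\<And>t. t \<in> I \<Longrightarrow> (u has_vector_derivative A (u t)) (at t within I)"
  shows "smooth_curve_on I u"
  unfolding smooth_curve_on_def
proof (intro exI[of _ "\<lambda>n t. (A ^^ n) (u t)"] conjI allI ballI)
  fix n t assume t: "t \<in> I"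
  show "((\<lambda>t. (A ^^ n) (u t)) has_vector_derivative (A ^^ Suc n) (u t)) (at t within I)"
  proof (induction n)
    case (Suc n)
    then show ?case
      using bounded_linear.has_vector_derivative[OF A Suc] by simp
  qed (use u[OF t] in simp)
qed simp

lemma has_vector_derivative_componentwise:
  fixes f :: "real \<Rightarrow> 'v::real_inner ^ 'p::finite"
  assumes "\<And>k. ((\<lambda>t. f t $ k) has_vector_derivative f' $ k) F"
  shows "(f has_vector_derivative f') F"
proof -
  have ax: "bounded_linear (axis k :: 'v \<Rightarrow> 'v ^ 'p)" for k
  proof (rule bounded_linear_intro)
    show "norm (axis k y :: 'v ^ 'p) \<le> norm y * 1" for y
      by (simp add: norm_eq_sqrt_inner inner_axis_axis)
  qed (auto simp: vec_eq_iff axis_def)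
  have expand: "y = (\<Sum>k\<in>UNIV. axis k (y $ k))" for y :: "'v ^ 'p"
    by (simp add: vec_eq_iff axis_def if_distrib cong: if_cong)
  have "((\<lambda>t. \<Sum>k\<in>UNIV. axis k (f t $ k)) has_vector_derivative (\<Sum>k\<in>UNIV. axis k (f' $ k))) F"
    by (intro has_vector_derivative_sum bounded_linear.has_vector_derivative[OF ax] assms)
  then show ?thesis
    by (simp flip: expand)
qed

text \<open>The Gram matrix \<open>G\<close> of a solution evolves by the commutator with the momentum, because
  the part of the generator that acts on \<open>V\<close> is skew.\<close>

lemma gram_ode:
  assumes w: "(w has_vector_derivative generator x v (w t)) (at t within I)"
  shows "((\<lambda>t. gram (w t) j k) has_vector_derivative
    - (\<Sum>l\<in>UNIV. momentum x v l j * gram (w t) l k + momentum x v l k * gram (w t) j l)) (at t within I)"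
proof -
  note n = bounded_linear.has_vector_derivative[OF bounded_linear_vec_nth w]
  have "((\<lambda>t. w t $ j \<bullet> w t $ k) has_vector_derivative
    (w t $ j \<bullet> generator x v (w t) $ k + generator x v (w t) $ j \<bullet> w t $ k)) (at t within I)"
    by (rule bounded_bilinear.has_vector_derivative[OF bounded_bilinear_inner n n])
  then show ?thesis
    using inner_generator[of x v "w t" j k] by (simp add: gram_def add.commute)
qed

text \<open>The Gram matrix of \<open>u\<close> and the constant identity matrix solve the same skew linear equation,
  since the commutator with a skew matrix is a skew operator on matrices and kills the identity.\<close>

lemma generator_flow_Stiefel:
  fixes u :: "real \<Rightarrow> 'v::real_inner ^ 'p::finite"
  assumes I: "is_interval I"
    and u: "\<And>t. t \<in> I \<Longrightarrow> (u has_vector_derivative generator x v (u t)) (at t within I)"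
    and st: "s \<in> I" "t \<in> I" and us: "u s \<in> Stiefel UNIV"
  shows "u t \<in> Stiefel UNIV"
proof -
  let ?m = "momentum x v"
  define A :: "real ^ 'p ^ 'p \<Rightarrow> real ^ 'p ^ 'p" where
    "A Z = (\<chi> j k. - (\<Sum>l\<in>UNIV. ?m l j * Z $ l $ k + ?m l k * Z $ j $ l))" for Z
  define G :: "real \<Rightarrow> real ^ 'p ^ 'p" where "G t = (\<chi> j k. gram (u t) j k)" for t
  have linA: "linear A"
    by (intro linearI) (simp_all add: A_def vec_eq_iff sum.distrib sum_distrib_left algebra_simps sum_negf)
  have skew1: "(\<Sum>j\<in>UNIV. \<Sum>k\<in>UNIV. \<Sum>l\<in>UNIV. ?m l j * (Z $ l $ k * Z $ j $ k)) = 0" for Z :: "real ^ 'p ^ 'p"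
  proof -
    have "(\<Sum>j\<in>UNIV. \<Sum>l\<in>UNIV. ?m l j * (Z $ l $ k * Z $ j $ k)) = 0" for k
      by (rule skew_sum_zero[of "\<lambda>j l. ?m l j"]) (rule momentum_skew, simp add: mult.commute)
    then show ?thesis
      by (subst sum.swap) simp
  qed
  have skew2: "(\<Sum>j\<in>UNIV. \<Sum>k\<in>UNIV. \<Sum>l\<in>UNIV. ?m l k * (Z $ j $ l * Z $ j $ k)) = 0" for Z :: "real ^ 'p ^ 'p"
  proof (rule sum.neutral, rule ballI)
    fix j
    have "(\<Sum>l\<in>UNIV. \<Sum>k\<in>UNIV. ?m l k * (Z $ j $ l * Z $ j $ k)) = 0"
      by (rule skew_sum_zero[OF momentum_skew]) (simp add: mult.commute)
    then show "(\<Sum>k\<in>UNIV. \<Sum>l\<in>UNIV. ?m l k * (Z $ j $ l * Z $ j $ k)) = 0"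
      by (subst sum.swap)
  qed
  have skewA: "A Z \<bullet> Z = 0" for Z
  proof -
    have "A Z \<bullet> Z = (\<Sum>j\<in>UNIV. \<Sum>k\<in>UNIV. - ((\<Sum>l\<in>UNIV. ?m l j * (Z $ l $ k * Z $ j $ k))
       + (\<Sum>l\<in>UNIV. ?m l k * (Z $ j $ l * Z $ j $ k))))"
      unfolding A_def inner_vec_def vec_lambda_beta inner_real_def
      by (intro sum.cong refl) (simp add: sum_distrib_right sum.distrib left_diff_distrib mult.assoc)
    also have "\<dots> = - ((\<Sum>j\<in>UNIV. \<Sum>k\<in>UNIV. \<Sum>l\<in>UNIV. ?m l j * (Z $ l $ k * Z $ j $ k))
       + (\<Sum>j\<in>UNIV. \<Sum>k\<in>UNIV. \<Sum>l\<in>UNIV. ?m l k * (Z $ j $ l * Z $ j $ k)))"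
      by (simp only: sum_negf sum.distrib)
    finally show ?thesis
      by (simp only: skew1 skew2)
  qed
  have A1: "A (mat 1) = 0"
  proof -
    have "(\<Sum>l\<in>UNIV. ?m l j * (mat 1 :: real ^ 'p ^ 'p) $ l $ k + ?m l k * (mat 1 :: real ^ 'p ^ 'p) $ j $ l)
        = ?m k j + ?m j k" for j k
      by (simp add: sum.distrib mat_def if_distrib[of "\<lambda>c. _ * c"] cong: if_cong)
    also have "?m k j + ?m j k = 0" for j k
      using momentum_skew[of x v k j] by simp
    finally show ?thesis
      by (simp add: A_def vec_eq_iff)
  qed
  have dG: "(G has_vector_derivative A (G t)) (at t within I)" if "t \<in> I" for t
  proof -
    have "((\<lambda>t. \<chi> j. \<chi> k. gram (u t) j k) has_vector_derivative
       (\<chi> j. \<chi> k. - (\<Sum>l\<in>UNIV. ?m l j * gram (u t) l k + ?m l k * gram (u t) j l))) (at t within I)"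
      by (intro has_vector_derivative_componentwise)
        (simp only: vec_lambda_beta, rule gram_ode[OF u[OF that]])
    then show ?thesis
      by (simp add: G_def[abs_def] A_def)
  qed
  have "G t = mat 1"
  proof (rule skew_ode_unique[where A=A and u=G and w="\<lambda>t. mat 1", OF I linA skewA dG _ st])
    show "((\<lambda>t. mat 1) has_vector_derivative A (mat 1)) (at t within I)" for t
      by (simp add: A1)
    show "G s = mat 1"
      using gram_Stiefel[OF us] by (simp add: G_def gram_def mat_def vec_eq_iff)
  qed
  then show ?thesis
    by (simp add: Stiefel_iff_orthonormal G_def gram_def mat_def vec_eq_iff)
qed

text \<open>For the generator \<open>z \<mapsto> \<Omega> z - z A\<close> and the Gram matrix \<open>G\<close> of a solution, \<open>G' = A G - G A\<close>.
  Therefore \<open>(u G)' = \<Omega> u G - u A G + u (A G - G A) = \<Omega> (u G) - (u G) A\<close>.\<close>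

lemma rmult_gram_ode:
  assumes u: "(u has_vector_derivative generator x v (u t)) (at t within I)"
    and w: "(w has_vector_derivative generator x v (w t)) (at t within I)"
  shows "((\<lambda>t. rmult (u t) (gram (w t))) has_vector_derivative
     generator x v (rmult (u t) (gram (w t)))) (at t within I)"
proof (rule has_vector_derivative_componentwise)
  fix k
  let ?m = "momentum x v" and ?G = "gram (w t)"
  let ?g = "\<lambda>j. - (\<Sum>l\<in>UNIV. ?m l j * ?G l k + ?m l k * ?G j l)"
  have du: "((\<lambda>t. u t $ j) has_vector_derivative generator x v (u t) $ j) (at t within I)" for j
    by (rule bounded_linear.has_vector_derivative[OF bounded_linear_vec_nth u])
  have *: "generator x v (rmult (u t) ?G) $ k =
    (\<Sum>j\<in>UNIV. ?G j k *\<^sub>R generator x v (u t) $ j + ?g j *\<^sub>R u t $ j)"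
  proof -
    have 1: "wedge x v (rmult (u t) ?G $ k) =
        (\<Sum>j\<in>UNIV. ?G j k *\<^sub>R generator x v (u t) $ j)
        + (\<Sum>j\<in>UNIV. \<Sum>l\<in>UNIV. (?G j k * ?m l j) *\<^sub>R u t $ l)"
      by (simp add: generator_def rmult_def linear_sum[OF linear_wedge] wedge_scale
          scaleR_diff_right sum_subtractf scaleR_sum_right)
    have 2: "(\<Sum>j\<in>UNIV. \<Sum>l\<in>UNIV. (?G j k * ?m l j) *\<^sub>R u t $ l) =
        - (\<Sum>j\<in>UNIV. \<Sum>l\<in>UNIV. (?m l j * ?G l k) *\<^sub>R u t $ j)"
    proof -
      have "(\<Sum>j\<in>UNIV. \<Sum>l\<in>UNIV. (?G j k * ?m l j) *\<^sub>R u t $ l) =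
        (\<Sum>j\<in>UNIV. \<Sum>l\<in>UNIV. (?G l k * ?m j l) *\<^sub>R u t $ j)"
        by (rule sum.swap)
      also have "\<dots> = (\<Sum>j\<in>UNIV. \<Sum>l\<in>UNIV. - ((?m l j * ?G l k) *\<^sub>R u t $ j))"
      proof (intro sum.cong refl)
        show "(?G l k * ?m j l) *\<^sub>R u t $ j = - ((?m l j * ?G l k) *\<^sub>R u t $ j)" for j l
          using momentum_skew[of x v j l] by simp
      qed
      finally show ?thesis
        by (simp add: sum_negf)
    qed
    have 3: "rmult (rmult (u t) ?G) ?m $ k =
        (\<Sum>j\<in>UNIV. \<Sum>l\<in>UNIV. (?m l k * ?G j l) *\<^sub>R u t $ j)"
      unfolding rmult_def vec_lambda_beta scaleR_sum_right scaleR_scaleR by (rule sum.swap)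
    show ?thesis
      by (simp add: generator_def[of x v "rmult _ _"] 1 2 3 sum.distrib scaleR_add_left
          scaleR_sum_left scaleR_left_diff_distrib sum_negf sum_subtractf)
  qed
  have "((\<lambda>t. \<Sum>j\<in>UNIV. gram (w t) j k *\<^sub>R u t $ j) has_vector_derivative
     (\<Sum>j\<in>UNIV. ?G j k *\<^sub>R generator x v (u t) $ j + ?g j *\<^sub>R u t $ j)) (at t within I)"
    by (intro has_vector_derivative_sum
        bounded_bilinear.has_vector_derivative[OF bounded_bilinear_scaleR gram_ode[OF w] du])
  then show "((\<lambda>t. rmult (u t) (gram (w t)) $ k) has_vector_derivative
     generator x v (rmult (u t) ?G) $ k) (at t within I)"
    unfolding * by (simp add: rmult_def)
qed

text \<open>With \<open>B\<close> the generator, \<open>B B u + u (B u)\<^sup>T (B u)\<close> solves the same linear equation as \<open>u\<close> and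
  vanishes at time \<open>0\<close>, where \<open>B x = v\<close> and \<open>B v = - x (v\<^sup>T v)\<close>. Hence \<open>u\<close> satisfies the
  geodesic equation at all times.\<close>

lemma geodesic_flow_acceleration:
  fixes u :: "real \<Rightarrow> 'v::real_inner ^ 'p::finite"
  assumes x: "x \<in> Stiefel UNIV" and v: "tangential x v"
    and u0: "u 0 = x" and u: "\<And>t. (u has_vector_derivative generator x v (u t)) (at t)"
  shows "generator x v (generator x v (u t)) = - rmult (u t) (gram (generator x v (u t)))"
proof -
  let ?A = "generator x v"
  have A: "(f has_vector_derivative f') (at t) \<Longrightarrow>
      ((\<lambda>t. ?A (f t)) has_vector_derivative ?A f') (at t)" for f f' and t :: real
    by (rule bounded_linear.has_vector_derivative[OF bounded_linear_generator])
  have "?A (?A (u t)) + rmult (u t) (gram (?A (u t))) = 0"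
  proof (rule skew_ode_unique[OF is_interval_univ linear_generator generator_skew])
    show "((\<lambda>t. ?A (?A (u t)) + rmult (u t) (gram (?A (u t)))) has_vector_derivative
      ?A (?A (?A (u t)) + rmult (u t) (gram (?A (u t))))) (at t)" for t
      unfolding generator_add
      by (intro has_vector_derivative_add A u rmult_gram_ode)
    show "((\<lambda>t. 0) has_vector_derivative ?A 0) (at t)" for t
      by (simp add: linear_0[OF linear_generator])
    have "momentum x v j k = x $ j \<bullet> v $ k" for j k
    proof -
      have "v $ j \<bullet> x $ k = - (x $ j \<bullet> v $ k)"
        using v unfolding tangential_def by (metis add.inverse_unique)
      then show ?thesis by (simp add: momentum_def)
    qed
    then have "?A v = - rmult x (gram v)"
      by (simp add: generator_def wedge_def rmult_def gram_def vec_eq_iff sum_subtractf)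
    then show "?A (?A (u 0)) + rmult (u 0) (gram (?A (u 0))) = 0"
      by (simp add: u0 generator_base_tangential[OF x v])
  qed auto
  then show ?thesis
    by (simp add: eq_neg_iff_add_eq_0)
qed


section \<open>Critical geodesics of Stiefel manifolds\<close>

lemma at_within_interval_nontrivial:
  fixes I :: "real set"
  assumes "is_interval I" "interior I \<noteq> {}" "t \<in> I"
  shows "at t within I \<noteq> bot"
proof -
  have "I \<noteq> {a}" for a
    using assms(2) by auto
  then show ?thesis
    using connected_imp_perfect[of I t] assms by (simp add: is_interval_connected_1 trivial_limit_within)
qed

text \<open>The difference quotients lie in \<open>U\<close>.\<close>

lemma derivative_in_closed_subspace:
  fixes c :: "real \<Rightarrow> 'a::real_normed_vector"
  assumes U: "subspace U" "closed U" and c: "c ` I \<subseteq> U" "t \<in> I"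
    and d: "(c has_vector_derivative v) (at t within I)" and nb: "at t within I \<noteq> bot"
  shows "v \<in> U"
proof -
  have "\<exists>w\<in>U. dist w v < e" if e: "0 < e" for e
  proof -
    have "\<forall>\<^sub>F y in at t within I. norm (c y - c t - (y - t) *\<^sub>R v) \<le> e / 2 * norm (y - t)"
      using d half_gt_zero[OF e] unfolding has_vector_derivative_def has_derivative_within_alt2 by blast
    moreover have "\<forall>\<^sub>F y in at t within I. y \<in> I \<and> y \<noteq> t"
      by (simp add: eventually_at_filter)
    ultimately obtain y where y: "norm (c y - c t - (y - t) *\<^sub>R v) \<le> e / 2 * \<bar>y - t\<bar>" "y \<in> I" "y \<noteq> t"
      using eventually_happens'[OF nb eventually_conj] by fastforce
    let ?w = "(c y - c t) /\<^sub>R (y - t)"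
    have "norm (c y - c t - (y - t) *\<^sub>R v) = \<bar>y - t\<bar> * norm (?w - v)"
      using y(3) by (simp add: norm_scaleR[symmetric] scaleR_diff_right del: norm_scaleR)
    then have "norm (?w - v) \<le> e / 2"
      using y(1,3) by (simp add: mult.commute)
    moreover have "?w \<in> U"
      using c y(2) U(1) by (intro subspace_scale subspace_diff) auto
    ultimately show ?thesis
      using e by (intro bexI[of _ ?w]) (auto simp: dist_norm)
  qed
  then show ?thesis
    using closed_approachable[OF U(2)] by blast
qed

lemma Stiefel_tangential:
  assumes c: "c ` I \<subseteq> Stiefel UNIV" "t \<in> I"
    and d: "(c has_vector_derivative v) (at t within I)" and nb: "at t within I \<noteq> bot"
  shows "tangential (c t) v"
  unfolding tangential_def
proof (intro allI)
  fix j k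
  note n = bounded_linear.has_vector_derivative[OF bounded_linear_vec_nth d]
  have "((\<lambda>s. c s $ j \<bullet> c s $ k) has_vector_derivative (c t $ j \<bullet> v $ k + v $ j \<bullet> c t $ k)) (at t within I)"
    by (rule bounded_bilinear.has_vector_derivative[OF bounded_bilinear_inner n n])
  moreover have "((\<lambda>s. c s $ j \<bullet> c s $ k) has_vector_derivative 0) (at t within I)"
  proof (rule has_vector_derivative_transform[OF c(2)])
    show "c s $ j \<bullet> c s $ k = (if j = k then 1 else 0)" if "s \<in> I" for s
      using c(1) that by (intro gram_Stiefel) auto
  qed simp
  ultimately show "c t $ j \<bullet> v $ k + v $ j \<bullet> c t $ k = 0"
    using vector_derivative_unique_within[OF nb] by blast
qed

lemma closed_subspace_vec:
  fixes U :: "'v::real_inner set"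
  assumes U: "subspace U" "closed U"
  shows "subspace {z :: 'v ^ 'p::finite. \<forall>k. z $ k \<in> U}" "closed {z :: 'v ^ 'p::finite. \<forall>k. z $ k \<in> U}"
proof -
  show "subspace {z :: 'v ^ 'p. \<forall>k. z $ k \<in> U}"
    using U(1) by (auto simp: subspace_def)
  have "closed ((\<lambda>z :: 'v ^ 'p. z $ k) -` U)" for k
    by (intro closed_vimage U continuous_intros)
  then show "closed {z :: 'v ^ 'p. \<forall>k. z $ k \<in> U}"
    by (auto intro!: closed_Collect_all simp: vimage_def)
qed

lemma rmult_normal:
  fixes x v :: "'v::real_inner ^ 'p::finite"
  assumes v: "tangential x v" and S: "\<And>j k. S j k = S k j"
  shows "rmult x S \<bullet> v = 0"
proof -
  have "rmult x S \<bullet> v = (\<Sum>k\<in>UNIV. \<Sum>j\<in>UNIV. (x $ j \<bullet> v $ k) * S j k)"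
    by (simp add: inner_vec_def rmult_def inner_sum_left mult.commute)
  also have "\<dots> = 0"
  proof (subst sum.swap, rule skew_sum_zero[OF _ S])
    show "x $ k \<bullet> v $ j = - (x $ j \<bullet> v $ k)" for j k
      using v unfolding tangential_def by (metis add.inverse_unique inner_commute)
  qed
  finally show ?thesis .
qed

lemma tangential_projection:
  assumes x: "x \<in> Stiefel UNIV"
  shows "tangential x (a - rmult x (sym_part x a))"
  unfolding tangential_def
proof (intro allI)
  fix j k
  have "rmult x (sym_part x a) $ j \<bullet> x $ k = sym_part x a k j"
    using inner_rmult_Stiefel[OF x, of k "sym_part x a" j] by (simp add: inner_commute)
  then show "x $ j \<bullet> (a - rmult x (sym_part x a)) $ k + (a - rmult x (sym_part x a)) $ j \<bullet> x $ k = 0"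
    using inner_rmult_Stiefel[OF x, of j "sym_part x a" k]
    by (simp add: inner_diff_left inner_diff_right sym_part_def inner_commute field_simps)
qed

text \<open>The flow of the generator provides a curve in the Stiefel manifold with a given tangential
  velocity; it stays in every subspace that contains the initial data.\<close>

lemma tangent_space_Stiefel:
  fixes x :: "'v::real_inner ^ 'p::finite"
  assumes U: "subspace U" "closed U" and x: "x \<in> Stiefel U"
  shows "tangent_space (Stiefel U) x = {v. tangential x v \<and> (\<forall>k. v $ k \<in> U)}"
proof (intro subset_antisym subsetI)
  fix v assume "v \<in> tangent_space (Stiefel U) x"
  then obtain \<epsilon> c where e: "0 < \<epsilon>" and c: "c ` {-\<epsilon><..<\<epsilon>} \<subseteq> Stiefel U" "c 0 = x"
      and d: "(c has_vector_derivative v) (at 0)"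
    unfolding tangent_space_def by auto
  let ?I = "{-\<epsilon><..<\<epsilon>}"
  have I: "0 \<in> ?I" "at 0 within ?I \<noteq> bot"
    using e at_within_interval_nontrivial[of ?I 0] by (auto simp: is_interval_oo)
  have d': "(c has_vector_derivative v) (at 0 within ?I)"
    using d by (rule has_vector_derivative_at_within)
  have "c ` ?I \<subseteq> Stiefel UNIV" "c ` ?I \<subseteq> {z. \<forall>k. z $ k \<in> U}"
    using c(1) Stiefel_subspace_iff[OF U(1)] by auto
  then show "v \<in> {v. tangential x v \<and> (\<forall>k. v $ k \<in> U)}"
    using Stiefel_tangential[OF _ I(1) d' I(2)] c(2)
      derivative_in_closed_subspace[OF closed_subspace_vec[OF U] _ I(1) d' I(2)] by auto
next
  fix v assume "v \<in> {v. tangential x v \<and> (\<forall>k. v $ k \<in> U)}"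
  then have v: "tangential x v" "\<And>k. v $ k \<in> U" by auto
  have x': "x \<in> Stiefel UNIV" "\<And>k. x $ k \<in> U"
    using x Stiefel_subspace_iff[OF U(1)] by auto
  obtain u where u: "u 0 = x" "\<And>t. (u has_vector_derivative generator x v (u t)) (at t)"
      "\<And>t k. u t $ k \<in> span (range (($) x) \<union> range (($) v))"
    using generator_flow_exists[of x v] by blast
  have "span (range (($) x) \<union> range (($) v)) \<subseteq> U"
    using x' v U(1) by (intro span_minimal) auto
  then have "u t \<in> Stiefel U" for t
    using generator_flow_Stiefel[OF is_interval_univ u(2), of 0 t] u(1,3) x' Stiefel_subspace_iff[OF U(1)]
    by blast
  moreover have "smooth_curve_on {-1<..<1} u"
    by (rule linear_ode_smooth[OF bounded_linear_generator])
      (rule has_vector_derivative_at_within[OF u(2)])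
  ultimately show "v \<in> tangent_space (Stiefel U) x"
    using u(1) u(2)[of 0] generator_base_tangential[OF x'(1) v(1)]
    unfolding tangent_space_def by (auto intro!: exI[of _ 1] exI[of _ u])
qed

text \<open>The tangential part of \<open>a\<close> lies in the tangent space of \<open>St(p,U)\<close>, so it is orthogonal to
  \<open>a\<close> and therefore to itself.\<close>

lemma normal_to_Stiefel:
  assumes U: "subspace U" "closed U" and x: "x \<in> Stiefel U"
    and a: "\<And>k. a $ k \<in> U" "\<And>v. v \<in> tangent_space (Stiefel U) x \<Longrightarrow> a \<bullet> v = 0"
  shows "a = rmult x (sym_part x a)"
proof -
  have x': "x \<in> Stiefel UNIV" "\<And>k. x $ k \<in> U"
    using x Stiefel_subspace_iff[OF U(1)] by auto
  define v where "v = a - rmult x (sym_part x a)"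
  have t: "tangential x v"
    unfolding v_def by (rule tangential_projection[OF x'(1)])
  have "v $ k \<in> U" for k
    unfolding v_def rmult_def using a(1) x'(2) U(1)
    by (auto intro!: subspace_diff subspace_sum subspace_scale)
  then have "a \<bullet> v = 0"
    using a(2) t by (simp add: tangent_space_Stiefel[OF U x])
  moreover have "rmult x (sym_part x a) \<bullet> v = 0"
    by (rule rmult_normal[OF t]) (simp add: sym_part_def inner_commute)
  ultimately have "v \<bullet> v = 0"
    by (simp add: v_def inner_diff_left)
  then show ?thesis
    by (simp add: v_def)
qed

lemma smooth_curve_velocity:
  assumes I: "is_interval I" "interior I \<noteq> {}" and c: "smooth_curve_on I c"
  shows "\<exists>D. \<forall>t\<in>I. (c has_vector_derivative velocity I c t) (at t within I) \<and>
     (velocity I c has_vector_derivative D t) (at t within I)"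
proof -
  obtain F where F: "F 0 = c" "\<And>n t. t \<in> I \<Longrightarrow> (F n has_vector_derivative F (Suc n) t) (at t within I)"
    using c unfolding smooth_curve_on_def by blast
  have v: "velocity I c t = F 1 t" if "t \<in> I" for t
    unfolding velocity_def using F(2)[OF that, of 0]
    by (intro vector_derivative_within at_within_interval_nontrivial[OF I that]) (simp add: F(1))
  have "(velocity I c has_vector_derivative F 2 t) (at t within I)" if "t \<in> I" for t
    by (rule has_vector_derivative_transform[OF that v]) (use F(2)[OF that, of 1] in \<open>simp_all add: numeral_2_eq_2\<close>)
  then show ?thesis
    using v F(2)[of _ 0] by (intro exI[of _ "F 2"]) (simp add: F(1))
qed

text \<open>A normal acceleration is \<open>\<gamma> S\<close> for the symmetric part \<open>S\<close> of \<open>\<gamma>\<^sup>T \<gamma>''\<close>; differentiating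
  \<open>\<gamma>\<^sup>T \<gamma> = Id\<close> twice identifies \<open>S\<close> with \<open>- \<gamma>'\<^sup>T \<gamma>'\<close>. The subspace \<open>U\<close> enters the resulting
  equation only through the condition that \<open>\<gamma>\<close> takes its values in \<open>St(p,U)\<close>.\<close>

lemma critical_geodesic_Stiefel_iff:
  fixes \<gamma> :: "real \<Rightarrow> 'v::real_inner ^ 'p::finite"
  assumes U: "subspace U" "closed U" and I: "is_interval I" "interior I \<noteq> {}"
  shows "critical_geodesic (Stiefel U) I \<gamma> \<longleftrightarrow>
    smooth_curve_on I \<gamma> \<and> \<gamma> ` I \<subseteq> Stiefel U \<and>
    (\<forall>t\<in>I. (velocity I \<gamma> has_vector_derivative - rmult (\<gamma> t) (gram (velocity I \<gamma> t))) (at t within I))"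
proof (intro iffI conjI ballI)
  assume c: "critical_geodesic (Stiefel U) I \<gamma>"
  then show sm: "smooth_curve_on I \<gamma>" and in_St: "\<gamma> ` I \<subseteq> Stiefel U"
    by (auto simp: critical_geodesic_def)
  let ?v = "velocity I \<gamma>"
  fix t assume t: "t \<in> I"
  note nb = at_within_interval_nontrivial[OF I t]
  have dv: "(\<gamma> has_vector_derivative ?v s) (at s within I)" if "s \<in> I" for s
    using smooth_curve_velocity[OF I sm] that by blast
  obtain D where D: "(?v has_vector_derivative D) (at t within I)"
      "\<And>u. u \<in> tangent_space (Stiefel U) (\<gamma> t) \<Longrightarrow> D \<bullet> u = 0"
    using c t by (auto simp: critical_geodesic_def has_covariant_derivative_def)
  have St: "\<gamma> ` I \<subseteq> Stiefel UNIV" "\<gamma> ` I \<subseteq> {z. \<forall>k. z $ k \<in> U}"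
    using in_St Stiefel_subspace_iff[OF U(1)] by auto
  note clU = closed_subspace_vec[OF U]
  have "?v ` I \<subseteq> {z. \<forall>k. z $ k \<in> U}"
    using derivative_in_closed_subspace[OF clU St(2) _ dv] at_within_interval_nontrivial[OF I] by auto
  from derivative_in_closed_subspace[OF clU this t D(1) nb] have DU: "\<And>k. D $ k \<in> U"
    by simp
  have gt: "\<gamma> t \<in> Stiefel U"
    using in_St t by auto
  note Deq = normal_to_Stiefel[OF U gt DU D(2)]
  have tang: "\<gamma> s $ j \<bullet> ?v s $ k + ?v s $ j \<bullet> \<gamma> s $ k = 0" if "s \<in> I" for s j k
    using Stiefel_tangential[OF St(1) that dv[OF that] at_within_interval_nontrivial[OF I that]]
    by (simp add: tangential_def)
  have "sym_part (\<gamma> t) D j k = - gram (?v t) j k" for j k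
  proof -
    note n = bounded_linear.has_vector_derivative[OF bounded_linear_vec_nth]
    note ip = bounded_bilinear.has_vector_derivative[OF bounded_bilinear_inner]
    have "((\<lambda>s. \<gamma> s $ j \<bullet> ?v s $ k + ?v s $ j \<bullet> \<gamma> s $ k) has_vector_derivative
       (\<gamma> t $ j \<bullet> D $ k + ?v t $ j \<bullet> ?v t $ k) + (?v t $ j \<bullet> ?v t $ k + D $ j \<bullet> \<gamma> t $ k)) (at t within I)"
      by (intro has_vector_derivative_add ip n dv t D(1))
    moreover have "((\<lambda>s. \<gamma> s $ j \<bullet> ?v s $ k + ?v s $ j \<bullet> \<gamma> s $ k) has_vector_derivative 0) (at t within I)"
      by (rule has_vector_derivative_transform[OF t tang]) auto
    ultimately have "(\<gamma> t $ j \<bullet> D $ k + ?v t $ j \<bullet> ?v t $ k) + (?v t $ j \<bullet> ?v t $ k + D $ j \<bullet> \<gamma> t $ k) = 0"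
      using vector_derivative_unique_within[OF nb] by blast
    then show ?thesis
      by (simp add: sym_part_def gram_def field_simps)
  qed
  then have "rmult (\<gamma> t) (sym_part (\<gamma> t) D) = - rmult (\<gamma> t) (gram (?v t))"
    by (simp add: rmult_def vec_eq_iff sum_negf)
  then show "(?v has_vector_derivative - rmult (\<gamma> t) (gram (?v t))) (at t within I)"
    using D(1) Deq by simp
next
  assume a: "smooth_curve_on I \<gamma> \<and> \<gamma> ` I \<subseteq> Stiefel U \<and>
    (\<forall>t\<in>I. (velocity I \<gamma> has_vector_derivative - rmult (\<gamma> t) (gram (velocity I \<gamma> t))) (at t within I))"
  have "has_covariant_derivative (Stiefel U) I \<gamma> (velocity I \<gamma>) t 0" if t: "t \<in> I" for t
  proof -
    have gt: "\<gamma> t \<in> Stiefel U"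
      using a t by auto
    have "rmult (\<gamma> t) (gram (velocity I \<gamma> t)) \<bullet> u = 0" if "u \<in> tangent_space (Stiefel U) (\<gamma> t)" for u
      using that unfolding tangent_space_Stiefel[OF U gt]
      by (intro rmult_normal) (auto simp: gram_def inner_commute)
    moreover have "0 \<in> tangent_space (Stiefel U) (\<gamma> t)"
      unfolding tangent_space_Stiefel[OF U gt] using U(1) by (auto simp: tangential_def subspace_0)
    ultimately show ?thesis
      using a t unfolding has_covariant_derivative_def by (auto simp: inner_minus_left)
  qed
  then show "critical_geodesic (Stiefel U) I \<gamma>"
    using a by (simp add: critical_geodesic_def)
qed

text \<open>The generator \<open>B\<close> of position and velocity is constant in time: by the product rule its
  derivative is \<open>B \<gamma>' \<gamma>' + B \<gamma> \<gamma>''\<close>, where the first term vanishes by antisymmetry and the second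
  because the acceleration is normal.\<close>

lemma critical_geodesic_ode:
  fixes \<gamma> :: "real \<Rightarrow> 'v::real_inner ^ 'p::finite"
  assumes U: "subspace U" "closed U" and I: "is_interval I" "interior I \<noteq> {}"
    and c: "critical_geodesic (Stiefel U) I \<gamma>" and s: "s \<in> I"
  shows "\<And>t. t \<in> I \<Longrightarrow>
      (\<gamma> has_vector_derivative generator (\<gamma> s) (velocity I \<gamma> s) (\<gamma> t)) (at t within I)"
proof -
  let ?v = "velocity I \<gamma>"
  have sm: "smooth_curve_on I \<gamma>" and in_St: "\<gamma> ` I \<subseteq> Stiefel U"
    and eq: "\<And>t. t \<in> I \<Longrightarrow> (?v has_vector_derivative - rmult (\<gamma> t) (gram (?v t))) (at t within I)"
    using c unfolding critical_geodesic_Stiefel_iff[OF U I] by auto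
  have dv: "(\<gamma> has_vector_derivative ?v t) (at t within I)" if "t \<in> I" for t
    using smooth_curve_velocity[OF I sm] that by blast
  have St: "\<gamma> ` I \<subseteq> Stiefel UNIV"
    using in_St Stiefel_subspace_iff[OF U(1)] by auto
  have tang: "tangential (\<gamma> t) (?v t)" if "t \<in> I" for t
    by (rule Stiefel_tangential[OF St that dv[OF that] at_within_interval_nontrivial[OF I that]])
  have const: "generator (\<gamma> t) (?v t) z = generator (\<gamma> s) (?v s) z" if t: "t \<in> I" for t z
  proof -
    have "((\<lambda>t. generator (\<gamma> t) (?v t) z) has_vector_derivative 0) (at t within I)" if "t \<in> I" for t
    proof -
      have "generator (\<gamma> t) (- rmult (\<gamma> t) (gram (?v t))) z = 0"
      proof -
        have "generator (\<gamma> t) (rmult (\<gamma> t) (gram (?v t))) z = 0"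
          using St that by (intro generator_rmult) (auto simp: gram_def inner_commute)
        then show ?thesis
          using generator_scale_right[of "\<gamma> t" "-1" "rmult (\<gamma> t) (gram (?v t))" z] by simp
      qed
      then show ?thesis
        using bounded_bilinear.has_vector_derivative[OF bounded_bilinear_generator dv[OF that] eq[OF that], of z]
        by (simp add: generator_self)
    qed
    from has_vector_derivative_zero_constant[OF is_interval_convex[OF I(1)] this]
    obtain c where "\<And>t. t \<in> I \<Longrightarrow> generator (\<gamma> t) (?v t) z = c"
      by blast
    then show ?thesis using s t by simp
  qed
  show "(\<gamma> has_vector_derivative generator (\<gamma> s) (?v s) (\<gamma> t)) (at t within I)" if t: "t \<in> I" for t
  proof -
    have "generator (\<gamma> t) (?v t) (\<gamma> t) = ?v t"
      using St t by (intro generator_base_tangential tang) auto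
    then show ?thesis
      using dv[OF t] const[OF t] by simp
  qed
qed

lemma generator_flow_critical:
  fixes u :: "real \<Rightarrow> 'v::real_inner ^ 'p::finite"
  assumes U: "subspace U" "closed U" and I: "is_interval I" "interior I \<noteq> {}"
    and x: "x \<in> Stiefel U" and v: "tangential x v"
    and u: "u 0 = x" "\<And>t. (u has_vector_derivative generator x v (u t)) (at t)"
    and uU: "\<And>t k. u t $ k \<in> U"
  shows "critical_geodesic (Stiefel U) I u"
    and "\<And>t. t \<in> I \<Longrightarrow> norm (velocity I u t) = norm v"
proof -
  have x': "x \<in> Stiefel UNIV"
    using x Stiefel_subspace_iff[OF U(1)] by auto
  have u': "(u has_vector_derivative generator x v (u t)) (at t within I)" for t I
    by (rule has_vector_derivative_at_within[OF u(2)])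
  have vel: "velocity I u t = generator x v (u t)" if "t \<in> I" for t
    unfolding velocity_def by (rule vector_derivative_within[OF at_within_interval_nontrivial[OF I that] u'])
  have d2: "((\<lambda>t. generator x v (u t)) has_vector_derivative generator x v (generator x v (u t)))
      (at t within I)" for t I
    by (rule bounded_linear.has_vector_derivative[OF bounded_linear_generator u'])
  have "(velocity I u has_vector_derivative - rmult (u t) (gram (velocity I u t))) (at t within I)"
    if t: "t \<in> I" for t
    unfolding vel[OF t] geodesic_flow_acceleration[OF x' v u, symmetric]
    by (rule has_vector_derivative_transform[OF t vel d2])
  moreover have "u t \<in> Stiefel U" for t
    using generator_flow_Stiefel[OF is_interval_univ u(2), of 0 t] u(1) x' uU Stiefel_subspace_iff[OF U(1)]
    by blast
  ultimately show "critical_geodesic (Stiefel U) I u"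
    unfolding critical_geodesic_Stiefel_iff[OF U I]
    by (auto intro: linear_ode_smooth[OF bounded_linear_generator] u')
  show "norm (velocity I u t) = norm v" if "t \<in> I" for t
  proof -
    have "norm (generator x v (u t)) = norm (generator x v (u 0))"
      by (rule skew_ode_norm_constant[OF is_interval_univ generator_skew d2]) auto
    then show ?thesis
      using vel[OF that] u(1) generator_base_tangential[OF x' v] by simp
  qed
qed


section \<open>Discrete geodesics\<close>

definition discrete_energy :: "nat \<Rightarrow> (nat \<Rightarrow> 'a::real_normed_vector) \<Rightarrow> real" where
  "discrete_energy N z = (\<Sum>j<N. (norm (z (Suc j) - z j))\<^sup>2)"

text \<open>The second clause is the stationarity condition for the discrete energy: the sum of the
  neighbours of an inner vertex is normal to the manifold at that vertex.\<close>

definition discrete_geodesic :: "nat \<Rightarrow> (nat \<Rightarrow> 'v::real_inner ^ 'p::finite) \<Rightarrow> bool" where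
  "discrete_geodesic N z \<longleftrightarrow> (\<forall>j\<le>N. z j \<in> Stiefel UNIV) \<and>
     (\<forall>j. Suc j < N \<longrightarrow>
        (\<exists>S. (\<forall>i k. S i k = S k i) \<and> z j + z (Suc (Suc j)) = rmult (z (Suc j)) S))"

lemma compact_vec_in_span:
  fixes S :: "('v::real_inner ^ 'p::finite) set"
  assumes F: "finite F" and S: "closed S" "bounded S" "\<And>z k. z \<in> S \<Longrightarrow> z $ k \<in> span F"
  shows "compact S"
proof -
  let ?G = "(\<lambda>(k, b). axis k b :: 'v ^ 'p) ` (UNIV \<times> F)"
  have axis: "axis k b \<in> span ?G" if "b \<in> span F" for k and b :: 'v
    using that
  proof (induction rule: span_induct_alt)
    case base
    then show ?case by (simp add: span_zero axis_def flip: zero_vec_def)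
  next
    case (step c b' b)
    have "axis k (c *\<^sub>R b' + b) = c *\<^sub>R axis k b' + (axis k b :: 'v ^ 'p)"
      by (simp add: vec_eq_iff axis_def)
    then show ?case
      using step by (auto intro!: span_add span_scale intro: span_base)
  qed
  have "S \<subseteq> span ?G"
  proof
    fix z assume z: "z \<in> S"
    have "z = (\<Sum>k\<in>UNIV. axis k (z $ k))"
      by (simp add: vec_eq_iff axis_def if_distrib cong: if_cong)
    then show "z \<in> span ?G"
      using span_sum[of UNIV "\<lambda>k. axis k (z $ k)" ?G] axis[OF S(3)[OF z]] by metis
  qed
  then show ?thesis
    using F S by (intro compact_in_span[of ?G]) auto
qed

lemma compact_Stiefel:
  assumes F: "finite (F :: 'v::real_inner set)"
  shows "compact (Stiefel (span F) :: ('v ^ 'p::finite) set)"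
proof -
  let ?S = "Stiefel (span F) :: ('v ^ 'p) set"
  have S: "?S = {z. \<forall>j k. z $ j \<bullet> z $ k = (if j = k then 1 else 0)} \<inter> {z. \<forall>k. z $ k \<in> span F}"
    using Stiefel_subspace_iff[OF subspace_span] Stiefel_iff_orthonormal by blast
  have "closed {z :: 'v ^ 'p. \<forall>j k. z $ j \<bullet> z $ k = (if j = k then 1 else 0)}"
    by (intro closed_Collect_all closed_Collect_eq continuous_intros)
  then have "closed ?S"
    unfolding S using closed_subspace_vec(2)[OF subspace_span closed_span_finite[OF F]] by blast
  moreover have "bounded ?S"
  proof (rule boundedI)
    show "norm z \<le> sqrt CARD('p)" if "z \<in> ?S" for z
      using norm_Stiefel[of z] that S Stiefel_iff_orthonormal[of z] by auto
  qed
  ultimately show ?thesis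
    using S by (intro compact_vec_in_span[OF F]) auto
qed

lemma discrete_energy_update:
  assumes "Suc j < N"
  shows "discrete_energy N (z(Suc j := w)) - discrete_energy N z =
     (norm (w - z j))\<^sup>2 + (norm (z (Suc (Suc j)) - w))\<^sup>2
     - (norm (z (Suc j) - z j))\<^sup>2 - (norm (z (Suc (Suc j)) - z (Suc j)))\<^sup>2"
proof -
  have split: "discrete_energy N y = (\<Sum>i\<in>{..<N} - {j, Suc j}. (norm (y (Suc i) - y i))\<^sup>2)
      + ((norm (y (Suc j) - y j))\<^sup>2 + (norm (y (Suc (Suc j)) - y (Suc j)))\<^sup>2)" for y :: "nat \<Rightarrow> 'a"
    unfolding discrete_energy_def using assms by (subst sum.subset_diff[of "{j, Suc j}"]) auto
  have "(\<Sum>i\<in>{..<N} - {j, Suc j}. (norm ((z(Suc j := w)) (Suc i) - (z(Suc j := w)) i))\<^sup>2) =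
      (\<Sum>i\<in>{..<N} - {j, Suc j}. (norm (z (Suc i) - z i))\<^sup>2)"
    by (intro sum.cong) auto
  then show ?thesis
    unfolding split by simp
qed

text \<open>The polygons with given endpoints form a compact set, so the energy has a minimum. As a function
  of one inner vertex \<open>w\<close>, the energy is a constant minus twice the inner product of \<open>w\<close> with the
  sum of its neighbours, because all frames have the same norm; at a minimum this sum is normal.\<close>

lemma discrete_energy_minimizer:
  fixes z :: "nat \<Rightarrow> 'v::real_inner ^ 'p::finite"
  assumes F: "finite F" and z: "\<And>j. j \<le> N \<Longrightarrow> z j \<in> Stiefel (span F)"
  shows "\<exists>y. y 0 = z 0 \<and> y N = z N \<and> discrete_geodesic N y \<and>
     discrete_energy N y \<le> discrete_energy N z"
proof -
  let ?St = "Stiefel (span F) :: ('v ^ 'p) set"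
  \<comment> \<open>Vertices beyond \<open>N\<close> are pinned as well, which makes the set of all polygons a compact product.\<close>
  define K where "K i = (if 0 < i \<and> i < N then ?St else {z (if i = 0 then 0 else N)})" for i
  let ?P = "PiE UNIV K"
  have "compactin (product_topology (\<lambda>i. euclidean) UNIV) ?P"
    unfolding compactin_PiE using compact_Stiefel[OF F] by (auto simp: K_def)
  then have "compact ?P"
    by (simp add: euclidean_product_topology)
  moreover have "(\<lambda>i. if i \<le> N then z i else z N) \<in> ?P"
    using z by (auto simp: K_def PiE_iff)
  moreover have "continuous_on ?P (discrete_energy N)"
    unfolding discrete_energy_def
    by (intro continuous_intros continuous_on_product_then_coordinatewise continuous_on_id)
  ultimately obtain y where y: "y \<in> ?P"
      and min: "\<And>w. w \<in> ?P \<Longrightarrow> discrete_energy N y \<le> discrete_energy N w"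
    using continuous_attains_inf[of ?P "discrete_energy N"] by (metis empty_iff)
  have yK: "y i \<in> K i" for i
    using y by auto
  have ends: "y 0 = z 0" "y N = z N"
    using yK[of 0] yK[of N] by (auto simp: K_def split: if_splits)
  have ySt: "y j \<in> ?St" if "j \<le> N" for j
    using yK[of j] z[of 0] z[of N] that by (auto simp: K_def split: if_splits)
  have St: "w \<in> Stiefel UNIV" if "w \<in> ?St" for w
    using that Stiefel_subspace_iff[OF subspace_span] by blast
  have "discrete_energy N y \<le> discrete_energy N (\<lambda>i. if i \<le> N then z i else z N)"
    by (rule min) fact
  also have "\<dots> = discrete_energy N z"
    unfolding discrete_energy_def by (intro sum.cong) auto
  finally have le: "discrete_energy N y \<le> discrete_energy N z" .
  have "\<exists>S. (\<forall>i k. S i k = S k i) \<and> y j + y (Suc (Suc j)) = rmult (y (Suc j)) S" if j: "Suc j < N" for j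
  proof -
    let ?x = "y (Suc j)" and ?a = "y j + y (Suc (Suc j))"
    have x: "?x \<in> ?St"
      using ySt j by simp
    have max: "?a \<bullet> w \<le> ?a \<bullet> ?x" if w: "w \<in> ?St" for w
    proof -
      have "(y(Suc j := w)) i \<in> K i" for i
        using yK[of i] w j by (cases "i = Suc j") (simp_all add: K_def)
      then have "y(Suc j := w) \<in> ?P"
        by (auto simp: PiE_iff)
      from min[OF this] have "(norm (?x - y j))\<^sup>2 + (norm (y (Suc (Suc j)) - ?x))\<^sup>2
         \<le> (norm (w - y j))\<^sup>2 + (norm (y (Suc (Suc j)) - w))\<^sup>2"
        using discrete_energy_update[OF j, of y w] by linarith
      moreover have "w \<bullet> w = ?x \<bullet> ?x"
        using norm_Stiefel[OF St[OF w]] norm_Stiefel[OF St[OF x]] by (simp add: norm_eq_sqrt_inner)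
      ultimately show ?thesis
        by (simp add: power2_norm_eq_inner algebra_simps inner_commute)
    qed
    have crit: "?a \<bullet> v = 0" if v: "v \<in> tangent_space ?St ?x" for v
    proof -
      obtain e c where e: "0 < e" and c: "c ` {-e<..<e} \<subseteq> ?St" "c 0 = ?x"
          and d: "(c has_vector_derivative v) (at 0)"
        using v unfolding tangent_space_def by auto
      have "((\<lambda>t. ?a \<bullet> c t) has_real_derivative ?a \<bullet> v) (at 0)"
        using bounded_linear.has_vector_derivative[OF bounded_linear_inner_right d]
        by (simp add: has_real_derivative_iff_has_vector_derivative)
      moreover have "\<forall>t. \<bar>0 - t\<bar> < e \<longrightarrow> ?a \<bullet> c t \<le> ?a \<bullet> c 0"
        using c max by (auto simp: image_subset_iff abs_less_iff)
      ultimately show ?thesis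
        using DERIV_local_max[OF _ e] by blast
    qed
    have "?a $ k \<in> span F" for k
      using ySt[of j] ySt[of "Suc (Suc j)"] j Stiefel_subspace_iff[OF subspace_span]
      by (auto intro!: span_add)
    from normal_to_Stiefel[OF subspace_span closed_span_finite[OF F] x this crit]
    have "?a = rmult ?x (sym_part ?x ?a)" .
    then show ?thesis
      by (intro exI[of _ "sym_part ?x ?a"]) (simp add: sym_part_def inner_commute)
  qed
  then have "discrete_geodesic N y"
    using ySt St by (auto simp: discrete_geodesic_def)
  then show ?thesis
    using ends le by blast
qed

text \<open>Each vertex is a combination of the two preceding ones, by the stationarity condition.\<close>

lemma discrete_geodesic_in_span:
  assumes z: "discrete_geodesic N z" and "j \<le> N"
  shows "z j $ k \<in> span (range (($) (z 0)) \<union> range (($) (z 1)))" (is "_ \<in> ?S")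
  using assms(2)
proof (induction j arbitrary: k rule: less_induct)
  case (less j)
  show ?case
  proof (cases "j < 2")
    case True
    then have "j = 0 \<or> j = 1" by auto
    then show ?thesis by (auto intro: span_base)
  next
    case False
    then obtain i where i: "j = Suc (Suc i)"
      by (metis One_nat_def Suc_1 less_2_cases_iff not0_implies_Suc)
    have "Suc i < N"
      using less(2) i by simp
    then obtain S where "z i + z j = rmult (z (Suc i)) S"
      using z unfolding discrete_geodesic_def i by blast
    then have "z j = rmult (z (Suc i)) S - z i"
      by (simp add: eq_diff_eq add.commute)
    then have "z j $ k = (\<Sum>l\<in>UNIV. S l k *\<^sub>R z (Suc i) $ l) - z i $ k"
      by (simp add: rmult_def)
    moreover have "z (Suc i) $ l \<in> ?S" "z i $ l \<in> ?S" for l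
      using less i by auto
    ultimately show ?thesis
      by (auto intro!: span_diff span_sum span_scale)
  qed
qed

text \<open>Extend an orthonormal basis \<open>C0\<close> of the common subspace to bases of both spans and match the
  remaining basis vectors; there is room, as the dimension of the second span is at least that of the first.\<close>

lemma isometry_fixing_subspace:
  assumes C0: "orthonormal C0" and F: "finite F" "C0 \<subseteq> span F" "card F \<le> n"
    and C: "orthonormal C" "C0 \<subseteq> span C" "card C = n"
  shows "\<exists>T. bounded_linear T \<and> (\<forall>y\<in>span C0. T y = y) \<and> range T \<subseteq> span C \<and>
     (\<forall>a\<in>span F. \<forall>b\<in>span F. T a \<bullet> T b = a \<bullet> b)"
proof -
  obtain D1 where D1: "orthonormal D1" "C0 \<subseteq> D1" "span D1 = span (C0 \<union> F)"
    using orthonormal_extension[OF C0 F(1)] by blast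
  have sD1: "span D1 = span F"
    unfolding D1(3) span_eq using F(2) by (auto intro: span_base)
  obtain D2 where D2: "orthonormal D2" "C0 \<subseteq> D2" "span D2 = span (C0 \<union> C)"
    using orthonormal_extension[OF C0 orthonormal_finite[OF C(1)]] by blast
  have sD2: "span D2 = span C"
    unfolding D2(3) span_eq using C(2) by (auto intro: span_base)
  have "card D1 \<le> n"
    using independent_span_bound[OF F(1) orthonormal_independent[OF D1(1)]] sD1 F(3)
    by (metis order_trans span_superset)
  moreover have "card D2 = n"
    using dim_span_orthonormal[OF D2(1)] dim_span_orthonormal[OF C(1)] sD2 C(3) by simp
  ultimately have "card (D1 - C0) \<le> card (D2 - C0)"
    using D1 D2 orthonormal_finite[OF C0] by (simp add: card_Diff_subset)
  then obtain \<psi> where \<psi>: "\<psi> ` (D1 - C0) \<subseteq> D2 - C0" "inj_on \<psi> (D1 - C0)"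
    using card_le_inj[of "D1 - C0" "D2 - C0"] orthonormal_finite[OF D1(1)] orthonormal_finite[OF D2(1)]
    by auto
  define \<phi> where "\<phi> c = (if c \<in> C0 then c else \<psi> c)" for c
  have "inj_on \<phi> D1"
    using \<psi> D1(2) unfolding inj_on_def \<phi>_def by (auto split: if_splits)
  moreover have "\<phi> ` D1 \<subseteq> D2"
    using \<psi> D2(2) by (auto simp: \<phi>_def)
  ultimately obtain T where T: "bounded_linear T \<and> (\<forall>c\<in>D1. T c = \<phi> c) \<and> range T \<subseteq> span D2 \<and>
      (\<forall>v\<in>span D1. \<forall>w\<in>span D1. T v \<bullet> T w = v \<bullet> w)"
    using orthonormal_transfer[OF D1(1) D2(1)] by blast
  have "T y = y" if "y \<in> span C0" for y
  proof (rule linear_eq_on_span[of T "\<lambda>y. y" C0])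
    show "T c = c" if "c \<in> C0" for c
      using T D1(2) that by (auto simp: \<phi>_def)
  qed (use T that in \<open>auto simp: linear_id[unfolded id_def] bounded_linear.linear\<close>)
  then show ?thesis
    using T sD1 sD2 by auto
qed

lemma discrete_geodesic_induced_map:
  assumes f: "linear f" and iso: "\<And>a b. a \<in> D \<Longrightarrow> b \<in> D \<Longrightarrow> f a \<bullet> f b = a \<bullet> b"
    and D: "\<And>j k. j \<le> N \<Longrightarrow> z j $ k \<in> D" and z: "discrete_geodesic N z"
  shows "discrete_geodesic N (\<lambda>j. induced_map f (z j))"
proof -
  have "induced_map f (z j) \<in> Stiefel UNIV" if "j \<le> N" for j
    using z that by (auto simp: discrete_geodesic_def Stiefel_iff_orthonormal iso D)
  moreover have "\<exists>S. (\<forall>i k. S i k = S k i) \<and>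
      induced_map f (z j) + induced_map f (z (Suc (Suc j))) = rmult (induced_map f (z (Suc j))) S"
    if j: "Suc j < N" for j
  proof -
    obtain S where S: "\<And>i k. S i k = S k i" "z j + z (Suc (Suc j)) = rmult (z (Suc j)) S"
      using z j unfolding discrete_geodesic_def by blast
    have "f (z j $ k) + f (z (Suc (Suc j)) $ k) = f ((z j + z (Suc (Suc j))) $ k)" for k
      by (simp add: linear_add[OF f])
    then have "induced_map f (z j) + induced_map f (z (Suc (Suc j))) = rmult (induced_map f (z (Suc j))) S"
      unfolding S(2) by (simp add: vec_eq_iff rmult_def linear_sum[OF f] linear_scale[OF f])
    then show ?thesis
      using S(1) by blast
  qed
  ultimately show ?thesis
    by (auto simp: discrete_geodesic_def)
qed

text \<open>Minimize in the finite-dimensional span of \<open>C\<close> and all vertices of \<open>z\<close>. The minimizer lies in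
  the span of its first two vertices, of dimension at most \<open>2p\<close>, which is moved into the span of \<open>C\<close>
  by an isometry that fixes the endpoints. Passing to a subspace of dimension \<open>2p\<close> thus costs no energy.\<close>

lemma discrete_geodesic_within:
  fixes z :: "nat \<Rightarrow> 'v::real_inner ^ 'p::finite"
  assumes C: "orthonormal C" "card C = 2 * CARD('p)"
    and ends: "z 0 \<in> Stiefel (span C)" "z N \<in> Stiefel (span C)"
    and z: "\<And>j. j \<le> N \<Longrightarrow> z j \<in> Stiefel UNIV"
  shows "\<exists>y. y 0 = z 0 \<and> y N = z N \<and> discrete_geodesic N y \<and>
     (\<forall>j\<le>N. y j \<in> Stiefel (span C)) \<and> discrete_energy N y \<le> discrete_energy N z"
proof -
  define F where "F = (\<Union>j\<in>{..N}. range (($) (z j)))"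
  have F: "finite F"
    unfolding F_def by auto
  have zF: "z j \<in> Stiefel (span F)" if "j \<le> N" for j
    using z[OF that] that unfolding Stiefel_subspace_iff[OF subspace_span, of _ F]
    by (auto simp: F_def intro!: span_base)
  obtain w where w: "w 0 = z 0" "w N = z N"
      "discrete_geodesic N w" "discrete_energy N w \<le> discrete_energy N z"
    using discrete_energy_minimizer[of F N z, OF F zF] by blast
  let ?G = "range (($) (w 0)) \<union> range (($) (w 1))"
  have wG: "w j $ k \<in> span ?G" if "j \<le> N" for j k
    by (rule discrete_geodesic_in_span[OF w(3) that])
  note cG = finite_card_two_frames[of "w 0" "w 1"]
  let ?E = "range (($) (z 0)) \<union> range (($) (z N))"
  obtain C0 where C0: "orthonormal C0" "span C0 = span ?E"
    using orthonormal_extension[of "{}" ?E] by (auto simp: orthonormal_def)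
  have "?E \<subseteq> span ?G"
    using wG[of 0] wG[of N] w(1,2) by auto
  from span_superset[of C0] span_minimal[OF this subspace_span]
  have 1: "C0 \<subseteq> span ?G"
    unfolding C0(2) by (rule order_trans)
  have "?E \<subseteq> span C"
    using ends unfolding Stiefel_subspace_iff[OF subspace_span, of _ C] by auto
  from span_superset[of C0] span_minimal[OF this subspace_span]
  have 2: "C0 \<subseteq> span C"
    unfolding C0(2) by (rule order_trans)
  obtain T where T: "bounded_linear T" "\<And>a. a \<in> span C0 \<Longrightarrow> T a = a" "range T \<subseteq> span C"
      "\<And>a b. a \<in> span ?G \<Longrightarrow> b \<in> span ?G \<Longrightarrow> T a \<bullet> T b = a \<bullet> b"
    using isometry_fixing_subspace[OF C0(1) cG(1) 1 cG(2) C(1) 2 C(2)] by blast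
  note lin = bounded_linear.linear[OF T(1)]
  let ?y = "\<lambda>j. induced_map T (w j)"
  have "z i $ k \<in> span C0" if "i = 0 \<or> i = N" for i k
    unfolding C0(2) using that by (auto intro: span_base)
  then have "?y 0 = z 0" "?y N = z N"
    using w(1,2) by (simp_all add: vec_eq_iff T(2))
  moreover have dg: "discrete_geodesic N ?y"
    by (rule discrete_geodesic_induced_map[OF lin T(4) wG w(3)])
  moreover have "?y j \<in> Stiefel (span C)" if "j \<le> N" for j
    using dg that T(3) unfolding Stiefel_subspace_iff[OF subspace_span, of _ C] discrete_geodesic_def
    by auto
  moreover have "discrete_energy N ?y = discrete_energy N w"
    unfolding discrete_energy_def
  proof (intro sum.cong refl)
    fix j assume "j \<in> {..<N}"
    then have "w (Suc j) $ k - w j $ k \<in> span ?G" for k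
      by (intro span_diff wG) auto
    then have "norm (T (w (Suc j) $ k - w j $ k)) = norm (w (Suc j) $ k - w j $ k)" for k
      by (simp add: norm_eq_sqrt_inner T(4))
    then show "(norm (?y (Suc j) - ?y j))\<^sup>2 = (norm (w (Suc j) - w j))\<^sup>2"
      by (simp add: norm_vec_squared linear_diff[OF lin, symmetric])
  qed
  ultimately show ?thesis
    using w(4) by (intro exI[of _ ?y]) auto
qed


section \<open>Convergence of discrete geodesics\<close>

lemma norm_rmult_gram_le:
  fixes a d :: "'v::real_inner ^ 'p::finite"
  assumes a: "a \<in> Stiefel UNIV"
  shows "norm (rmult a (gram d)) \<le> (real CARD('p))\<^sup>2 * (norm d)\<^sup>2"
proof -
  have comp: "norm (rmult a (gram d) $ k) \<le> real CARD('p) * (norm d)\<^sup>2" for k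
    unfolding rmult_def vec_lambda_beta
  proof (rule sum_norm_bound)
    fix j
    have "\<bar>gram d j k\<bar> \<le> norm (d $ j) * norm (d $ k)"
      unfolding gram_def by (rule Cauchy_Schwarz_ineq2)
    also have "\<dots> \<le> norm d * norm d"
      by (intro mult_mono Finite_Cartesian_Product.norm_nth_le) auto
    finally show "norm (gram d j k *\<^sub>R a $ j) \<le> (norm d)\<^sup>2"
      by (simp add: norm_Stiefel_nth[OF a] power2_eq_square)
  qed
  have "norm (rmult a (gram d)) \<le> (\<Sum>k\<in>UNIV. norm (rmult a (gram d) $ k))"
    unfolding norm_vec_def by (rule L2_set_le_sum) auto
  also have "\<dots> \<le> real CARD('p) * (real CARD('p) * (norm d)\<^sup>2)"
    using sum_mono[of UNIV "\<lambda>k. norm (rmult a (gram d) $ k)", OF comp] by simp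
  finally show ?thesis
    by (simp add: power2_eq_square ac_simps)
qed

text \<open>For a chord \<open>d = b - a\<close> the difference is \<open>a (d\<^sup>T d) / 2\<close>: the generator of two vertices
  gives their difference up to a quadratic error.\<close>

lemma generator_chord:
  fixes a b :: "'v::real_inner ^ 'p::finite"
  assumes a: "a \<in> Stiefel UNIV" and b: "b \<in> Stiefel UNIV"
  shows "norm (generator a b a - (b - a)) \<le> (real CARD('p))\<^sup>2 * (norm (b - a))\<^sup>2"
proof -
  have sp: "sym_part a b j k = (if j = k then 1 else 0) - gram (b - a) j k / 2" for j k
    using gram_Stiefel[OF a, of j k] gram_Stiefel[OF b, of j k]
    by (simp add: sym_part_def gram_def inner_diff_left inner_diff_right field_simps)
  have "rmult a (sym_part a b) $ k = a $ k - (1 / 2) *\<^sub>R rmult a (gram (b - a)) $ k" for k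
  proof -
    have "rmult a (sym_part a b) $ k = (\<Sum>j\<in>UNIV. (if j = k then a $ j else 0) - (1 / 2) *\<^sub>R (gram (b - a) j k *\<^sub>R a $ j))"
      unfolding rmult_def vec_lambda_beta sp by (intro sum.cong) (auto simp: scaleR_left_diff_distrib)
    then show ?thesis
      by (simp add: sum_subtractf rmult_def scaleR_sum_right)
  qed
  then have "generator a b a - (b - a) = (1 / 2) *\<^sub>R rmult a (gram (b - a))"
    by (simp add: generator_base[OF a] vec_eq_iff)
  then have "norm (generator a b a - (b - a)) = norm (rmult a (gram (b - a))) / 2"
    by simp
  then show ?thesis
    using norm_rmult_gram_le[OF a, of "b - a"] norm_ge_zero[of "rmult a (gram (b - a))"] by linarith
qed

text \<open>Conservation of the generator: by stationarity \<open>z (j-1) + z (j+1)\<close> does not contribute to the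
  generator at \<open>z j\<close>, and the generator is antisymmetric in its first two arguments.\<close>

lemma discrete_geodesic_generator:
  assumes z: "discrete_geodesic N z" and "j < N"
  shows "generator (z j) (z (Suc j)) w = generator (z 0) (z 1) w"
  using assms(2)
proof (induction j)
  case (Suc j)
  obtain S where S: "\<And>i k. S i k = S k i" "z j + z (Suc (Suc j)) = rmult (z (Suc j)) S"
    using z Suc(2) unfolding discrete_geodesic_def by blast
  have "z (Suc j) \<in> Stiefel UNIV"
    using z Suc(2) unfolding discrete_geodesic_def by auto
  then have "generator (z (Suc j)) (z j + z (Suc (Suc j))) w = 0"
    unfolding S(2) using S(1) by (rule generator_rmult)
  then have "generator (z (Suc j)) (z (Suc (Suc j))) w = - generator (z (Suc j)) (z j) w"
    unfolding generator_add_right by (simp add: eq_neg_iff_add_eq_0 add.commute)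
  also have "\<dots> = generator (z j) (z (Suc j)) w"
    by (simp add: generator_antisym[of "z (Suc j)"])
  finally show ?case
    using Suc by simp
qed simp

text \<open>The vector \<open>V\<close> is the scaled initial edge, an approximate initial velocity. Some edge has length at most
  \<open>L / N\<close>, since the energy is at most \<open>N (L / N)\<^sup>2\<close>; by conservation of the generator, this one
  edge controls \<open>V\<close>, and it controls the speed with the sharp constant \<open>L\<close>.\<close>

lemma discrete_geodesic_bounds:
  fixes z :: "nat \<Rightarrow> 'v::real_inner ^ 'p::finite"
  assumes z: "discrete_geodesic N z" and N: "0 < N"
    and L: "0 \<le> L" "discrete_energy N z \<le> L\<^sup>2 / N"
  defines "q \<equiv> real CARD('p)" and "V \<equiv> real N *\<^sub>R (z 1 - z 0)"
  shows "\<And>j. j < N \<Longrightarrow> norm ((1 / N) *\<^sub>R generator (z 0) V (z j) - (z (Suc j) - z j))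
      \<le> q\<^sup>2 * (norm (z (Suc j) - z j))\<^sup>2"
    and "\<exists>j<N. norm (generator (z 0) V (z j)) \<le> L + q\<^sup>2 * L\<^sup>2 / N"
    and "norm V \<le> 3 * q ^ 3 * L + q\<^sup>2 * L\<^sup>2"
proof -
  have St: "z j \<in> Stiefel UNIV" if "j \<le> N" for j
    using z that by (auto simp: discrete_geodesic_def)
  have gen: "generator (z 0) V w = real N *\<^sub>R generator (z j) (z (Suc j)) w" if "j < N" for j w
    using discrete_geodesic_generator[OF z that]
    by (simp add: V_def generator_scale_right generator_diff_right generator_self)
  show step: "norm ((1 / N) *\<^sub>R generator (z 0) V (z j) - (z (Suc j) - z j))
      \<le> q\<^sup>2 * (norm (z (Suc j) - z j))\<^sup>2" if "j < N" for j
    using generator_chord[OF St St, of j "Suc j"] that N by (simp add: gen[OF that] q_def)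
  have "\<exists>j<N. norm (z (Suc j) - z j) \<le> L / N"
  proof (rule ccontr)
    assume "\<not> ?thesis"
    then have *: "L / N < norm (z (Suc j) - z j)" if "j < N" for j
      using that by (simp add: not_le)
    have "(\<Sum>j<N. (L / N)\<^sup>2) < discrete_energy N z"
      unfolding discrete_energy_def using N L(1) *
      by (intro sum_strict_mono power_strict_mono) auto
    then show False
      using L(2) N by (simp add: power2_eq_square field_simps)
  qed
  then obtain j where j: "j < N" "norm (z (Suc j) - z j) \<le> L / N"
    by blast
  have "norm (generator (z 0) V (z j)) \<le> L + q\<^sup>2 * L\<^sup>2 / N"
  proof -
    have "norm ((1 / N) *\<^sub>R generator (z 0) V (z j)) \<le> norm (z (Suc j) - z j) + q\<^sup>2 * (norm (z (Suc j) - z j))\<^sup>2"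
      using step[OF j(1)] norm_triangle_sub[of "(1 / N) *\<^sub>R generator (z 0) V (z j)" "z (Suc j) - z j"]
      by linarith
    also have "\<dots> \<le> L / N + q\<^sup>2 * (L / N)\<^sup>2"
      using j(2) by (intro add_mono mult_left_mono power_mono) auto
    finally show ?thesis
      using N by (simp add: power2_eq_square field_simps)
  qed
  then show "\<exists>j<N. norm (generator (z 0) V (z j)) \<le> L + q\<^sup>2 * L\<^sup>2 / N"
    using j(1) by blast
  have q: "norm (z j) * norm (z i) = q" if "j \<le> N" "i \<le> N" for i j
    using that by (simp add: norm_Stiefel St q_def)
  have "norm (generator (z 0) V (z 0)) \<le> 3 * q ^ 3 * L"
  proof -
    have "generator (z 0) V (z 0) = real N *\<^sub>R generator (z j) (z (Suc j) - z j) (z 0)"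
      by (simp add: gen[OF j(1)] generator_diff_right generator_self)
    then have "norm (generator (z 0) V (z 0)) \<le> N * (3 * q\<^sup>2 * norm (z j) * norm (z (Suc j) - z j) * norm (z 0))"
      using norm_generator_le[of "z j" "z (Suc j) - z j" "z 0"] N by (simp add: q_def)
    also have "\<dots> = N * (3 * q\<^sup>2 * (norm (z j) * norm (z 0)) * norm (z (Suc j) - z j))"
      by (simp add: ac_simps)
    also have "\<dots> = 3 * q ^ 3 * (N * norm (z (Suc j) - z j))"
      using j(1) by (simp add: q power3_eq_cube power2_eq_square)
    also have "\<dots> \<le> 3 * q ^ 3 * L"
      using j(2) N by (intro mult_left_mono) (auto simp: q_def field_simps)
    finally show ?thesis .
  qed
  moreover have "norm (V - generator (z 0) V (z 0)) \<le> q\<^sup>2 * L\<^sup>2"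
  proof -
    have "V - generator (z 0) V (z 0) = - (real N *\<^sub>R (generator (z 0) (z 1) (z 0) - (z 1 - z 0)))"
      using gen[OF N] by (simp add: V_def scaleR_diff_right)
    then have "norm (V - generator (z 0) V (z 0)) = N * norm (generator (z 0) (z 1) (z 0) - (z 1 - z 0))"
      by simp
    also have "\<dots> \<le> N * (q\<^sup>2 * (norm (z 1 - z 0))\<^sup>2)"
      using generator_chord[OF St St, of 0 1] N by (intro mult_left_mono) (auto simp: q_def)
    also have "(norm (z 1 - z 0))\<^sup>2 \<le> discrete_energy N z"
      unfolding discrete_energy_def using N member_le_sum[of 0 "{..<N}" "\<lambda>j. (norm (z (Suc j) - z j))\<^sup>2"]
      by simp
    also have "\<dots> \<le> L\<^sup>2 / N" by (rule L(2))
    finally show ?thesis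
      using N by (simp add: mult_left_mono)
  qed
  ultimately show "norm V \<le> 3 * q ^ 3 * L + q\<^sup>2 * L\<^sup>2"
    using norm_triangle_sub[of V "generator (z 0) V (z 0)"] by linarith
qed

lemma norm_diff_le_vector_derivative:
  fixes f :: "real \<Rightarrow> 'a::real_normed_vector"
  assumes ab: "a \<le> b" and f: "\<And>t. t \<in> {a..b} \<Longrightarrow> (f has_vector_derivative f' t) (at t within {a..b})"
    and B: "\<And>t. t \<in> {a..b} \<Longrightarrow> norm (f' t) \<le> B"
  shows "norm (f b - f a) \<le> B * (b - a)"
proof -
  have "norm (f b - f a) \<le> B * norm (b - a)"
  proof (rule differentiable_bound[OF convex_real_interval(5)])
    show "(f has_derivative (\<lambda>h. h *\<^sub>R f' t)) (at t within {a..b})" if "t \<in> {a..b}" for t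
      using f[OF that] by (simp add: has_vector_derivative_def)
    show "onorm (\<lambda>h. h *\<^sub>R f' t) \<le> B" if "t \<in> {a..b}" for t
      using B[OF that] by (intro onorm_le) (simp add: mult.commute[of B] mult_left_mono)
  qed (use ab in auto)
  then show ?thesis using ab by simp
qed

text \<open>The mean value inequality, applied to \<open>u\<close> and then to \<open>u s - s A (u t)\<close>.\<close>

lemma linear_ode_euler_step:
  fixes u :: "real \<Rightarrow> 'a::real_normed_vector"
  assumes A: "linear A" "\<And>w. norm (A w) \<le> \<kappa> * norm w" and k: "0 \<le> \<kappa>"
    and u: "\<And>t. (u has_vector_derivative A (u t)) (at t)" and r: "\<And>t. norm (u t) \<le> r"
    and h: "0 \<le> h"
  shows "norm (u (t + h) - u t - h *\<^sub>R A (u t)) \<le> \<kappa>\<^sup>2 * r * h\<^sup>2"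
proof -
  have u': "(u has_vector_derivative A (u s)) (at s within I)" for s I
    using u by (rule has_vector_derivative_at_within)
  have r0: "0 \<le> r"
    using r[of 0] norm_ge_zero order_trans by blast
  have 1: "norm (u s - u t) \<le> \<kappa> * r * h" if "s \<in> {t..t+h}" for s
  proof -
    have "norm (u s - u t) \<le> (\<kappa> * r) * (s - t)"
      using that A(2) r k by (intro norm_diff_le_vector_derivative[of t s u, OF _ u'])
        (auto intro: order_trans[OF A(2)] mult_left_mono)
    also have "\<dots> \<le> (\<kappa> * r) * h"
      using that k r0 by (intro mult_left_mono) auto
    finally show ?thesis .
  qed
  have "norm ((u (t + h) - (t + h) *\<^sub>R A (u t)) - (u t - t *\<^sub>R A (u t))) \<le> (\<kappa> * (\<kappa> * r * h)) * (t + h - t)"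
  proof (rule norm_diff_le_vector_derivative)
    show "((\<lambda>s. u s - s *\<^sub>R A (u t)) has_vector_derivative A (u s - u t)) (at s within {t..t+h})" for s
      by (auto intro!: derivative_eq_intros u' simp: linear_diff[OF A(1)])
    show "norm (A (u s - u t)) \<le> \<kappa> * (\<kappa> * r * h)" if "s \<in> {t..t+h}" for s
      using 1[OF that] k by (intro order_trans[OF A(2)] mult_left_mono)
  qed (use h in auto)
  then show ?thesis
    by (simp add: algebra_simps power2_eq_square)
qed

text \<open>An Euler step with a skew operator moves orthogonally to \<open>e\<close>, so it changes the norm only to
  second order in \<open>h\<close>.\<close>

lemma skew_euler_step:
  fixes e :: "'a::real_inner"
  assumes skew: "A e \<bullet> e = 0" and A: "norm (A e) \<le> \<kappa> * norm e" and k: "0 \<le> \<kappa>"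
  shows "norm (e + h *\<^sub>R A e) \<le> norm e + h\<^sup>2 * \<kappa>\<^sup>2 * norm e"
proof (rule power2_le_imp_le)
  have "(norm (e + h *\<^sub>R A e))\<^sup>2 = (norm e)\<^sup>2 + h\<^sup>2 * (norm (A e))\<^sup>2"
    unfolding power2_norm_eq_inner using skew inner_commute[of e "A e"]
    by (simp add: inner_add_left inner_add_right power2_eq_square)
  also have "\<dots> \<le> (norm e)\<^sup>2 + h\<^sup>2 * (\<kappa> * norm e)\<^sup>2"
    using A by (intro add_left_mono mult_left_mono power_mono) auto
  also have "\<dots> \<le> (norm e)\<^sup>2 + 2 * (h\<^sup>2 * \<kappa>\<^sup>2) * (norm e)\<^sup>2 + (h\<^sup>2 * \<kappa>\<^sup>2 * norm e)\<^sup>2"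
    by (simp add: power_mult_distrib)
  also have "\<dots> = (norm e + h\<^sup>2 * \<kappa>\<^sup>2 * norm e)\<^sup>2"
    by (simp add: power2_eq_square algebra_simps)
  finally show "(norm (e + h *\<^sub>R A e))\<^sup>2 \<le> (norm e + h\<^sup>2 * \<kappa>\<^sup>2 * norm e)\<^sup>2" .
qed simp

text \<open>The error \<open>e j = z j - u (j / N)\<close> changes in one step by an Euler step, which does not
  amplify it to first order, by the chord error of the polygon, by the difference of the two generators, and by
  the consistency error of the flow. The chord errors add up to a multiple of the
  energy, which is of order \<open>1 / N\<close>.\<close>

lemma discrete_geodesic_near_flow:
  fixes z :: "nat \<Rightarrow> 'v::real_inner ^ 'p::finite"
  assumes z: "discrete_geodesic N z" and N: "0 < N"
    and L: "0 \<le> L" "discrete_energy N z \<le> L\<^sup>2 / N"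
    and u: "u 0 = z 0" "\<And>t. (u has_vector_derivative generator (z 0) v (u t)) (at t)"
  defines "q \<equiv> real CARD('p)" and "V \<equiv> real N *\<^sub>R (z 1 - z 0)"
  defines "\<kappa> \<equiv> 3 * q\<^sup>2 * sqrt q * norm v"
  assumes j: "j \<le> N"
  shows "norm (z j - u (j / N)) \<le> (3 * sqrt q * \<kappa>\<^sup>2 + q\<^sup>2 * L\<^sup>2) / N + 3 * q ^ 3 * norm (V - v)"
proof -
  let ?A = "generator (z 0) v" and ?h = "1 / real N" and ?r = "sqrt q"
  have St: "z j \<in> Stiefel UNIV" if "j \<le> N" for j
    using z that by (auto simp: discrete_geodesic_def)
  have nz: "norm (z j) = ?r" if "j \<le> N" for j
    using norm_Stiefel[OF St[OF that]] by (simp add: q_def)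
  have A: "norm (?A w) \<le> \<kappa> * norm w" for w
    using norm_generator_le[of "z 0" v w] nz[of 0] by (simp add: q_def \<kappa>_def)
  have k: "0 \<le> \<kappa>" and q: "0 \<le> q"
    by (auto simp: q_def \<kappa>_def)
  have nu: "norm (u t) = ?r" for t
    using skew_ode_norm_constant[OF is_interval_univ generator_skew u(2), of 0 t] u(1) nz[of 0] by simp
  define c where "c = 3 * ?r * \<kappa>\<^sup>2 * ?h\<^sup>2 + 3 * q ^ 3 * norm (V - v) * ?h"
  have ind: "norm (z j - u (j * ?h)) \<le> j * c + q\<^sup>2 * (\<Sum>i<j. (norm (z (Suc i) - z i))\<^sup>2)" if "j \<le> N" for j
    using that
  proof (induction j)
    case 0
    then show ?case by (simp add: u(1))
  next
    case (Suc j)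
    define e where "e = z j - u (j * ?h)"
    have split: "z (Suc j) - u (Suc j * ?h) = (e + ?h *\<^sub>R ?A e)
      - (?h *\<^sub>R generator (z 0) V (z j) - (z (Suc j) - z j))
      + ?h *\<^sub>R generator (z 0) (V - v) (z j)
      - (u (j * ?h + ?h) - u (j * ?h) - ?h *\<^sub>R ?A (u (j * ?h)))"
    proof -
      have "real (Suc j) * ?h = j * ?h + ?h"
        by (simp add: add_divide_distrib)
      then show ?thesis
        by (simp add: e_def linear_diff[OF linear_generator] generator_diff_right scaleR_diff_right)
    qed
    have "norm e \<le> 2 * ?r"
      using norm_triangle_ineq4[of "z j" "u (j * ?h)"] nz[of j] nu Suc.prems by (simp add: e_def)
    then have "?h\<^sup>2 * \<kappa>\<^sup>2 * norm e \<le> ?h\<^sup>2 * \<kappa>\<^sup>2 * (2 * ?r)"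
      by (intro mult_left_mono) auto
    then have 1: "norm (e + ?h *\<^sub>R ?A e) \<le> norm e + 2 * ?r * \<kappa>\<^sup>2 * ?h\<^sup>2"
      using skew_euler_step[of ?A e \<kappa> ?h, OF generator_skew A k] by (simp add: ac_simps)
    have 2: "norm (?h *\<^sub>R generator (z 0) V (z j) - (z (Suc j) - z j)) \<le> q\<^sup>2 * (norm (z (Suc j) - z j))\<^sup>2"
      using discrete_geodesic_bounds(1)[OF z N L] Suc.prems by (simp add: q_def V_def)
    have 3: "norm (?h *\<^sub>R generator (z 0) (V - v) (z j)) \<le> 3 * q ^ 3 * norm (V - v) * ?h"
    proof -
      have "norm (generator (z 0) (V - v) (z j)) \<le> 3 * q\<^sup>2 * ?r * norm (V - v) * ?r"
        using norm_generator_le[of "z 0" "V - v" "z j"] nz[of 0] nz[of j] Suc.prems by (simp add: q_def)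
      also have "\<dots> = 3 * q\<^sup>2 * (?r * ?r) * norm (V - v)"
        by (simp only: ac_simps)
      also have "\<dots> = 3 * q ^ 3 * norm (V - v)"
        using q by (simp add: power3_eq_cube power2_eq_square)
      finally show ?thesis
        using N by (simp add: divide_right_mono)
    qed
    have 4: "norm (u (j * ?h + ?h) - u (j * ?h) - ?h *\<^sub>R ?A (u (j * ?h))) \<le> \<kappa>\<^sup>2 * ?r * ?h\<^sup>2"
      by (rule linear_ode_euler_step[OF linear_generator A k u(2)]) (auto simp: nu)
    have "norm (z (Suc j) - u (Suc j * ?h)) \<le> norm (e + ?h *\<^sub>R ?A e)
      + norm (?h *\<^sub>R generator (z 0) V (z j) - (z (Suc j) - z j))
      + norm (?h *\<^sub>R generator (z 0) (V - v) (z j))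
      + norm (u (j * ?h + ?h) - u (j * ?h) - ?h *\<^sub>R ?A (u (j * ?h)))"
      unfolding split
      by (intro order_trans[OF norm_triangle_ineq4] add_mono order_trans[OF norm_triangle_ineq] order_refl)
    also have "\<dots> \<le> norm e + c + q\<^sup>2 * (norm (z (Suc j) - z j))\<^sup>2"
      using 1 2 3 4 by (simp add: c_def mult.commute[of "\<kappa>\<^sup>2" ?r])
    also have "\<dots> \<le> Suc j * c + q\<^sup>2 * (\<Sum>i<Suc j. (norm (z (Suc i) - z i))\<^sup>2)"
      using Suc by (simp add: e_def algebra_simps)
    finally show ?case .
  qed
  have "0 \<le> c"
    using q by (auto simp: c_def)
  have "norm (z j - u (j / N)) \<le> j * c + q\<^sup>2 * (\<Sum>i<j. (norm (z (Suc i) - z i))\<^sup>2)"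
    using ind[OF j] by simp
  also have "\<dots> \<le> N * c + q\<^sup>2 * discrete_energy N z"
    unfolding discrete_energy_def using j \<open>0 \<le> c\<close>
    by (intro add_mono mult_right_mono mult_left_mono sum_mono2) auto
  also have "\<dots> \<le> N * c + q\<^sup>2 * (L\<^sup>2 / N)"
    using L(2) by (intro add_left_mono mult_left_mono) auto
  also have "N * c = 3 * ?r * \<kappa>\<^sup>2 / N + 3 * q ^ 3 * norm (V - v)"
    using N by (simp add: c_def power2_eq_square field_simps)
  finally show ?thesis
    by (simp add: add_divide_distrib)
qed

text \<open>The scaled initial edges are bounded and lie in a finite-dimensional space; \<open>v\<close> is a limit
  point of them. It is tangential because an edge violates tangency only quadratically. The polygons approach the
  flow of \<open>v\<close>, which therefore ends at \<open>y\<close>. The speed of the flow is constant, and at a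
  vertex that begins an edge of length at most \<open>L N / N\<close> it is bounded by \<open>L N\<close> up to a null sequence.\<close>

lemma discrete_geodesics_converge:
  fixes x y :: "'v::real_inner ^ 'p::finite" and z :: "nat \<Rightarrow> nat \<Rightarrow> 'v ^ 'p"
  assumes C: "orthonormal C" and x: "x \<in> Stiefel (span C)"
    and z: "\<And>N. 0 < N \<Longrightarrow> discrete_geodesic N (z N)" "\<And>N. 0 < N \<Longrightarrow> z N 1 \<in> Stiefel (span C)"
      "\<And>N. 0 < N \<Longrightarrow> z N 0 = x" "\<And>N. 0 < N \<Longrightarrow> z N N = y"
    and energy: "\<And>N. 0 < N \<Longrightarrow> discrete_energy N (z N) \<le> (L N)\<^sup>2 / N"
    and L: "\<And>N. 0 \<le> L N" "L \<longlonglongrightarrow> l"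
  shows "\<exists>v u. tangential x v \<and> (\<forall>k. v $ k \<in> span C) \<and> norm v \<le> l \<and> u 0 = x \<and> u 1 = y \<and>
     (\<forall>t::real. (u has_vector_derivative generator x v (u t)) (at t)) \<and> (\<forall>t k. u t $ k \<in> span C)"
proof -
  define q where "q = real CARD('p)"
  have q: "0 \<le> q" by (simp add: q_def)
  have xC: "x $ k \<in> span C" and xSt: "x \<in> Stiefel UNIV" for k
    using x Stiefel_subspace_iff[OF subspace_span] by auto
  obtain M where M: "\<And>N. L N \<le> M" "0 \<le> M"
  proof -
    have "Bseq L"
      using L(2) by (intro convergent_imp_Bseq) (auto simp: convergent_def)
    then obtain M where "0 < M" "\<And>N. norm (L N) \<le> M"
      unfolding Bseq_def by blast
    then show thesis
      using that[of M] by (metis abs_le_D1 less_imp_le real_norm_def)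
  qed
  \<comment> \<open>Indices are shifted by one, as a polygon has at least one edge.\<close>
  define V where "V n = real (Suc n) *\<^sub>R (z (Suc n) 1 - z (Suc n) 0)" for n
  define B where "B = 3 * q ^ 3 * M + q\<^sup>2 * M\<^sup>2"
  have VB: "norm (V n) \<le> B" for n
  proof -
    have "norm (V n) \<le> 3 * q ^ 3 * L (Suc n) + q\<^sup>2 * (L (Suc n))\<^sup>2"
      using discrete_geodesic_bounds(3)[OF z(1) _ L(1) energy, of "Suc n"] by (simp add: q_def V_def)
    also have "\<dots> \<le> B"
      unfolding B_def using M L(1) q by (intro add_mono mult_left_mono power_mono) auto
    finally show ?thesis .
  qed
  let ?W = "{v :: 'v ^ 'p. \<forall>k. v $ k \<in> span C}"
  have VW: "V n $ k \<in> span C" for n k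
    using z(2)[of "Suc n"] z(3)[of "Suc n"] xC Stiefel_subspace_iff[OF subspace_span, of _ C]
    by (auto simp: V_def intro!: span_scale span_diff)
  have "compact (?W \<inter> cball 0 B)"
    by (rule compact_vec_in_span[OF orthonormal_finite[OF C]])
      (auto intro!: closed_Int closed_subspace_vec closed_span_finite orthonormal_finite[OF C]
        bounded_Int)
  moreover have "V n \<in> ?W \<inter> cball 0 B" for n
    using VW VB by simp
  ultimately obtain v s where v: "v \<in> ?W \<inter> cball 0 B" and s: "strict_mono s" "(V \<circ> s) \<longlonglongrightarrow> v"
    using seq_compactE[OF compact_imp_seq_compact] by blast
  define n where "n i = Suc (s i)" for i
  have n0: "0 < n i" for i
    by (simp add: n_def)
  have n_top: "filterlim (\<lambda>i. real (n i)) at_top sequentially"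
    unfolding n_def
    by (intro filterlim_compose[OF filterlim_real_sequentially] filterlim_compose[OF filterlim_Suc]
        filterlim_subseq s(1))
  have inv0: "(\<lambda>i. c / real (n i)) \<longlonglongrightarrow> 0" for c
    by (intro tendsto_divide_0[OF tendsto_const] filterlim_at_top_imp_at_infinity n_top)
  have Vs: "(\<lambda>i. V (s i)) \<longlonglongrightarrow> v"
    using s(2) by (simp add: o_def)
  have Vv: "(\<lambda>i. norm (V (s i) - v)) \<longlonglongrightarrow> 0"
    using Vs by (simp add: LIM_zero_iff tendsto_norm_zero_iff)
  have Ls: "(\<lambda>i. L (n i)) \<longlonglongrightarrow> l"
    using L(2) filterlim_compose[OF L(2), of n sequentially]
    unfolding n_def by (simp add: filterlim_compose[OF filterlim_Suc] filterlim_subseq s(1))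
  have tang: "tangential x v"
    unfolding tangential_def
  proof (intro allI)
    fix j k
    have lim: "(\<lambda>i. x $ j \<bullet> V (s i) $ k + V (s i) $ j \<bullet> x $ k) \<longlonglongrightarrow> x $ j \<bullet> v $ k + v $ j \<bullet> x $ k"
      by (intro tendsto_intros Vs)
    have "(\<lambda>i. x $ j \<bullet> V (s i) $ k + V (s i) $ j \<bullet> x $ k) \<longlonglongrightarrow> 0"
    proof (rule Lim_null_comparison[OF always_eventually inv0[of "B\<^sup>2"]], intro allI)
      fix i
      define d where "d = z (n i) 1 - x"
      have V: "V (s i) = real (n i) *\<^sub>R d"
        using z(3)[OF n0] by (simp add: V_def n_def d_def)
      have "z (n i) 1 = x + d" by (simp add: d_def)
      moreover have "z (n i) 1 \<in> Stiefel UNIV"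
        using z(2)[OF n0] Stiefel_subspace_iff[OF subspace_span] by blast
      ultimately have "(x $ j + d $ j) \<bullet> (x $ k + d $ k) = x $ j \<bullet> x $ k"
        using gram_Stiefel[of "x + d" j k] gram_Stiefel[OF xSt, of j k] by simp
      then have "x $ j \<bullet> d $ k + d $ j \<bullet> x $ k = - (d $ j \<bullet> d $ k)"
        by (simp add: inner_add_left inner_add_right)
      then have "x $ j \<bullet> V (s i) $ k + V (s i) $ j \<bullet> x $ k = - (V (s i) $ j \<bullet> V (s i) $ k) / n i"
        using n0[of i] unfolding V by (simp add: distrib_left[symmetric])
      moreover have "\<bar>V (s i) $ j \<bullet> V (s i) $ k\<bar> \<le> B\<^sup>2"
      proof -
        have "\<bar>V (s i) $ j \<bullet> V (s i) $ k\<bar> \<le> norm (V (s i) $ j) * norm (V (s i) $ k)"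
          by (rule Cauchy_Schwarz_ineq2)
        also have "\<dots> \<le> B * B"
          using order_trans[OF Finite_Cartesian_Product.norm_nth_le VB]
            order_trans[OF norm_ge_zero VB] by (intro mult_mono) auto
        finally show ?thesis by (simp add: power2_eq_square)
      qed
      ultimately show "norm (x $ j \<bullet> V (s i) $ k + V (s i) $ j \<bullet> x $ k) \<le> B\<^sup>2 / real (n i)"
        by (simp add: divide_right_mono)
    qed
    then show "x $ j \<bullet> v $ k + v $ j \<bullet> x $ k = 0"
      using LIMSEQ_unique[OF lim] by blast
  qed
  obtain u where u: "u 0 = x" "\<And>t. (u has_vector_derivative generator x v (u t)) (at t)"
      and u_span: "\<And>t k. u t $ k \<in> span (range (($) x) \<union> range (($) v))"
    using generator_flow_exists[of x v] by blast
  have "span (range (($) x) \<union> range (($) v)) \<subseteq> span C"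
    using xC v by (intro span_minimal) auto
  then have uC: "u t $ k \<in> span C" for t k
    using u_span by blast
  define \<kappa> where "\<kappa> = 3 * q\<^sup>2 * sqrt q * norm v"
  define E where "E i = (3 * sqrt q * \<kappa>\<^sup>2 + q\<^sup>2 * (L (n i))\<^sup>2) / n i + 3 * q ^ 3 * norm (V (s i) - v)" for i
  have E0: "E \<longlonglongrightarrow> 0"
  proof -
    have "(\<lambda>i. (3 * sqrt q * \<kappa>\<^sup>2) * (1 / n i) + q\<^sup>2 * (L (n i))\<^sup>2 * (1 / n i) + 3 * q ^ 3 * norm (V (s i) - v))
        \<longlonglongrightarrow> (3 * sqrt q * \<kappa>\<^sup>2) * 0 + q\<^sup>2 * l\<^sup>2 * 0 + 3 * q ^ 3 * 0"
      by (intro tendsto_intros inv0 Ls Vv)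
    then show ?thesis
      by (simp add: E_def[abs_def] add_divide_distrib)
  qed
  have near: "norm (z (n i) j - u (j / n i)) \<le> E i" if "j \<le> n i" for i j
    using discrete_geodesic_near_flow[OF z(1)[OF n0] n0 L(1) energy[OF n0], of u i v j] that u z(3)[OF n0]
    by (simp add: E_def \<kappa>_def q_def V_def n_def)
  have "u 1 = y"
  proof -
    have "norm (y - u 1) \<le> E i" for i
      using near[of "n i" i] z(4)[OF n0] n0[of i] by simp
    then have "norm (y - u 1) \<le> 0"
      using E0 by (intro LIMSEQ_le_const) auto
    then show ?thesis by simp
  qed
  moreover have "norm v \<le> l"
  proof -
    have speed: "norm (generator x v (u t)) = norm v" for t
    proof -
      have "((\<lambda>t. generator x v (u t)) has_vector_derivative generator x v (generator x v (u t))) (at t)" for t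
        by (rule bounded_linear.has_vector_derivative[OF bounded_linear_generator u(2)])
      from skew_ode_norm_constant[OF is_interval_univ generator_skew this, of t 0]
      show ?thesis
        using u(1) generator_base_tangential[OF xSt tang] by simp
    qed
    \<comment> \<open>The speed at the short edge differs from \<open>norm v\<close> only by terms that tend to zero.\<close>
    have bound: "norm v \<le> \<kappa> * E i + 3 * q ^ 3 * norm (V (s i) - v) + (L (n i) + q\<^sup>2 * (L (n i))\<^sup>2 * (1 / n i))" for i
    proof -
      obtain j where j: "j < n i" "norm (generator x (V (s i)) (z (n i) j)) \<le> L (n i) + q\<^sup>2 * (L (n i))\<^sup>2 / n i"
        using discrete_geodesic_bounds(2)[OF z(1)[OF n0] n0 L(1) energy[OF n0], of i] z(3)[OF n0, of i]
        by (auto simp: q_def V_def n_def)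
      let ?z = "z (n i) j" and ?t = "j / n i"
      have zSt: "?z \<in> Stiefel UNIV"
        using z(1)[OF n0, of i] j(1) by (auto simp: discrete_geodesic_def)
      have nx: "norm x = sqrt q" "norm ?z = sqrt q"
        using norm_Stiefel[OF xSt] norm_Stiefel[OF zSt] by (simp_all add: q_def)
      have "generator x v (u ?t) = generator x v (u ?t - ?z) - generator x (V (s i) - v) ?z + generator x (V (s i)) ?z"
        by (simp add: linear_diff[OF linear_generator] generator_diff_right)
      then have "norm v \<le> norm (generator x v (u ?t - ?z)) + norm (generator x (V (s i) - v) ?z)
          + norm (generator x (V (s i)) ?z)"
        unfolding speed[of ?t, symmetric]
        by (simp only:) (intro order_trans[OF norm_triangle_ineq] add_mono norm_triangle_ineq4 order_refl)
      moreover have "norm (generator x v (u ?t - ?z)) \<le> \<kappa> * E i"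
      proof -
        have "norm (generator x v (u ?t - ?z)) \<le> \<kappa> * norm (u ?t - ?z)"
          using norm_generator_le[of x v "u ?t - ?z"] nx by (simp add: \<kappa>_def q_def)
        also have "\<dots> \<le> \<kappa> * E i"
          using near[of j i] j(1) q by (intro mult_left_mono) (auto simp: norm_minus_commute \<kappa>_def)
        finally show ?thesis .
      qed
      moreover have "norm (generator x (V (s i) - v) ?z) \<le> 3 * q ^ 3 * norm (V (s i) - v)"
      proof -
        have "norm (generator x (V (s i) - v) ?z) \<le> 3 * q\<^sup>2 * sqrt q * norm (V (s i) - v) * sqrt q"
          using norm_generator_le[of x "V (s i) - v" ?z] nx by (simp add: q_def)
        also have "\<dots> = 3 * q\<^sup>2 * (sqrt q * sqrt q) * norm (V (s i) - v)"
          by (simp only: ac_simps)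
        also have "\<dots> = 3 * q ^ 3 * norm (V (s i) - v)"
          using q by (simp add: power3_eq_cube power2_eq_square)
        finally show ?thesis .
      qed
      ultimately show ?thesis
        using j(2) by simp
    qed
    have "(\<lambda>i. \<kappa> * E i + 3 * q ^ 3 * norm (V (s i) - v) + (L (n i) + q\<^sup>2 * (L (n i))\<^sup>2 * (1 / n i)))
        \<longlonglongrightarrow> \<kappa> * 0 + 3 * q ^ 3 * 0 + (l + q\<^sup>2 * l\<^sup>2 * 0)"
      by (intro tendsto_intros E0 Vv Ls inv0)
    then have "norm v \<le> \<kappa> * 0 + 3 * q ^ 3 * 0 + (l + q\<^sup>2 * l\<^sup>2 * 0)"
      by (rule LIMSEQ_le_const) (use bound in auto)
    then show ?thesis by simp
  qed
  ultimately show ?thesis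
    using tang v u uC by (intro exI[of _ v] exI[of _ u]) auto
qed


section \<open>Inscribed polygons and connectedness\<close>

definition lipschitz_connected :: "'a::metric_space set \<Rightarrow> 'a \<Rightarrow> 'a \<Rightarrow> bool" where
  "lipschitz_connected M x y \<longleftrightarrow>
     (\<exists>c T K. 0 \<le> T \<and> K-lipschitz_on {0..T::real} c \<and> c ` {0..T} \<subseteq> M \<and> c 0 = x \<and> c T = y)"

lemma lipschitz_connected_refl: "x \<in> M \<Longrightarrow> lipschitz_connected M x x"
  unfolding lipschitz_connected_def
  by (intro exI[of _ "\<lambda>_. x"] exI[of _ 0]) (auto intro: lipschitz_on_constant)

lemma lipschitz_connected_trans:
  assumes "lipschitz_connected M x y" "lipschitz_connected M y z"
  shows "lipschitz_connected M x z"
proof -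
  obtain a K and S :: real where a: "0 \<le> S" "K-lipschitz_on {0..S} a" "a ` {0..S} \<subseteq> M" "a 0 = x" "a S = y"
    using assms(1) unfolding lipschitz_connected_def by blast
  obtain b L and T :: real where b: "0 \<le> T" "L-lipschitz_on {0..T} b" "b ` {0..T} \<subseteq> M" "b 0 = y" "b T = z"
    using assms(2) unfolding lipschitz_connected_def by blast
  let ?b = "\<lambda>t. b (t - S)"
  have b': "L-lipschitz_on {S..S+T} ?b"
  proof (rule lipschitz_onI)
    show "dist (b (s - S)) (b (t - S)) \<le> L * dist s t" if "s \<in> {S..S+T}" "t \<in> {S..S+T}" for s t
      using lipschitz_onD[OF b(2), of "s - S" "t - S"] that by (simp add: dist_real_def)
    show "0 \<le> L" by (rule lipschitz_on_nonneg[OF b(2)])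
  qed
  let ?c = "\<lambda>t. if t \<le> S then a t else ?b t"
  have "(max K L)-lipschitz_on {0..S+T} ?c"
    by (rule lipschitz_on_concat_max[OF a(2) b']) (simp add: a b)
  moreover have "?c ` {0..S+T} \<subseteq> M"
    using a b by (auto simp: image_subset_iff)
  moreover have "?c 0 = x" "?c (S + T) = z"
    using a b by auto
  ultimately show ?thesis
    unfolding lipschitz_connected_def using a(1) b(1)
    by (intro exI[of _ ?c] exI[of _ "S + T"] exI[of _ "max K L"]) auto
qed

lemma lipschitz_connected_polygon:
  assumes "lipschitz_connected M x y"
  shows "\<exists>L\<ge>0. \<forall>N>0. \<exists>z. z 0 = x \<and> z N = y \<and> (\<forall>j\<le>N. z j \<in> M) \<and> discrete_energy N z \<le> L\<^sup>2 / N"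
proof -
  obtain c K and T :: real where c: "0 \<le> T" "K-lipschitz_on {0..T} c" "c ` {0..T} \<subseteq> M" "c 0 = x" "c T = y"
    using assms unfolding lipschitz_connected_def by blast
  have K: "0 \<le> K" by (rule lipschitz_on_nonneg[OF c(2)])
  show ?thesis
  proof (intro exI[of _ "K * T"] conjI allI impI)
    fix N :: nat assume N: "0 < N"
    define z where "z j = c (j * T / N)" for j :: nat
    have dom: "j * T / N \<in> {0..T}" if "j \<le> N" for j
      using that N c(1) by (auto simp: field_simps mult_left_mono)
    have "norm (z (Suc j) - z j) \<le> K * T / N" if "j < N" for j
    proof -
      have "dist (c (Suc j * T / N)) (c (j * T / N)) \<le> K * dist (Suc j * T / N) (j * T / N)"
        using lipschitz_onD[OF c(2) dom dom, of "Suc j" j] that by simp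
      also have "dist (Suc j * T / N) (j * T / N) = T / N"
        using c(1) by (simp add: dist_real_def diff_divide_distrib[symmetric] algebra_simps)
      finally show ?thesis by (simp add: z_def dist_norm)
    qed
    then have "discrete_energy N z \<le> (\<Sum>j<N. (K * T / N)\<^sup>2)"
      unfolding discrete_energy_def by (intro sum_mono power_mono) auto
    also have "\<dots> = (K * T)\<^sup>2 / N"
      using N by (simp add: power2_eq_square)
    finally have "discrete_energy N z \<le> (K * T)\<^sup>2 / N" .
    moreover have "z j \<in> M" if "j \<le> N" for j
      using c(3) dom[OF that] by (auto simp: z_def)
    ultimately show "\<exists>z. z 0 = x \<and> z N = y \<and> (\<forall>j\<le>N. z j \<in> M) \<and> discrete_energy N z \<le> (K * T)\<^sup>2 / N"
      using c(4,5) N by (intro exI[of _ z]) (auto simp: z_def)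
  qed (use K c(1) in auto)
qed

text \<open>The rotation by the angle \<open>t\<close> in the plane of the orthonormal pair \<open>e\<close>, \<open>f\<close>, from \<open>e\<close> towards \<open>f\<close>.\<close>

definition plane_rotation :: "'v::real_inner \<Rightarrow> 'v \<Rightarrow> real \<Rightarrow> 'v \<Rightarrow> 'v" where
  "plane_rotation e f t w = w + ((cos t - 1) * (e \<bullet> w) - sin t * (f \<bullet> w)) *\<^sub>R e
     + (sin t * (e \<bullet> w) + (cos t - 1) * (f \<bullet> w)) *\<^sub>R f"

lemma inner_plane_rotation:
  assumes e: "e \<bullet> e = 1" "f \<bullet> f = 1" "e \<bullet> f = 0"
  shows "plane_rotation e f t v \<bullet> plane_rotation e f t w = v \<bullet> w"
proof -
  define a b a' b' c s where d: "a = e \<bullet> v" "b = f \<bullet> v" "a' = e \<bullet> w" "b' = f \<bullet> w" "c = cos t" "s = sin t"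
  have cs: "c * c + s * s = 1"
    using sin_cos_squared_add2[of t] by (simp add: d power2_eq_square add.commute)
  have "plane_rotation e f t v \<bullet> plane_rotation e f t w = v \<bullet> w
     + ((c - 1) * a - s * b) * a' + (s * a + (c - 1) * b) * b'
     + ((c - 1) * a' - s * b') * a + (s * a' + (c - 1) * b') * b
     + ((c - 1) * a - s * b) * ((c - 1) * a' - s * b')
     + (s * a + (c - 1) * b) * (s * a' + (c - 1) * b')"
    using e unfolding plane_rotation_def d
    by (simp add: inner_add_left inner_add_right inner_commute[of f e] inner_commute[of v e]
        inner_commute[of v f] inner_commute[of w e] inner_commute[of w f] algebra_simps)
  also have "\<dots> = v \<bullet> w"
    using cs by algebra
  finally show ?thesis .
qed

lemma plane_rotation_lipschitz:
  fixes x :: "'v::real_inner ^ 'p::finite"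
  assumes T: "0 \<le> T" and e: "norm e = 1" "norm f = 1"
  shows "\<exists>K. K-lipschitz_on {0..T} (\<lambda>t. induced_map (plane_rotation e f t) x)"
proof -
  let ?c = "\<lambda>t. induced_map (plane_rotation e f t) x"
  define c' where "c' t = (\<chi> k. (- sin t * (e \<bullet> x $ k) - cos t * (f \<bullet> x $ k)) *\<^sub>R e
     + (cos t * (e \<bullet> x $ k) - sin t * (f \<bullet> x $ k)) *\<^sub>R f)" for t
  have d: "(?c has_vector_derivative c' t) (at t within I)" for t I
  proof (rule has_vector_derivative_componentwise)
    show "((\<lambda>t. ?c t $ k) has_vector_derivative c' t $ k) (at t within I)" for k
      unfolding c'_def induced_map_nth plane_rotation_def vec_lambda_beta
      by (auto intro!: derivative_eq_intros simp: has_real_derivative_iff_has_vector_derivative[symmetric])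
  qed
  have ax: "\<bar>e \<bullet> w\<bar> \<le> norm w" "\<bar>f \<bullet> w\<bar> \<le> norm w" for w
    using Cauchy_Schwarz_ineq2[of e w] Cauchy_Schwarz_ineq2[of f w] e by auto
  have b: "norm (c' t) \<le> (\<Sum>k\<in>UNIV. 4 * norm (x $ k))" for t
  proof -
    have "norm (c' t) \<le> (\<Sum>k\<in>UNIV. norm (c' t $ k))"
      unfolding norm_vec_def by (rule L2_set_le_sum) auto
    also have "\<dots> \<le> (\<Sum>k\<in>UNIV. 4 * norm (x $ k))"
    proof (rule sum_mono)
      fix k
      have m: "\<bar>r * (g \<bullet> x $ k)\<bar> \<le> norm (x $ k)" if "\<bar>r\<bar> \<le> 1" "g = e \<or> g = f" for r g
        using mult_mono[OF that(1), of "\<bar>g \<bullet> x $ k\<bar>" "norm (x $ k)"] ax that(2) by (auto simp: abs_mult)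
      have "norm (c' t $ k) \<le> \<bar>- sin t * (e \<bullet> x $ k) - cos t * (f \<bullet> x $ k)\<bar>
         + \<bar>cos t * (e \<bullet> x $ k) - sin t * (f \<bullet> x $ k)\<bar>"
        unfolding c'_def vec_lambda_beta by (rule order_trans[OF norm_triangle_ineq]) (simp add: e)
      then show "norm (c' t $ k) \<le> 4 * norm (x $ k)"
        using m[of "sin t" e] m[of "cos t" f] m[of "cos t" e] m[of "sin t" f] by auto
    qed
    finally show ?thesis .
  qed
  have "(\<Sum>k\<in>UNIV. 4 * norm (x $ k))-lipschitz_on {0..T} ?c"
  proof (rule lipschitz_onI)
    have *: "dist (?c s) (?c t) \<le> (\<Sum>k\<in>UNIV. 4 * norm (x $ k)) * dist s t" if "s \<le> t" for s t
      using norm_diff_le_vector_derivative[OF that d b] that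
      by (simp add: dist_norm norm_minus_commute[of "?c s"])
    show "dist (?c s) (?c t) \<le> (\<Sum>k\<in>UNIV. 4 * norm (x $ k)) * dist s t" for s t
      using *[of s t] *[of t s] by (cases "s \<le> t") (auto simp: dist_commute)
  qed (auto intro: sum_nonneg)
  then show ?thesis by blast
qed

text \<open>The columns of \<open>x\<close> are made equal to those of \<open>y\<close> one after the other. A column \<open>e\<close> is turned into
  its target in the plane that they span. Both are orthogonal to the columns that already agree, so the rotation of
  the whole frame leaves those in place.\<close>

lemma Stiefel_lipschitz_connected:
  fixes x y :: "'v::real_inner ^ 'p::finite"
  assumes dimV: "finite (B::'v set)" "independent B" "card B = 2 * CARD('p)"
    and x: "x \<in> Stiefel UNIV" and y: "y \<in> Stiefel UNIV"
  shows "lipschitz_connected (Stiefel UNIV) x y"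
proof -
  have "\<exists>w. lipschitz_connected (Stiefel UNIV) x w \<and> w \<in> Stiefel UNIV \<and> (\<forall>j\<in>S. w $ j = y $ j)"
    if "finite S" for S :: "'p set"
    using that
  proof (induction S)
    case empty
    then show ?case
      using lipschitz_connected_refl[OF x] x by blast
  next
    case (insert k S)
    then obtain w where w: "lipschitz_connected (Stiefel UNIV) x w" "w \<in> Stiefel UNIV"
        "\<And>j. j \<in> S \<Longrightarrow> w $ j = y $ j"
      by blast
    define e where "e = w $ k"
    have ee: "e \<bullet> e = 1"
      by (simp add: e_def gram_Stiefel[OF w(2)])
    have ey: "e \<bullet> y $ j = 0" if "j \<in> S" for j
      using insert(2) that gram_Stiefel[OF w(2), of k j] by (auto simp: e_def w(3)[symmetric])
    have yy: "y $ i \<bullet> y $ j = (if i = j then 1 else 0)" for i j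
      by (rule gram_Stiefel[OF y])
    define g where "g = y $ k - (e \<bullet> y $ k) *\<^sub>R e"
    have ge: "g \<bullet> e = 0"
      by (simp add: g_def inner_diff_left ee inner_commute[of "y $ k" e])
    have gy: "g \<bullet> y $ j = 0" if "j \<in> S" for j
      using insert(2) that yy[of k j] ey[OF that] by (auto simp: g_def inner_diff_left)
    obtain f where f: "f \<bullet> f = 1" "e \<bullet> f = 0" "\<And>j. j \<in> S \<Longrightarrow> f \<bullet> y $ j = 0" "g = norm g *\<^sub>R f"
    proof (cases "g = 0")
      case False
      show thesis
      proof (rule that[of "g /\<^sub>R norm g"])
        show "(g /\<^sub>R norm g) \<bullet> (g /\<^sub>R norm g) = 1"
          using False by (simp add: power2_norm_eq_inner[symmetric] power2_eq_square)
      qed (use False ge gy in \<open>simp_all add: inner_commute\<close>)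
    next
      case True
      \<comment> \<open>The target is \<open>e\<close> or \<open>- e\<close>, and any direction orthogonal to all columns will do; \<open>p < 2p\<close> leaves room for one.\<close>
      let ?X = "range (($) w)"
      have X: "orthonormal ?X"
      proof -
        have "w $ i \<bullet> w $ j = (if w $ i = w $ j then 1 else 0)" for i j
          using gram_Stiefel[OF w(2), of i j] gram_Stiefel[OF w(2), of i i] by (cases "i = j") auto
        then show ?thesis by (auto simp: orthonormal_def)
      qed
      obtain D where D: "orthonormal D" "?X \<subseteq> D" "span D = span (?X \<union> B)"
        using orthonormal_extension[OF X dimV(1)] by blast
      have "card B \<le> card D"
        by (rule card_independent_le_orthonormal[OF D(1) dimV(2)]) (auto simp: D(3) intro: span_base)
      moreover have "card ?X \<le> CARD('p)"
        by (rule card_image_le) simp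
      moreover have "0 < CARD('p)"
        by simp
      ultimately have "card ?X < card D"
        using dimV(3) by linarith
      then have "\<not> D \<subseteq> ?X"
        using card_mono[of ?X D] by auto
      then obtain f where f: "f \<in> D" "f \<notin> ?X"
        by blast
      have fw: "f \<bullet> w $ j = 0" "w $ j \<bullet> f = 0" for j
      proof -
        have "w $ j \<in> D" "f \<noteq> w $ j"
          using D(2) f(2) by auto
        then show "f \<bullet> w $ j = 0" "w $ j \<bullet> f = 0"
          using D(1) f(1) unfolding orthonormal_def by auto
      qed
      moreover have "f \<bullet> f = 1"
        using D(1) f(1) by (simp add: orthonormal_def)
      ultimately show thesis
        using True by (intro that[of f]) (simp_all add: e_def fw w(3)[symmetric])
    qed
    have nef: "norm e = 1" "norm f = 1"
      using ee f(1) by (simp_all add: norm_eq_sqrt_inner)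
    have yk: "y $ k = (e \<bullet> y $ k) *\<^sub>R e + norm g *\<^sub>R f"
      using f(4) by (simp add: g_def)
    have "y $ k \<bullet> y $ k = (e \<bullet> y $ k)\<^sup>2 + (norm g)\<^sup>2"
      by (subst (1 2) yk) (simp add: inner_add_left inner_add_right ee f(1,2) inner_commute[of f e] power2_eq_square)
    then have "(e \<bullet> y $ k)\<^sup>2 + (norm g)\<^sup>2 = 1"
      by (simp add: yy)
    then obtain T where T: "0 \<le> T" "e \<bullet> y $ k = cos T" "norm g = sin T"
      using sincos_total_2pi by metis
    define c where "c t = induced_map (plane_rotation e f t) w" for t
    have cSt: "c t \<in> Stiefel UNIV" for t
      using gram_Stiefel[OF w(2)]
      by (simp add: Stiefel_iff_orthonormal c_def inner_plane_rotation[OF ee f(1,2)])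
    have fe: "f \<bullet> e = 0" using f(2) by (simp add: inner_commute)
    have "c T $ j = y $ j" if j: "j \<in> insert k S" for j
    proof (cases "j = k")
      case True
      have "c T $ k = cos T *\<^sub>R e + sin T *\<^sub>R f"
        unfolding c_def induced_map_nth plane_rotation_def e_def[symmetric] ee fe by (simp add: algebra_simps)
      then show ?thesis
        using yk T True by simp
    next
      case False
      then show ?thesis
        using j w(3) ey f(3) by (auto simp: c_def plane_rotation_def)
    qed
    moreover have "c 0 = w"
      by (simp add: c_def plane_rotation_def vec_eq_iff)
    moreover obtain K where "K-lipschitz_on {0..T} c"
      using plane_rotation_lipschitz[OF T(1) nef, of w] unfolding c_def by blast
    ultimately have "lipschitz_connected (Stiefel UNIV) w (c T)"
      unfolding lipschitz_connected_def using T(1) cSt by blast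
    then show ?case
      using lipschitz_connected_trans[OF w(1)] cSt \<open>\<And>j. j \<in> insert k S \<Longrightarrow> c T $ j = y $ j\<close> by blast
  qed
  from this[of UNIV] show ?thesis
    by (metis UNIV_I finite_code vec_eq_iff)
qed

text \<open>The vertices are chosen at equal arc length by the intermediate value theorem, so every edge has
  length at most \<open>L / N\<close>.\<close>

lemma smooth_path_polygon:
  fixes \<gamma> :: "real \<Rightarrow> 'a::real_inner"
  assumes g: "\<gamma> \<in> smooth_paths M x y" and N: "0 < N"
  shows "\<exists>z. z 0 = x \<and> z N = y \<and> (\<forall>j\<le>N. z j \<in> M) \<and>
    discrete_energy N z \<le> (curve_length \<gamma> 0 1)\<^sup>2 / N"
proof -
  let ?v = "velocity {0..1} \<gamma>"
  have sm: "smooth_curve_on {0..1} \<gamma>" and gM: "\<gamma> ` {0..1} \<subseteq> M" and ends: "\<gamma> 0 = x" "\<gamma> 1 = y"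
    using g by (auto simp: smooth_paths_def)
  obtain D where D: "\<forall>t\<in>{0..1}. (\<gamma> has_vector_derivative ?v t) (at t within {0..1}) \<and>
      (?v has_vector_derivative D t) (at t within {0..1})"
    using smooth_curve_velocity[OF _ _ sm] by (auto simp: is_interval_cc)
  then have dv: "\<And>t. t \<in> {0..1} \<Longrightarrow> (\<gamma> has_vector_derivative ?v t) (at t within {0..1})"
      and dD: "\<And>t. t \<in> {0..1} \<Longrightarrow> (?v has_vector_derivative D t) (at t within {0..1})"
    by blast+
  have contv: "continuous_on {0..1} (\<lambda>t. norm (?v t))"
    by (intro continuous_on_norm continuous_on_vector_derivative[OF dD])
  have contg: "continuous_on {0..1} \<gamma>"
    by (rule continuous_on_vector_derivative[OF dv])
  define s where "s t = integral {0..t} (\<lambda>t. norm (?v t))" for t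
  have ds: "(s has_vector_derivative norm (?v t)) (at t within {0..1})" if "t \<in> {0..1}" for t
    unfolding s_def by (rule integral_has_vector_derivative[OF contv that])
  have conts: "continuous_on {0..1} s"
    by (rule continuous_on_vector_derivative[OF ds])
  let ?L = "curve_length \<gamma> 0 1"
  have s01: "s 0 = 0" "s 1 = ?L"
    by (simp_all add: s_def curve_length_def)
  have L0: "0 \<le> ?L"
    unfolding curve_length_def by (rule integral_nonneg[OF integrable_continuous_real[OF contv]]) simp
  have chord: "norm (\<gamma> b - \<gamma> a) \<le> s b - s a" if ab: "a \<le> b" "a \<in> {0..1}" "b \<in> {0..1}" for a b
  proof (cases "a = b")
    case False
    have sub: "{a..b} \<subseteq> {0..1}" using ab by auto
    have at: "at t within {0..1} = at t" if "a < t" "t < b" for t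
      using that ab by (intro at_within_interior) auto
    show ?thesis
    proof (rule differentiable_bound_general)
      show "a < b" using False ab by simp
      show "(\<gamma> has_vector_derivative ?v t) (at t)" if "a < t" "t < b" for t
        using dv[of t] at[OF that] that ab by auto
      show "(s has_vector_derivative norm (?v t)) (at t)" if "a < t" "t < b" for t
        using ds[of t] at[OF that] that ab by auto
    qed (use sub contg conts in \<open>auto intro: continuous_on_subset\<close>)
  qed simp
  \<comment> \<open>The parameters of the endpoints are prescribed, because arc length need not determine them when the velocity vanishes near \<open>0\<close> or \<open>1\<close>.\<close>
  have "\<exists>t\<in>{0..1}. s t = j * ?L / N \<and> (j = 0 \<longrightarrow> t = 0) \<and> (j = N \<longrightarrow> t = 1)" if j: "j \<le> N" for j
  proof -
    consider "j = 0" | "j = N" | "j \<noteq> 0" "j \<noteq> N" by blast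
    then show ?thesis
    proof cases
      case 1
      then show ?thesis using s01 N by (intro bexI[of _ 0]) auto
    next
      case 2
      then show ?thesis using s01 N by (intro bexI[of _ 1]) auto
    next
      case 3
      have "0 \<le> j * ?L / N" "j * ?L / N \<le> ?L"
        using L0 j N by (auto simp: field_simps intro!: mult_right_mono)
      then obtain t where "0 \<le> t" "t \<le> 1" "s t = j * ?L / N"
        using IVT'[of s 0 "j * ?L / N" 1] s01 conts by auto
      then show ?thesis using 3 by auto
    qed
  qed
  then obtain t where t: "\<And>j. j \<le> N \<Longrightarrow> t j \<in> {0..1}" "\<And>j. j \<le> N \<Longrightarrow> s (t j) = j * ?L / N"
      "t 0 = 0" "t N = 1"
    by (metis le_refl zero_le)
  have "norm (\<gamma> (t (Suc j)) - \<gamma> (t j)) \<le> ?L / N" if j: "j < N" for j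
  proof -
    have "norm (\<gamma> (t (Suc j)) - \<gamma> (t j)) \<le> \<bar>s (t (Suc j)) - s (t j)\<bar>"
    proof (cases "t j \<le> t (Suc j)")
      case True
      then show ?thesis using chord[of "t j" "t (Suc j)"] t(1) j by fastforce
    next
      case False
      then show ?thesis
        using chord[of "t (Suc j)" "t j"] t(1)[of j] t(1)[of "Suc j"] j by (simp add: norm_minus_commute)
    qed
    also have "\<dots> = ?L / N"
      using t(2)[of j] t(2)[of "Suc j"] j L0 by (simp add: diff_divide_distrib[symmetric] algebra_simps)
    finally show ?thesis .
  qed
  then have "discrete_energy N (\<lambda>j. \<gamma> (t j)) \<le> (\<Sum>j<N. (?L / N)\<^sup>2)"
    unfolding discrete_energy_def by (intro sum_mono power_mono) auto
  also have "\<dots> = ?L\<^sup>2 / N"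
    using N by (simp add: power2_eq_square)
  finally show ?thesis
    using t ends gM by (intro exI[of _ "\<lambda>j. \<gamma> (t j)"]) auto
qed

section \<open>Distance and minimal geodesics\<close>

lemma riem_dist_mono: "M \<subseteq> N \<Longrightarrow> riem_dist N x y \<le> riem_dist M x y"
  unfolding riem_dist_def by (rule INF_superset_mono) (auto simp: smooth_paths_def)

lemma Stiefel_subset_UNIV: "Stiefel U \<subseteq> Stiefel UNIV"
  by (auto simp: Stiefel_def)

text \<open>A minimizing sequence of paths in \<open>St(p,V)\<close> yields polygons in \<open>St(p,V)\<close>, then discrete
  geodesics in \<open>St(p,U)\<close> for the span \<open>U\<close> of \<open>C\<close>, and in the limit a geodesic in \<open>St(p,U)\<close> whose length is at most the distance
  in \<open>St(p,V)\<close>. As the distance in \<open>St(p,U)\<close> is at least the distance in \<open>St(p,V)\<close>, all three numbers agree.\<close>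

lemma Stiefel_minimal_geodesic:
  fixes x y :: "'v::real_inner ^ 'p::finite"
  assumes C: "orthonormal C" "card C = 2 * CARD('p)"
    and x: "x \<in> Stiefel (span C)" and y: "y \<in> Stiefel (span C)"
  shows "\<exists>\<gamma>. minimal_geodesic (Stiefel UNIV) x y \<gamma>"
    and "riem_dist (Stiefel (span C)) x y = riem_dist (Stiefel UNIV) x y"
proof -
  let ?d = "riem_dist (Stiefel UNIV) x y"
  have xU: "x \<in> Stiefel UNIV" and yU: "y \<in> Stiefel UNIV"
    using x y Stiefel_subset_UNIV by auto
  note sub = subspace_span[of C]
  have cl: "closed (span C)"
    by (rule closed_span_finite[OF orthonormal_finite[OF C(1)]])
  have flow: "\<exists>v u. tangential x v \<and> (\<forall>k. v $ k \<in> span C) \<and> norm v \<le> l \<and> u 0 = x \<and> u 1 = y \<and>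
     (\<forall>t::real. (u has_vector_derivative generator x v (u t)) (at t)) \<and> (\<forall>t k. u t $ k \<in> span C)"
    if L: "\<And>N. 0 \<le> L N" "L \<longlonglongrightarrow> l"
      and w: "\<And>N. 0 < N \<Longrightarrow> \<exists>w. w 0 = x \<and> w N = y \<and> (\<forall>j\<le>N. w j \<in> Stiefel UNIV) \<and>
        discrete_energy N w \<le> (L N)\<^sup>2 / N" for L :: "nat \<Rightarrow> real" and l
  proof -
    have "\<exists>z. z 0 = x \<and> z N = y \<and> discrete_geodesic N z \<and> z 1 \<in> Stiefel (span C) \<and>
        discrete_energy N z \<le> (L N)\<^sup>2 / N" if N: "0 < N" for N
    proof -
      obtain w where w: "w 0 = x" "w N = y" "\<And>j. j \<le> N \<Longrightarrow> w j \<in> Stiefel UNIV"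
          "discrete_energy N w \<le> (L N)\<^sup>2 / N"
        using w[OF N] by blast
      obtain z where "z 0 = w 0 \<and> z N = w N \<and> discrete_geodesic N z \<and>
          (\<forall>j\<le>N. z j \<in> Stiefel (span C)) \<and> discrete_energy N z \<le> discrete_energy N w"
        using discrete_geodesic_within[of C w N, OF C _ _ w(3)] w(1,2) x y by auto
      then show ?thesis
        using w N by (intro exI[of _ z]) auto
    qed
    then obtain z where z: "\<And>N. 0 < N \<Longrightarrow> z N 0 = x \<and> z N N = y \<and> discrete_geodesic N (z N) \<and>
        z N 1 \<in> Stiefel (span C) \<and> discrete_energy N (z N) \<le> (L N)\<^sup>2 / N"
      by metis
    show ?thesis
      by (rule discrete_geodesics_converge[OF C(1) x, of z y L l]) (use z L in auto)
  qed
  have geo: "critical_geodesic (Stiefel U) {0..1} u" "curve_length u 0 1 = norm v"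
      "u \<in> smooth_paths (Stiefel U) x y"
    if v: "tangential x v" and u: "u 0 = x" "u 1 = y"
      "\<And>t. (u has_vector_derivative generator x v (u t)) (at t)" "\<And>t k. u t $ k \<in> span C"
      and U: "U = UNIV \<or> U = span C"
    for u v U
  proof -
    have U': "subspace U" "closed U" "x \<in> Stiefel U" "\<And>t k. u t $ k \<in> U"
      using U sub cl x xU u(4) by auto
    have I: "is_interval {0..1::real}" "interior {0..1::real} \<noteq> {}"
      by (auto simp: is_interval_cc)
    note * = generator_flow_critical[OF U'(1,2) I U'(3) v u(1,3) U'(4)]
    show cg: "critical_geodesic (Stiefel U) {0..1} u"
      by (rule *(1))
    have "curve_length u 0 1 = integral {0..1::real} (\<lambda>t. norm v)"
      unfolding curve_length_def by (rule Henstock_Kurzweil_Integration.integral_cong) (rule *(2))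
    then show "curve_length u 0 1 = norm v"
      by simp
    show "u \<in> smooth_paths (Stiefel U) x y"
      using cg u(1,2) by (auto simp: smooth_paths_def critical_geodesic_def)
  qed
  \<comment> \<open>A Lipschitz path already gives polygons with energy of order \<open>1 / N\<close>, hence a geodesic from \<open>x\<close> to \<open>y\<close>.\<close>
  have fin: "?d < \<infinity>"
  proof -
    obtain L where L: "0 \<le> L" "\<And>N. 0 < N \<Longrightarrow> \<exists>z. z 0 = x \<and> z N = y \<and>
        (\<forall>j\<le>N. z j \<in> Stiefel UNIV) \<and> discrete_energy N z \<le> L\<^sup>2 / real N"
      using lipschitz_connected_polygon[OF Stiefel_lipschitz_connected[OF
            orthonormal_finite[OF C(1)] orthonormal_independent[OF C(1)] C(2) xU yU]] by blast
    obtain v u where vu: "tangential x v" "u 0 = x" "u 1 = y"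
        "\<And>t::real. (u has_vector_derivative generator x v (u t)) (at t)" "\<And>t k. u t $ k \<in> span C"
      using flow[of "\<lambda>_. L" L, OF L(1) tendsto_const L(2)] by blast
    have "?d \<le> ennreal (curve_length u 0 1)"
      unfolding riem_dist_def by (rule INF_lower) (rule geo(3)[OF vu], simp)
    also have "\<dots> < \<infinity>" by simp
    finally show ?thesis .
  qed
  define d where "d = enn2real ?d"
  have d: "?d = ennreal d" "0 \<le> d"
    using fin by (simp_all add: d_def)
  have "\<exists>w. w 0 = x \<and> w N = y \<and> (\<forall>j\<le>N. w j \<in> Stiefel UNIV) \<and>
        discrete_energy N w \<le> (d + 1 / N)\<^sup>2 / N" if N: "0 < N" for N :: nat
  proof -
    have "?d < ennreal (d + 1 / N)"
      using d N by (simp add: ennreal_less_iff)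
    then obtain \<gamma> where g: "\<gamma> \<in> smooth_paths (Stiefel UNIV) x y"
        "ennreal (curve_length \<gamma> 0 1) < ennreal (d + 1 / N)"
      unfolding riem_dist_def INF_less_iff by blast
    obtain w where w: "w 0 = x" "w N = y" "\<forall>j\<le>N. w j \<in> Stiefel UNIV"
        "discrete_energy N w \<le> (curve_length \<gamma> 0 1)\<^sup>2 / N"
      using smooth_path_polygon[OF g(1) N] by blast
    have "0 \<le> curve_length \<gamma> 0 1"
      unfolding curve_length_def
      by (cases "(\<lambda>t. norm (velocity {0..1} \<gamma> t)) integrable_on {0..1}")
        (simp_all add: Henstock_Kurzweil_Integration.integral_nonneg not_integrable_integral)
    moreover have "curve_length \<gamma> 0 1 \<le> d + 1 / N"
      using less_imp_le[OF g(2)] d(2) ennreal_le_iff[of "d + 1 / real N"] by auto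
    ultimately have "(curve_length \<gamma> 0 1)\<^sup>2 / N \<le> (d + 1 / N)\<^sup>2 / N"
      by (intro divide_right_mono power_mono) auto
    then show ?thesis
      using w by (intro exI[of _ w]) auto
  qed
  moreover have "(\<lambda>N. d + 1 / real N) \<longlonglongrightarrow> d"
    using tendsto_add[OF tendsto_const lim_1_over_n, of d] by simp
  ultimately obtain v u where vu: "tangential x v" "u 0 = x" "u 1 = y"
      "\<And>t::real. (u has_vector_derivative generator x v (u t)) (at t)" "\<And>t k. u t $ k \<in> span C"
      and le: "norm v \<le> d"
    using flow[of "\<lambda>N. d + 1 / real N" d] d(2) by fastforce
  note geoU = geo[OF vu, of UNIV, simplified] and geoC = geo[OF vu, of "span C", simplified]
  have 1: "riem_dist (Stiefel (span C)) x y \<le> ennreal (norm v)"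
    unfolding riem_dist_def geoC(2)[symmetric] by (rule INF_lower[OF geoC(3)])
  have 2: "ennreal (norm v) \<le> ?d"
    unfolding d(1) by (rule ennreal_leI[OF le])
  have 3: "?d \<le> riem_dist (Stiefel (span C)) x y"
    by (rule riem_dist_mono[OF Stiefel_subset_UNIV])
  show eq: "riem_dist (Stiefel (span C)) x y = ?d"
    using 1 2 3 by (intro antisym) auto
  have "ennreal (norm v) = ?d"
    using 1 2 3 by (intro antisym) auto
  then show "\<exists>\<gamma>. minimal_geodesic (Stiefel UNIV) x y \<gamma>"
    using geoU vu(2,3) unfolding minimal_geodesic_def by (intro exI[of _ u]) simp
qed

section \<open>Linear isometries of the ambient space\<close>

lemma smooth_curve_on_compose:
  assumes f: "bounded_linear f" and c: "smooth_curve_on I c"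
  shows "smooth_curve_on I (f \<circ> c)"
proof -
  obtain F where F: "F 0 = c" "\<And>n t. t \<in> I \<Longrightarrow> (F n has_vector_derivative F (Suc n) t) (at t within I)"
    using c unfolding smooth_curve_on_def by blast
  show ?thesis
    unfolding smooth_curve_on_def
    by (intro exI[of _ "\<lambda>n. f \<circ> F n"])
      (auto simp: F(1) o_def intro!: bounded_linear.has_vector_derivative[OF f] F(2))
qed

lemma velocity_compose:
  assumes I: "is_interval I" "interior I \<noteq> {}" and f: "bounded_linear f"
    and c: "smooth_curve_on I c" and t: "t \<in> I"
  shows "velocity I (f \<circ> c) t = f (velocity I c t)"
proof -
  have "(c has_vector_derivative velocity I c t) (at t within I)"
    using smooth_curve_velocity[OF I c] t by blast
  from bounded_linear.has_vector_derivative[OF f this]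
  have "((f \<circ> c) has_vector_derivative f (velocity I c t)) (at t within I)"
    by (simp add: o_def)
  then show ?thesis
    unfolding velocity_def[of I "f \<circ> c"]
    by (rule vector_derivative_within[OF at_within_interval_nontrivial[OF I t]])
qed

lemma curve_length_compose:
  assumes f: "bounded_linear f" "\<And>w. norm (f w) = norm w" and c: "smooth_curve_on {0..1} c"
  shows "curve_length (f \<circ> c) 0 1 = curve_length c 0 1"
  unfolding curve_length_def
  by (rule Henstock_Kurzweil_Integration.integral_cong) (simp add: velocity_compose[OF _ _ f(1) c] is_interval_cc f(2))

text \<open>Paths are carried over by \<open>f\<close> and pulled back by \<open>g\<close>; both preserve smoothness, and \<open>f\<close> preserves length.\<close>

lemma riem_dist_isometry:
  assumes f: "bounded_linear f" "\<And>w. norm (f w) = norm w"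
    and g: "bounded_linear g" "\<And>w. g (f w) = w"
  shows "riem_dist (f ` M) (f x) (f y) = riem_dist M x y"
proof (rule antisym)
  show "riem_dist (f ` M) (f x) (f y) \<le> riem_dist M x y"
    unfolding riem_dist_def
  proof (rule INF_mono)
    show "\<exists>\<delta>\<in>smooth_paths (f ` M) (f x) (f y). ennreal (curve_length \<delta> 0 1) \<le> ennreal (curve_length \<gamma> 0 1)"
      if "\<gamma> \<in> smooth_paths M x y" for \<gamma>
      using that smooth_curve_on_compose[OF f(1), of "{0..1}" \<gamma>] curve_length_compose[OF f, of \<gamma>]
      by (intro bexI[of _ "f \<circ> \<gamma>"]) (auto simp: smooth_paths_def)
  qed
  show "riem_dist M x y \<le> riem_dist (f ` M) (f x) (f y)"
    unfolding riem_dist_def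
  proof (rule INF_mono)
    fix \<gamma> assume \<gamma>: "\<gamma> \<in> smooth_paths (f ` M) (f x) (f y)"
    let ?c = "g \<circ> \<gamma>"
    have sm: "smooth_curve_on {0..1} \<gamma>" "smooth_curve_on {0..1} ?c"
      using \<gamma> smooth_curve_on_compose[OF g(1)] by (auto simp: smooth_paths_def)
    have fc: "f (?c t) = \<gamma> t" if "t \<in> {0..1}" for t
      using \<gamma> that g(2) by (auto simp: smooth_paths_def image_subset_iff) (metis atLeastAtMost_iff image_iff)
    have I: "is_interval {0..1::real}" "interior {0..1::real} \<noteq> {}"
      by (auto simp: is_interval_cc)
    have "velocity {0..1} (f \<circ> ?c) t = velocity {0..1} \<gamma> t" if t: "t \<in> {0..1}" for t
    proof -
      have "(\<gamma> has_vector_derivative velocity {0..1} \<gamma> t) (at t within {0..1})"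
        using smooth_curve_velocity[OF I sm(1)] t by blast
      then have "((f \<circ> ?c) has_vector_derivative velocity {0..1} \<gamma> t) (at t within {0..1})"
        by (rule has_vector_derivative_transform[OF t, rotated]) (use fc in auto)
      then show ?thesis
        unfolding velocity_def[of _ "f \<circ> ?c"]
        by (rule vector_derivative_within[OF at_within_interval_nontrivial[OF I t]])
    qed
    then have "curve_length (f \<circ> ?c) 0 1 = curve_length \<gamma> 0 1"
      unfolding curve_length_def by (intro Henstock_Kurzweil_Integration.integral_cong) auto
    then have "curve_length ?c 0 1 = curve_length \<gamma> 0 1"
      using curve_length_compose[OF f sm(2)] by simp
    moreover have "?c ` {0..1} \<subseteq> M" "?c 0 = x" "?c 1 = y"
      using \<gamma> g(2) by (auto simp: smooth_paths_def image_subset_iff)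
    ultimately show "\<exists>\<delta>\<in>smooth_paths M x y. ennreal (curve_length \<delta> 0 1) \<le> ennreal (curve_length \<gamma> 0 1)"
      using sm(2) by (intro bexI[of _ ?c]) (auto simp: smooth_paths_def)
  qed
qed

lemma isometry_range:
  fixes i :: "'w::euclidean_space \<Rightarrow> 'v::real_inner"
  assumes lin: "linear i" and iso: "\<And>u v. i u \<bullet> i v = u \<bullet> v"
  shows "\<exists>C. orthonormal C \<and> card C = DIM('w) \<and> range i = span C"
proof -
  have inj: "inj i"
    by (rule injI) (metis iso inner_eq_zero_iff right_minus_eq linear_diff[OF lin])
  have "orthonormal (i ` Basis)"
    using inj by (auto simp: orthonormal_def iso inner_Basis inj_eq)
  moreover have "card (i ` Basis) = DIM('w)"
    using inj by (intro card_image) (auto intro: inj_on_subset)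
  moreover have "range i = span (i ` Basis)"
    using linear_span_image[OF lin, of Basis] by simp
  ultimately show ?thesis by blast
qed

lemma isometry_left_inverse:
  fixes i :: "'w::euclidean_space \<Rightarrow> 'v::real_inner"
  assumes lin: "linear i" and iso: "\<And>u v. i u \<bullet> i v = u \<bullet> v"
  shows "\<exists>g. bounded_linear g \<and> (\<forall>w. g (i w) = w)"
proof -
  have "bounded_linear (\<lambda>v. \<Sum>b\<in>Basis. (v \<bullet> i b) *\<^sub>R b)"
    by (intro bounded_linear_sum bounded_linear_scaleR_const bounded_linear_inner_left)
  then show ?thesis
    by (intro exI[of _ "\<lambda>v. \<Sum>b\<in>Basis. (v \<bullet> i b) *\<^sub>R b"]) (simp add: iso euclidean_representation)
qed

lemma induced_map_Stiefel:
  fixes i :: "'w::real_inner \<Rightarrow> 'v::real_inner"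
  assumes lin: "linear i" and iso: "\<And>u v. i u \<bullet> i v = u \<bullet> v"
  shows "induced_map i ` (Stiefel UNIV :: ('w ^ 'p::finite) set) = Stiefel (range i)"
proof -
  have sub: "subspace (range i)"
    using lin by (intro linear_subspace_image) auto
  have iff: "induced_map i x \<in> Stiefel UNIV \<longleftrightarrow> x \<in> Stiefel UNIV" for x :: "'w ^ 'p"
    by (simp add: Stiefel_iff_orthonormal iso)
  show ?thesis
  proof (intro subset_antisym subsetI)
    fix y :: "'v ^ 'p" assume y: "y \<in> Stiefel (range i)"
    then obtain x where x: "\<And>k. y $ k = i (x k)"
      unfolding Stiefel_subspace_iff[OF sub] by (auto simp: image_iff) metis
    then have "y = induced_map i (\<chi> k. x k)"
      by (simp add: vec_eq_iff)
    then show "y \<in> induced_map i ` Stiefel UNIV"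
      using y iff unfolding Stiefel_subspace_iff[OF sub] by blast
  qed (auto simp: Stiefel_subspace_iff[OF sub] iff)
qed

lemma norm_induced_map:
  assumes iso: "\<And>u v. i u \<bullet> i v = u \<bullet> v"
  shows "norm (induced_map i x) = norm x"
  by (simp add: norm_eq_sqrt_inner inner_vec_def iso)

text \<open>The distance in \<open>St(p,W)\<close> is the distance in \<open>St(p,U)\<close> for the image \<open>U\<close> of \<open>W\<close>, which
  has dimension \<open>2p\<close> and so carries the distance of \<open>St(p,V)\<close>.\<close>

lemma riem_dist_induced_map:
  fixes i :: "'w::euclidean_space \<Rightarrow> 'v::real_inner" and x y :: "'w ^ 'p::finite"
  assumes dimW: "DIM('w) = 2 * CARD('p)"
    and lin: "linear i" and iso: "\<And>u v. i u \<bullet> i v = u \<bullet> v"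
    and x: "x \<in> Stiefel UNIV" and y: "y \<in> Stiefel UNIV"
  shows "riem_dist (Stiefel UNIV) (induced_map i x) (induced_map i y) = riem_dist (Stiefel UNIV) x y"
proof -
  obtain C where C: "orthonormal C" "card C = 2 * CARD('p)" "range i = span C"
    using isometry_range[OF lin iso] dimW by metis
  obtain g where g: "bounded_linear g" "\<And>w. g (i w) = w"
    using isometry_left_inverse[OF lin iso] by blast
  have bl: "bounded_linear i"
    using lin by (simp add: linear_conv_bounded_linear)
  have img: "induced_map i ` Stiefel UNIV = (Stiefel (span C) :: ('v ^ 'p) set)"
    using induced_map_Stiefel[OF lin iso] C(3) by simp
  have gi: "induced_map g (induced_map i w) = w" for w :: "'w ^ 'p"
    by (simp add: vec_eq_iff g(2))
  have "riem_dist (Stiefel UNIV) x y = riem_dist (Stiefel (span C)) (induced_map i x) (induced_map i y)"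
    unfolding img[symmetric]
    by (rule riem_dist_isometry[symmetric, OF bounded_linear_induced_map[OF bl] norm_induced_map[OF iso]
          bounded_linear_induced_map[OF g(1)] gi])
  also have "\<dots> = riem_dist (Stiefel UNIV) (induced_map i x) (induced_map i y)"
    by (rule Stiefel_minimal_geodesic(2)[OF C(1,2)]) (use img x y in auto)
  finally show ?thesis by simp
qed

section \<open>Geodesics in subspaces and the cut locus\<close>

text \<open>The geodesic equation is the same for both manifolds.\<close>

lemma critical_geodesic_subspace_mono:
  fixes \<gamma> :: "real \<Rightarrow> 'v::real_inner ^ 'p::finite"
  assumes U: "subspace U" "closed U" and I: "is_interval I" "interior I \<noteq> {}"
    and c: "critical_geodesic (Stiefel U) I \<gamma>"
  shows "critical_geodesic (Stiefel UNIV) I \<gamma>"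
  using c Stiefel_subset_UNIV[of U]
  unfolding critical_geodesic_Stiefel_iff[OF U I] critical_geodesic_Stiefel_iff[OF subspace_UNIV closed_UNIV I]
  by auto

lemma critical_geodesic_induced_map:
  fixes \<gamma> :: "real \<Rightarrow> 'w::real_inner ^ 'p::finite" and i :: "'w \<Rightarrow> 'v::real_inner"
  assumes bl: "bounded_linear i" and iso: "\<And>u v. i u \<bullet> i v = u \<bullet> v"
    and I: "is_interval I" "interior I \<noteq> {}" and c: "critical_geodesic (Stiefel UNIV) I \<gamma>"
  shows "critical_geodesic (Stiefel UNIV) I (induced_map i \<circ> \<gamma>)"
proof -
  note iff = critical_geodesic_Stiefel_iff[OF subspace_UNIV closed_UNIV I]
  note lin = bounded_linear.linear[OF bl]
  note bi = bounded_linear_induced_map[OF bl]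
  have sm: "smooth_curve_on I \<gamma>" and St: "\<gamma> ` I \<subseteq> Stiefel UNIV"
    and eq: "\<And>t. t \<in> I \<Longrightarrow> (velocity I \<gamma> has_vector_derivative - rmult (\<gamma> t) (gram (velocity I \<gamma> t))) (at t within I)"
    using c unfolding iff by auto
  note vel = velocity_compose[OF I bi sm]
  have gm: "gram (induced_map i w) = gram w" for w :: "'w ^ 'p"
    by (simp add: gram_def fun_eq_iff iso)
  have rm: "rmult (induced_map i w) S = induced_map i (rmult w S)" for w :: "'w ^ 'p" and S
    by (simp add: rmult_def vec_eq_iff linear_sum[OF lin] linear_scale[OF lin])
  have "(velocity I (induced_map i \<circ> \<gamma>) has_vector_derivative
      - rmult ((induced_map i \<circ> \<gamma>) t) (gram (velocity I (induced_map i \<circ> \<gamma>) t))) (at t within I)"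
    if t: "t \<in> I" for t
  proof (rule has_vector_derivative_transform[OF t vel])
    show "((\<lambda>t. induced_map i (velocity I \<gamma> t)) has_vector_derivative
      - rmult ((induced_map i \<circ> \<gamma>) t) (gram (velocity I (induced_map i \<circ> \<gamma>) t))) (at t within I)"
      using bounded_linear.has_vector_derivative[OF bi eq[OF t]]
      by (simp add: vel[OF t] gm rm linear_neg[OF bounded_linear.linear[OF bi]])
  qed
  moreover have "(induced_map i \<circ> \<gamma>) ` I \<subseteq> Stiefel UNIV"
    using St by (auto simp: Stiefel_iff_orthonormal iso)
  ultimately show ?thesis
    unfolding iff using smooth_curve_on_compose[OF bi sm] by auto
qed

text \<open>The geodesic stays in any subspace that contains the \<open>2p\<close> vectors of its position and velocity
  at one time.\<close>

lemma critical_geodesic_in_subspace: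
  fixes \<gamma> :: "real \<Rightarrow> 'v::real_inner ^ 'p::finite"
  assumes dimV: "finite (B::'v set)" "independent B" "card B = 2 * CARD('p)"
    and I: "is_interval I" "interior I \<noteq> {}" and c: "critical_geodesic (Stiefel UNIV) I \<gamma>"
    and s: "s \<in> I"
  shows "\<exists>C. orthonormal C \<and> card C = 2 * CARD('p) \<and> \<gamma> ` I \<subseteq> Stiefel (span C) \<and>
    critical_geodesic (Stiefel (span C)) I \<gamma>"
proof -
  let ?x = "\<gamma> s" and ?v = "velocity I \<gamma> s"
  note ode = critical_geodesic_ode[OF subspace_UNIV closed_UNIV I c s]
  let ?F = "range (($) ?x) \<union> range (($) ?v)"
  note cF = finite_card_two_frames[of ?x ?v]
  obtain C where C: "orthonormal C" "?F \<subseteq> span C" "card C = 2 * CARD('p)"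
    using orthonormal_superset_of_card[OF dimV cF] by blast
  have inC: "\<gamma> t $ k \<in> span C" if "t \<in> I" for t k
    by (rule generator_flow_in_span[OF C(1) _ _ I(1) ode s that]) (use C(2) in auto)
  note cl = closed_span_finite[OF orthonormal_finite[OF C(1)]]
  have St: "\<gamma> ` I \<subseteq> Stiefel (span C)"
  proof (rule image_subsetI)
    fix t assume "t \<in> I"
    then show "\<gamma> t \<in> Stiefel (span C)"
      using c inC unfolding Stiefel_subspace_iff[OF subspace_span, of _ C] critical_geodesic_def by blast
  qed
  moreover have "critical_geodesic (Stiefel (span C)) I \<gamma>"
    using c St unfolding critical_geodesic_Stiefel_iff[OF subspace_span cl I]
      critical_geodesic_Stiefel_iff[OF subspace_UNIV closed_UNIV I] by auto
  ultimately show ?thesis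
    using C by blast
qed

text \<open>A geodesic ray lies in some \<open>St(p,U)\<close> with \<open>dim U = 2p\<close>, and it is a geodesic there if and only if it is
  one of \<open>St(p,V)\<close>. As the distances agree, it is minimizing up to the same times in both.\<close>

lemma in_cut_locus_Stiefel_iff:
  fixes x y :: "'v::real_inner ^ 'p::finite"
  assumes dimV: "finite (B::'v set)" "independent B" "card B = 2 * CARD('p)"
  shows "in_cut_locus (Stiefel UNIV) x y \<longleftrightarrow>
        (\<exists>W'. subspace W' \<and> dim W' = 2 * CARD('p) \<and>
              x \<in> Stiefel W' \<and> y \<in> Stiefel W' \<and> in_cut_locus (Stiefel W') x y)"
proof -
  have I: "is_interval {0::real..}" "interior {0::real..} \<noteq> {}"
    by (auto simp: is_interval_ci)
  have sets: "{t. 0 \<le> t \<and> ennreal (curve_length \<gamma> 0 t) = riem_dist (Stiefel (span C)) (\<gamma> 0) (\<gamma> t)} =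
      {t. 0 \<le> t \<and> ennreal (curve_length \<gamma> 0 t) = riem_dist (Stiefel UNIV) (\<gamma> 0) (\<gamma> t)}"
    if C: "orthonormal C" "card C = 2 * CARD('p)" and St: "\<gamma> ` {0..} \<subseteq> Stiefel (span C)"
    for C :: "'v set" and \<gamma> :: "real \<Rightarrow> 'v ^ 'p"
  proof -
    have "riem_dist (Stiefel (span C)) (\<gamma> 0) (\<gamma> t) = riem_dist (Stiefel UNIV) (\<gamma> 0) (\<gamma> t)" if "0 \<le> t" for t
      by (rule Stiefel_minimal_geodesic(2)[OF C]) (use St that in auto)
    then show ?thesis by auto
  qed
  show ?thesis
  proof
    assume "in_cut_locus (Stiefel UNIV) x y"
    then obtain \<gamma> where g: "critical_geodesic (Stiefel UNIV) {0..} \<gamma>" "\<gamma> 0 = x" "\<gamma> 1 = y"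
      "(SUP t\<in>{t. 0 \<le> t \<and> ennreal (curve_length \<gamma> 0 t) = riem_dist (Stiefel UNIV) (\<gamma> 0) (\<gamma> t)}. ereal t) = 1"
      unfolding in_cut_locus_def by blast
    obtain C where C: "orthonormal C" "card C = 2 * CARD('p)" and St: "\<gamma> ` {0..} \<subseteq> Stiefel (span C)"
        and cg: "critical_geodesic (Stiefel (span C)) {0..} \<gamma>"
      using critical_geodesic_in_subspace[OF dimV I g(1), of 0] by auto
    have "in_cut_locus (Stiefel (span C)) x y"
      unfolding in_cut_locus_def using cg g sets[OF C St] by (intro exI[of _ \<gamma>]) simp
    moreover have "x \<in> Stiefel (span C)" "y \<in> Stiefel (span C)"
      using St g(2,3) by auto
    ultimately show "\<exists>W'. subspace W' \<and> dim W' = 2 * CARD('p) \<and>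
              x \<in> Stiefel W' \<and> y \<in> Stiefel W' \<and> in_cut_locus (Stiefel W') x y"
      using dim_span_orthonormal[OF C(1)] C(2) subspace_span by metis
  next
    assume "\<exists>W'. subspace W' \<and> dim W' = 2 * CARD('p) \<and>
              x \<in> Stiefel W' \<and> y \<in> Stiefel W' \<and> in_cut_locus (Stiefel W') x y"
    then obtain W' where W: "subspace W'" "dim W' = 2 * CARD('p)" "in_cut_locus (Stiefel W') x y"
      by blast
    obtain C where C: "orthonormal C" "span C = W'" "card C = 2 * CARD('p)"
      using orthonormal_basis_exists[OF W(1,2)] by auto
    obtain \<gamma> where g: "critical_geodesic (Stiefel (span C)) {0..} \<gamma>" "\<gamma> 0 = x" "\<gamma> 1 = y"
      "(SUP t\<in>{t. 0 \<le> t \<and> ennreal (curve_length \<gamma> 0 t) = riem_dist (Stiefel (span C)) (\<gamma> 0) (\<gamma> t)}. ereal t) = 1"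
      using W(3) unfolding in_cut_locus_def C(2) by blast
    have "\<gamma> ` {0..} \<subseteq> Stiefel (span C)"
      using g(1) by (simp add: critical_geodesic_def)
    from sets[OF C(1,3) this] show "in_cut_locus (Stiefel UNIV) x y"
      unfolding in_cut_locus_def
      using g critical_geodesic_subspace_mono[OF subspace_span closed_span_finite[OF orthonormal_finite[OF C(1)]] I g(1)]
      by (intro exI[of _ \<gamma>]) simp
  qed
qed

section \<open>The isometric embedding and the diameter\<close>

lemma differentiable_times_on_const: "differentiable_times_on n UNIV (\<lambda>x. c)"
  by (induction n arbitrary: c) (auto simp: frechet_derivative_const)

lemma smooth_map_bounded_linear:
  assumes "bounded_linear f"
  shows "smooth_map_on UNIV f"
proof -
  have fd: "frechet_derivative f (at x) = f" for x
    using frechet_derivative_at[OF bounded_linear_imp_has_derivative[OF assms]] by simp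
  have "differentiable_times_on n UNIV f" for n
  proof (cases n)
    case 0
    then show ?thesis
      using linear_continuous_on[OF assms] by simp
  next
    case (Suc m)
    then show ?thesis
      using bounded_linear_imp_differentiable[OF assms] by (simp add: fd differentiable_times_on_const)
  qed
  then show ?thesis by (simp add: smooth_map_on_def)
qed

lemma isometric_embedding_induced_map:
  fixes i :: "'w::euclidean_space \<Rightarrow> 'v::real_inner"
  assumes lin: "linear i" and iso: "\<And>u v. i u \<bullet> i v = u \<bullet> v"
  shows "isometric_embedding (Stiefel UNIV :: ('w ^ 'p::finite) set) (Stiefel UNIV) (induced_map i)"
proof -
  let ?f = "induced_map i :: 'w ^ 'p \<Rightarrow> 'v ^ 'p"
  obtain g where g: "bounded_linear g" "\<And>w. g (i w) = w"
    using isometry_left_inverse[OF lin iso] by blast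
  have bl: "bounded_linear ?f"
    using lin by (intro bounded_linear_induced_map) (simp add: linear_conv_bounded_linear)
  have gi: "induced_map g (?f w) = w" for w
    by (simp add: vec_eq_iff g(2))
  have "homeomorphism (Stiefel UNIV) (?f ` Stiefel UNIV) ?f (induced_map g)"
    by (intro homeomorphismI linear_continuous_on bl bounded_linear_induced_map g(1)) (auto simp: gi)
  moreover have "?f ` Stiefel UNIV \<subseteq> Stiefel UNIV"
    by (auto simp: Stiefel_iff_orthonormal iso)
  moreover have "frechet_derivative ?f (at x) = ?f" for x
    using frechet_derivative_at[OF bounded_linear_imp_has_derivative[OF bl]] by simp
  moreover have "?f v \<bullet> ?f w = v \<bullet> w" for v w
    by (simp add: inner_vec_def iso)
  ultimately show ?thesis
    unfolding isometric_embedding_def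
    using smooth_map_bounded_linear[OF bl]
    by (intro conjI ballI exI[of _ UNIV] exI[of _ ?f]) auto
qed

lemma euclidean_isometry_onto:
  fixes C :: "'v::real_inner set"
  assumes C: "orthonormal C" "card C = DIM('e::euclidean_space)"
  shows "\<exists>f :: 'e \<Rightarrow> 'v. linear f \<and> (\<forall>u v. f u \<bullet> f v = u \<bullet> v) \<and> range f = span C"
proof -
  obtain \<phi> where \<phi>: "bij_betw \<phi> (Basis :: 'e set) C"
    using finite_same_card_bij[OF finite_Basis orthonormal_finite[OF C(1)]] C(2) by metis
  then have "inj_on \<phi> Basis" "\<phi> ` Basis = C"
    by (auto simp: bij_betw_def)
  from orthonormal_transfer[OF orthonormal_Basis C(1) this(1)] this(2)
  obtain f where f: "bounded_linear f" "\<forall>c\<in>Basis. f c = \<phi> c"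
      "\<forall>v\<in>span Basis. \<forall>w\<in>span Basis. f v \<bullet> f w = v \<bullet> w"
    by auto
  have "f ` Basis = C"
    using f(2) \<open>\<phi> ` Basis = C\<close> by auto
  then have "range f = span C"
    using linear_span_image[OF bounded_linear.linear[OF f(1)], of Basis] by simp
  then show ?thesis
    using f bounded_linear.linear[OF f(1)] by (intro exI[of _ f]) simp
qed

lemma riem_dist_le_diameter:
  assumes "x \<in> M" "y \<in> M"
  shows "riem_dist M x y \<le> riem_diameter M"
  unfolding riem_diameter_def by (rule SUP_upper2[OF assms(1) SUP_upper[OF assms(2)]])

text \<open>Every pair of points lies in some \<open>St(p,U)\<close> with \<open>dim U = 2p\<close>, a copy of \<open>St(p,E)\<close> with
  the same distances.\<close>

lemma riem_diameter_Stiefel: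
  fixes B :: "'v::real_inner set"
  assumes dimV: "finite B" "independent B" "card B = 2 * CARD('p::finite)"
    and dimE: "DIM('e::euclidean_space) = 2 * CARD('p)"
  shows "riem_diameter (Stiefel UNIV :: ('v ^ 'p) set) = riem_diameter (Stiefel UNIV :: ('e ^ 'p) set)"
proof (rule antisym)
  show "riem_diameter (Stiefel UNIV :: ('v ^ 'p) set) \<le> riem_diameter (Stiefel UNIV :: ('e ^ 'p) set)"
    unfolding riem_diameter_def[of "Stiefel UNIV :: ('v ^ 'p) set"]
  proof (intro SUP_least)
    fix x y :: "'v ^ 'p" assume x: "x \<in> Stiefel UNIV" and y: "y \<in> Stiefel UNIV"
    let ?F = "range (($) x) \<union> range (($) y)"
    note cF = finite_card_two_frames[of x y]
    obtain C where C: "orthonormal C" "?F \<subseteq> span C" "card C = 2 * CARD('p)"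
      using orthonormal_superset_of_card[OF dimV cF] by blast
    obtain f :: "'e \<Rightarrow> 'v" where f: "linear f" "\<And>u v. f u \<bullet> f v = u \<bullet> v" "range f = span C"
      using euclidean_isometry_onto[OF C(1)] C(3) dimE by metis
    have "x \<in> induced_map f ` Stiefel UNIV" "y \<in> induced_map f ` Stiefel UNIV"
      unfolding induced_map_Stiefel[OF f(1,2)] f(3) using x y C(2)
      by (auto simp: Stiefel_subspace_iff[OF subspace_span, of _ C])
    then obtain x' y' :: "'e ^ 'p" where x': "x' \<in> Stiefel UNIV" "y' \<in> Stiefel UNIV"
        "x = induced_map f x'" "y = induced_map f y'"
      by auto
    have "riem_dist (Stiefel UNIV) x y = riem_dist (Stiefel UNIV) x' y'"
      unfolding x'(3,4) by (rule riem_dist_induced_map[OF dimE f(1,2) x'(1,2)])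
    also have "\<dots> \<le> riem_diameter (Stiefel UNIV :: ('e ^ 'p) set)"
      by (rule riem_dist_le_diameter[OF x'(1,2)])
    finally show "riem_dist (Stiefel UNIV) x y \<le> riem_diameter (Stiefel UNIV :: ('e ^ 'p) set)" .
  qed
  obtain C :: "'v set" where C: "orthonormal C" "card C = 2 * CARD('p)"
    using orthonormal_superset_of_card[OF dimV, of "{}"] by auto
  obtain f :: "'e \<Rightarrow> 'v" where f: "linear f" "\<And>u v. f u \<bullet> f v = u \<bullet> v"
    using euclidean_isometry_onto[OF C(1)] C(2) dimE by metis
  show "riem_diameter (Stiefel UNIV :: ('e ^ 'p) set) \<le> riem_diameter (Stiefel UNIV :: ('v ^ 'p) set)"
    unfolding riem_diameter_def[of "Stiefel UNIV :: ('e ^ 'p) set"]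
  proof (intro SUP_least)
    fix x y :: "'e ^ 'p" assume x: "x \<in> Stiefel UNIV" and y: "y \<in> Stiefel UNIV"
    have "induced_map f x \<in> Stiefel UNIV" "induced_map f y \<in> Stiefel UNIV"
      using x y by (auto simp: Stiefel_iff_orthonormal f(2))
    then show "riem_dist (Stiefel UNIV) x y \<le> riem_diameter (Stiefel UNIV :: ('v ^ 'p) set)"
      unfolding riem_dist_induced_map[OF dimE f x y, symmetric] by (rule riem_dist_le_diameter)
  qed
qed

theorem theorem3p1:
  fixes i :: "'w::euclidean_space \<Rightarrow> 'v::{real_inner,complete_space}"
  assumes dimV: "\<exists>B::'v set. finite B \<and> independent B \<and> card B = 2 * CARD('p::finite)"
    and dimW: "DIM('w) = 2 * CARD('p)"
    and linear_i: "linear i"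
    and isometric_i: "\<forall>u v. i u \<bullet> i v = u \<bullet> v"
  shows
    "isometric_embedding (Stiefel UNIV :: ('w ^ 'p) set) (Stiefel UNIV :: ('v ^ 'p) set)
       (induced_map i) \<and>
     totally_geodesic (induced_map i ` (Stiefel UNIV :: ('w ^ 'p) set))
       (Stiefel UNIV :: ('v ^ 'p) set) \<and>
     (\<forall>x\<in>(Stiefel UNIV :: ('w ^ 'p) set). \<forall>y\<in>Stiefel UNIV.
        riem_dist (Stiefel UNIV) x y =
        riem_dist (Stiefel UNIV) (induced_map i x) (induced_map i y)) \<and>
     (\<forall>x\<in>(Stiefel UNIV :: ('w ^ 'p) set). \<forall>y\<in>Stiefel UNIV. \<forall>\<gamma>.
        minimal_geodesic (Stiefel UNIV) x y \<gamma> \<longrightarrow>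
        minimal_geodesic (Stiefel UNIV) (induced_map i x) (induced_map i y) (induced_map i \<circ> \<gamma>)) \<and>
     riem_diameter (Stiefel UNIV :: ('v ^ 'p) set) =
       riem_diameter (Stiefel UNIV :: ((real ^ ('p + 'p)) ^ 'p) set) \<and>
     (\<forall>x\<in>(Stiefel UNIV :: ('v ^ 'p) set). \<forall>y\<in>Stiefel UNIV. \<exists>\<gamma>.
        minimal_geodesic (Stiefel UNIV) x y \<gamma>) \<and>
     (\<forall>(x :: 'v ^ 'p) y \<gamma>. minimal_geodesic (Stiefel UNIV) x y \<gamma> \<longrightarrow>
        (\<exists>U. subspace U \<and> dim U = 2 * CARD('p) \<and> \<gamma> ` {0..1} \<subseteq> Stiefel U)) \<and>
     (\<forall>x\<in>(Stiefel UNIV :: ('v ^ 'p) set). \<forall>y\<in>Stiefel UNIV.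
        in_cut_locus (Stiefel UNIV) x y \<longleftrightarrow>
        (\<exists>W'. subspace W' \<and> dim W' = 2 * CARD('p) \<and>
              x \<in> Stiefel W' \<and> y \<in> Stiefel W' \<and> in_cut_locus (Stiefel W') x y))"
proof (intro conjI ballI allI impI)
  obtain B :: "'v set" where B: "finite B" "independent B" "card B = 2 * CARD('p)"
    using dimV by blast
  have iso: "\<And>u v. i u \<bullet> i v = u \<bullet> v"
    using isometric_i by blast
  have bl: "bounded_linear i"
    using linear_i by (simp add: linear_conv_bounded_linear)
  have I01: "is_interval {0..1::real}" "interior {0..1::real} \<noteq> {}"
    by (auto simp: is_interval_cc)
  show "isometric_embedding (Stiefel UNIV :: ('w ^ 'p) set) (Stiefel UNIV :: ('v ^ 'p) set) (induced_map i)"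
    by (rule isometric_embedding_induced_map[OF linear_i iso])
  show "totally_geodesic (induced_map i ` (Stiefel UNIV :: ('w ^ 'p) set)) (Stiefel UNIV :: ('v ^ 'p) set)"
  proof -
    obtain C where C: "orthonormal C" "range i = span C"
      using isometry_range[OF linear_i iso] by blast
    show ?thesis
      unfolding induced_map_Stiefel[OF linear_i iso] C(2) totally_geodesic_def
      using Stiefel_subset_UNIV critical_geodesic_subspace_mono[OF subspace_span
          closed_span_finite[OF orthonormal_finite[OF C(1)]]] by blast
  qed
  show dist: "riem_dist (Stiefel UNIV) x y = riem_dist (Stiefel UNIV) (induced_map i x) (induced_map i y)"
    if "x \<in> Stiefel UNIV" "y \<in> Stiefel UNIV" for x y :: "'w ^ 'p"
    using riem_dist_induced_map[OF dimW linear_i iso that] by simp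
  show "minimal_geodesic (Stiefel UNIV) (induced_map i x) (induced_map i y) (induced_map i \<circ> \<gamma>)"
    if "x \<in> Stiefel UNIV" "y \<in> Stiefel UNIV" "minimal_geodesic (Stiefel UNIV) x y \<gamma>"
    for x y :: "'w ^ 'p" and \<gamma>
    using that(3) critical_geodesic_induced_map[OF bl iso I01, of \<gamma>] dist[OF that(1,2)]
      curve_length_compose[OF bounded_linear_induced_map[OF bl] norm_induced_map[OF iso], of \<gamma>]
    by (auto simp: minimal_geodesic_def critical_geodesic_def)
  show "riem_diameter (Stiefel UNIV :: ('v ^ 'p) set) =
       riem_diameter (Stiefel UNIV :: ((real ^ ('p + 'p)) ^ 'p) set)"
    by (rule riem_diameter_Stiefel[OF B]) (simp add: card_UNIV_sum)
  show "\<exists>\<gamma>. minimal_geodesic (Stiefel UNIV) x y \<gamma>"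
    if x: "x \<in> Stiefel UNIV" and y: "y \<in> Stiefel UNIV" for x y :: "'v ^ 'p"
  proof -
    let ?F = "range (($) x) \<union> range (($) y)"
    note cF = finite_card_two_frames[of x y]
    obtain C where C: "orthonormal C" "?F \<subseteq> span C" "card C = 2 * CARD('p)"
      using orthonormal_superset_of_card[OF B cF] by blast
    have "x \<in> Stiefel (span C)" "y \<in> Stiefel (span C)"
      using x y C(2) by (auto simp: Stiefel_subspace_iff[OF subspace_span, of _ C])
    from Stiefel_minimal_geodesic(1)[OF C(1,3) this] show ?thesis by blast
  qed
  show "\<exists>U. subspace U \<and> dim U = 2 * CARD('p) \<and> \<gamma> ` {0..1} \<subseteq> Stiefel U"
    if "minimal_geodesic (Stiefel UNIV) x y \<gamma>" for x y :: "'v ^ 'p" and \<gamma>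
  proof -
    have "critical_geodesic (Stiefel UNIV) {0..1} \<gamma>"
      using that by (simp add: minimal_geodesic_def)
    from critical_geodesic_in_subspace[OF B I01 this, of 0]
    show ?thesis
      using dim_span_orthonormal subspace_span by (metis atLeastAtMost_iff order_refl zero_le_one)
  qed
  show "in_cut_locus (Stiefel UNIV) x y \<longleftrightarrow>
        (\<exists>W'. subspace W' \<and> dim W' = 2 * CARD('p) \<and>
              x \<in> Stiefel W' \<and> y \<in> Stiefel W' \<and> in_cut_locus (Stiefel W') x y)" for x y :: "'v ^ 'p"
    by (rule in_cut_locus_Stiefel_iff[OF B])
qed

end
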